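(* There is a polynomial-time 2-approximation algorithm for \textsf{MINCONNECTIVITY} on a path with both preemptive and non-preemptive maintenance jobs.
   Context: An instance consists of a graph $G=(V,E)$ which is a path from $s^+$ to $s^-$ and, for every edge $e$, a maintenance job with processing time $p_e\in\mathbb{Z}_{\ge0}$, release date $r_e$ and deadline $d_e$ (nonnegative integers), each job designated either preemptive or non-preemptive. A schedule assigns to each edge $e$ a finite set of disjoint intervals $S(e)$ within $[r_e,d_e]$ of total length $p_e$, where $S(e)$ is a single interval if the job is non-preemptive (preemptive jobs may be interrupted at arbitrary real times). Edge $e$ is unavailable during $S(e)$; arbitrarily many edges may be maintained simultaneously. Time horizon $T=\max_e d_e$. On a path, the network is disconnected at time $t$ iff some edge is maintained at $t$. \textsf{MINCONNECTIVITY} minimizes the measure of disconnected times in $[0,T]$; a 2-approximation returns a feasible schedule with value at most twice the optimum. *)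

theory Defs
  imports "HOL-Analysis.Analysis" "HOL-Computational_Algebra.Polynomial" "HOL-Library.Log_Nat"
    "HOL-Library.Multiset"
begin

section \<open>Computation model: while programs on a RAM with logarithmic cost\<close>

text \<open>
  The memory consists of finitely many (those named in the program) unbounded integer arrays;
  a scalar variable is the cell with index 0 of an array. As in the classical logarithmic-cost
  RAM, every intermediate value, addresses included, is charged its bit length, so polynomial
  cost in this model coincides with polynomial time on Turing machines. Output is written
  item by item, so that its length is charged as well.
\<close>

type_synonym vname = string
type_synonym memory = "vname \<Rightarrow> int \<Rightarrow> int"

datatype aexp =
    N int
  | Cell vname aexp
  | Plus aexp aexp
  | Minus aexp aexp
  | Times aexp aexp

datatype bexp =
    Less aexp aexp
  | BNot bexp
  | BAnd bexp bexp

datatype com =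
    SKIP
  | Store vname aexp aexp  \<comment> \<open>\<open>Store x i e\<close> is \<open>x[i] := e\<close>\<close>
  | Write aexp
  | Seq com com
  | If bexp com com
  | While bexp com

definition int_size :: "int \<Rightarrow> nat" where
  "int_size x = 1 + floorlog 2 (nat \<bar>x\<bar>)"

fun aval :: "aexp \<Rightarrow> memory \<Rightarrow> int" where
  "aval (N k) m = k"
| "aval (Cell x i) m = m x (aval i m)"
| "aval (Plus a b) m = aval a m + aval b m"
| "aval (Minus a b) m = aval a m - aval b m"
| "aval (Times a b) m = aval a m * aval b m"

fun acost :: "aexp \<Rightarrow> memory \<Rightarrow> nat" where
  "acost (N k) m = int_size k"
| "acost (Cell x i) m = acost i m + int_size (m x (aval i m))"
| "acost (Plus a b) m = acost a m + acost b m + int_size (aval a m + aval b m)"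
| "acost (Minus a b) m = acost a m + acost b m + int_size (aval a m - aval b m)"
| "acost (Times a b) m = acost a m + acost b m + int_size (aval a m * aval b m)"

fun bval :: "bexp \<Rightarrow> memory \<Rightarrow> bool" where
  "bval (Less a b) m \<longleftrightarrow> aval a m < aval b m"
| "bval (BNot b) m \<longleftrightarrow> \<not> bval b m"
| "bval (BAnd b c) m \<longleftrightarrow> bval b m \<and> bval c m"

fun bcost :: "bexp \<Rightarrow> memory \<Rightarrow> nat" where
  "bcost (Less a b) m = 1 + acost a m + acost b m"
| "bcost (BNot b) m = 1 + bcost b m"
| "bcost (BAnd b c) m = 1 + bcost b m + bcost c m"

definition store :: "memory \<Rightarrow> vname \<Rightarrow> int \<Rightarrow> int \<Rightarrow> memory" where
  "store m x i v = m(x := (m x)(i := v))"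

text \<open>
  \<open>exec c (m, out) t (m', out')\<close>: started with memory \<open>m\<close> and output \<open>out\<close>, the command \<open>c\<close>
  terminates at cost \<open>t\<close> with memory \<open>m'\<close> and output \<open>out'\<close>.
\<close>

inductive exec :: "com \<Rightarrow> memory \<times> int list \<Rightarrow> nat \<Rightarrow> memory \<times> int list \<Rightarrow> bool" where
  Skip: "exec SKIP s 1 s"
| Store: "exec (Store x i e) (m, out) (1 + acost i m + acost e m)
            (store m x (aval i m) (aval e m), out)"
| Write: "exec (Write e) (m, out) (1 + acost e m) (m, out @ [aval e m])"
| Seq: "exec c1 s t1 s' \<Longrightarrow> exec c2 s' t2 s'' \<Longrightarrow> exec (Seq c1 c2) s (t1 + t2) s''"
| IfTrue: "bval b m \<Longrightarrow> exec c1 (m, out) t s' \<Longrightarrow>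
            exec (If b c1 c2) (m, out) (1 + bcost b m + t) s'"
| IfFalse: "\<not> bval b m \<Longrightarrow> exec c2 (m, out) t s' \<Longrightarrow>
            exec (If b c1 c2) (m, out) (1 + bcost b m + t) s'"
| WhileFalse: "\<not> bval b m \<Longrightarrow> exec (While b c) (m, out) (1 + bcost b m) (m, out)"
| WhileTrue: "bval b m \<Longrightarrow> exec c (m, out) t1 s' \<Longrightarrow> exec (While b c) s' t2 s'' \<Longrightarrow>
            exec (While b c) (m, out) (1 + bcost b m + t1 + t2) s''"

lemma exec_deterministic:
  "exec c s t s' \<Longrightarrow> exec c s u s'' \<Longrightarrow> u = t \<and> s'' = s'"
proof (induction arbitrary: u s'' rule: exec.induct)
  case (Seq c1 s t1 s' c2 t2 s2)
  from Seq.prems show ?case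
    by (cases rule: exec.cases) (use Seq.IH in blast)+
next
  case (IfTrue b m c1 out t s' c2)
  from IfTrue.prems show ?case
    by (cases rule: exec.cases) (use IfTrue.IH IfTrue.hyps in blast)+
next
  case (IfFalse b m c2 out t s' c1)
  from IfFalse.prems show ?case
    by (cases rule: exec.cases) (use IfFalse.IH IfFalse.hyps in blast)+
next
  case (WhileTrue b m c out t1 s' t2 s2)
  from WhileTrue.prems show ?case
    by (cases rule: exec.cases) (use WhileTrue.IH WhileTrue.hyps in blast)+
qed (auto elim: exec.cases)

text \<open>The input is a list of integers, stored in the array \<open>in\<close>; its length is in \<open>len[0]\<close>.\<close>

definition initial_memory :: "int list \<Rightarrow> memory" where
  "initial_memory xs = (\<lambda>x i.
     if x = ''in'' \<and> 0 \<le> i \<and> i < int (length xs) then xs ! nat i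
     else if x = ''len'' \<and> i = 0 then int (length xs)
     else 0)"

definition run :: "com \<Rightarrow> int list \<Rightarrow> nat \<Rightarrow> int list \<Rightarrow> bool" where
  "run c xs t ys \<longleftrightarrow> (\<exists>m. exec c (initial_memory xs, []) t (m, ys))"

definition input_size :: "int list \<Rightarrow> nat" where
  "input_size xs = (\<Sum>x\<leftarrow>xs. int_size x)"

definition polynomial_time_on :: "int list set \<Rightarrow> com \<Rightarrow> bool" where
  "polynomial_time_on X c \<longleftrightarrow>
     (\<exists>P :: nat poly. \<forall>xs\<in>X. \<exists>t ys. run c xs t ys \<and> t \<le> poly P (input_size xs))"


section \<open>Networks with maintenance jobs\<close>

record edge =
  end1 :: nat
  end2 :: nat
  proc :: nat
  release :: nat
  deadline :: nat
  preemptive :: bool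

record network =
  source :: nat
  sink :: nat
  edges :: "edge list"

definition ends :: "edge \<Rightarrow> nat set" where
  "ends e = {end1 e, end2 e}"

text \<open>
  The graph of the network is a simple path from source to sink (with at least one edge); the
  edges may be listed in any order. The vertex set is implicit, as a path has no isolated vertices.
\<close>

definition path_network :: "network \<Rightarrow> bool" where
  "path_network G \<longleftrightarrow> edges G \<noteq> [] \<and>
     (\<exists>vs. vs \<noteq> [] \<and> distinct vs \<and> hd vs = source G \<and> last vs = sink G \<and>
        mset (map ends (edges G)) = mset (map2 (\<lambda>u v. {u, v}) vs (tl vs)))"

text \<open>
  A schedule maps the index of an edge to a set of intervals; the pair \<open>(a, b)\<close> stands for
  \<open>{a..<b}\<close>.
\<close>

type_synonym schedule = "nat \<Rightarrow> (real \<times> real) set"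

definition feasible_job :: "edge \<Rightarrow> (real \<times> real) set \<Rightarrow> bool" where
  "feasible_job e J \<longleftrightarrow>
     finite J \<and>
     (\<forall>(a, b)\<in>J. real (release e) \<le> a \<and> a \<le> b \<and> b \<le> real (deadline e)) \<and>
     (\<forall>(a, b)\<in>J. \<forall>(c, d)\<in>J. (a, b) \<noteq> (c, d) \<longrightarrow> {a..<b} \<inter> {c..<d} = {}) \<and>
     (\<Sum>(a, b)\<in>J. b - a) = real (proc e) \<and>
     (\<not> preemptive e \<longrightarrow> card J = 1)"

definition feasible :: "network \<Rightarrow> schedule \<Rightarrow> bool" where
  "feasible G S \<longleftrightarrow> (\<forall>i < length (edges G). feasible_job (edges G ! i) (S i))"

definition maintained :: "schedule \<Rightarrow> nat \<Rightarrow> real \<Rightarrow> bool" where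
  "maintained S i t \<longleftrightarrow> (\<exists>(a, b)\<in>S i. t \<in> {a..<b})"

definition available_adj :: "network \<Rightarrow> schedule \<Rightarrow> real \<Rightarrow> (nat \<times> nat) set" where
  "available_adj G S t =
     {(u, v). \<exists>i < length (edges G). ends (edges G ! i) = {u, v} \<and> \<not> maintained S i t}"

definition disconnected :: "network \<Rightarrow> schedule \<Rightarrow> real \<Rightarrow> bool" where
  "disconnected G S t \<longleftrightarrow> (source G, sink G) \<notin> (available_adj G S t)\<^sup>*"

definition horizon :: "network \<Rightarrow> nat" where
  "horizon G = Max (deadline ` set (edges G))"

definition disconnected_time :: "network \<Rightarrow> schedule \<Rightarrow> real" where
  "disconnected_time G S = measure lborel {t \<in> {0..real (horizon G)}. disconnected G S t}"

definition min_connectivity_opt :: "network \<Rightarrow> real" where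
  "min_connectivity_opt G = (INF S\<in>{S. feasible G S}. disconnected_time G S)"


section \<open>Approximation algorithms\<close>

definition encode_edge :: "edge \<Rightarrow> int list" where
  "encode_edge e =
     [int (end1 e), int (end2 e), int (proc e), int (release e), int (deadline e),
      if preemptive e then 1 else 0]"

definition encode_network :: "network \<Rightarrow> int list" where
  "encode_network G =
     [int (length (edges G)), int (source G), int (sink G)] @ concat (map encode_edge (edges G))"

text \<open>
  A schedule is written as a common denominator \<open>q\<close> followed by triples \<open>i, a, b\<close>, each saying
  that edge number \<open>i\<close> is maintained during \<open>{a/q..<b/q}\<close>.
\<close>

definition schedule_encoding :: "int list \<Rightarrow> schedule \<Rightarrow> bool" where
  "schedule_encoding ys S \<longleftrightarrow>
     (\<exists>(q :: int) (js :: (nat \<times> int \<times> int) list). q > 0 \<and>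
        ys = q # concat (map (\<lambda>(i, a, b). [int i, a, b]) js) \<and>
        S = (\<lambda>i. {(real_of_int a / real_of_int q, real_of_int b / real_of_int q) | a b.
                   (i, a, b) \<in> set js}))"

text \<open>
  Instances without any feasible schedule have no optimum; on them only termination within the
  time bound is demanded.
\<close>

definition polynomial_approximation_on :: "network set \<Rightarrow> real \<Rightarrow> com \<Rightarrow> bool" where
  "polynomial_approximation_on \<G> \<alpha> c \<longleftrightarrow>
     polynomial_time_on (encode_network ` \<G>) c \<and>
     (\<forall>G\<in>\<G>. (\<exists>S. feasible G S) \<longrightarrow>
        (\<exists>t ys S. run c (encode_network G) t ys \<and> schedule_encoding ys S \<and>
           feasible G S \<and> disconnected_time G S \<le> \<alpha> * min_connectivity_opt G))"

end

theory Submission imports Defs begin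

text \<open>
  Schedule the preemptive and the non-preemptive jobs separately, each set optimally. On a path the
  disconnected times are the union of all maintenance intervals, so each of the two optima is at most
  the cost of any feasible schedule, and the combined schedule costs at most their sum.

  For the preemptive jobs let \<open>X t\<close> be the maintenance time up to \<open>t\<close>. The constraints on the values of
  \<open>X\<close> at release dates and deadlines are difference constraints (\<open>X\<close> grows with slope between \<open>0\<close> and
  \<open>1\<close>, and by at least the processing time between release date and deadline), and Bellman-Ford
  computes their least nonnegative solution. Between two consecutive points one maintains as early
  as possible.

  For the non-preemptive jobs, the busy set of a schedule is a family of intervals. Whether job \<open>j\<close>
  fits into \<open>[a, b]\<close> depends only on its earliest completion time \<open>e j \<le> b\<close>, its latest start time
  \<open>l j \<ge> a\<close> and its length \<open>p j \<le> b - a\<close>. An interval for the longest job serves every job except those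
  with \<open>l j < a\<close> and those with \<open>e j > b\<close>; these two sets are disjoint and no other interval is needed
  for both, which gives a dynamic program over the sets \<open>{j. e j > e A \<and> l j < l B}\<close>.

  The running time is controlled syntactically: programs are built from loops with bounds that are
  not modified, and stored values are computed without products.
\<close>

section \<open>Loop programs\<close>

text \<open>Feasible schedules use arbitrary real times, whereas the program handles integers only,
  so each lower bound compares an integer with real objects. In the preemptive part, relaxation from
  zero keeps integers and stays below every real nonnegative solution. In the non-preemptive part,
  the ends of a tightened interval are some \<open>l i\<close> and one of \<open>e k\<close>,
  \<open>e J\<close>, \<open>a + p J\<close>, so trying all pairs of jobs \<open>(i, k)\<close>
  loses nothing.

  The dynamic program competes with covers by intervals instead of schedules: the members of a cover
  can be distributed to the two subproblems, while the runs of a schedule would have to be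
  rearranged.

  Instances without a feasible schedule must be processed in polynomial time as well. Hence every
  loop has a number of rounds fixed by the number of edges: Bellman-Ford does not wait for
  convergence, and the dynamic program sweeps over all its states \<open>n\<close> times. Products
  are kept out of stored values because repeated squaring in a loop would produce exponentially long
  numbers.\<close>

datatype lcom =
    LSkip
  | Assign vname aexp aexp
  | Out aexp
  | LSeq lcom lcom (infixr ";;" 60)
  | LIf bexp lcom lcom
  | For vname aexp lcom

primrec avars :: "aexp \<Rightarrow> vname set" where
  "avars (N k) = {}"
| "avars (Cell x i) = insert x (avars i)"
| "avars (Plus a b) = avars a \<union> avars b"
| "avars (Minus a b) = avars a \<union> avars b"
| "avars (Times a b) = avars a \<union> avars b"

primrec writes :: "lcom \<Rightarrow> vname set" where
  "writes LSkip = {}"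
| "writes (Assign x i e) = {x}"
| "writes (Out e) = {}"
| "writes (c ;; d) = writes c \<union> writes d"
| "writes (LIf b c d) = writes c \<union> writes d"
| "writes (For x e c) = insert x (writes c)"

text \<open>The bound of a \<open>For\<close> is evaluated once, on entry, so this is a total
  function, free of termination arguments. The final store leaves the counter at the value with
  which the compiled while loop exits.\<close>

primrec lmem :: "lcom \<Rightarrow> memory \<Rightarrow> memory" where
  "lmem LSkip m = m"
| "lmem (Assign x i e) m = store m x (aval i m) (aval e m)"
| "lmem (Out e) m = m"
| "lmem (c ;; d) m = lmem d (lmem c m)"
| "lmem (LIf b c d) m = (if bval b m then lmem c m else lmem d m)"
| "lmem (For x e c) m =
     store (rec_nat m (\<lambda>i m'. lmem c (store m' x 0 (int i))) (nat (aval e m)))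
       x 0 (int (nat (aval e m)))"

abbreviation loop_state :: "vname \<Rightarrow> lcom \<Rightarrow> memory \<Rightarrow> nat \<Rightarrow> memory" where
  "loop_state x c m \<equiv> rec_nat m (\<lambda>i m'. lmem c (store m' x 0 (int i)))"

primrec lout :: "lcom \<Rightarrow> memory \<Rightarrow> int list" where
  "lout LSkip m = []"
| "lout (Assign x i e) m = []"
| "lout (Out e) m = [aval e m]"
| "lout (c ;; d) m = lout c m @ lout d (lmem c m)"
| "lout (LIf b c d) m = (if bval b m then lout c m else lout d m)"
| "lout (For x e c) m =
     concat (map (\<lambda>i. lout c (store (loop_state x c m i) x 0 (int i))) [0..<nat (aval e m)])"

primrec compile :: "lcom \<Rightarrow> com" where
  "compile LSkip = SKIP"
| "compile (Assign x i e) = Store x i e"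
| "compile (Out e) = Write e"
| "compile (c ;; d) = Seq (compile c) (compile d)"
| "compile (LIf b c d) = If b (compile c) (compile d)"
| "compile (For x e c) =
     Seq (Store x (N 0) (N 0))
       (While (Less (Cell x (N 0)) e)
         (Seq (compile c) (Store x (N 0) (Plus (Cell x (N 0)) (N 1)))))"

lemma store_apply: "store m x i v y j = (if y = x \<and> j = i then v else m y j)"
  by (simp add: store_def)

lemma store_other: "y \<noteq> x \<Longrightarrow> store m x i v y = m y"
  by (simp add: store_def)

lemma lmem_frame: "y \<notin> writes c \<Longrightarrow> lmem c m y = m y"
proof (induction c arbitrary: m)
  case (For x e c)
  have "loop_state x c m k y = m y" for k
    using For by (induction k) (auto simp: store_other)
  then show ?case using For.prems by (simp add: store_other)
qed (auto simp: store_other)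

lemma loop_state_frame: "y \<notin> insert x (writes c) \<Longrightarrow> loop_state x c m i y = m y"
  by (induction i) (auto simp: lmem_frame store_other)

lemma aval_cong: "(\<And>x. x \<in> avars e \<Longrightarrow> m x = m' x) \<Longrightarrow> aval e m = aval e m'"
  by (induction e) auto

text \<open>
  Stored values are sums and differences of memory cells, so a step increases bit lengths only by
  a constant. Products are allowed in addresses and tests, which do not feed back into the memory.
\<close>

primrec product_free :: "aexp \<Rightarrow> bool" where
  "product_free (N k) = True"
| "product_free (Cell x i) = True"
| "product_free (Plus a b) = (product_free a \<and> product_free b)"
| "product_free (Minus a b) = (product_free a \<and> product_free b)"
| "product_free (Times a b) = False"

text \<open>The compiled loop tests the bound anew in every round and counts in ordinary memory.
  Forbidding the body to touch the counter or anything the bound reads, and the bound to read the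
  counter, makes that loop agree with \<open>lmem\<close>. In assignments only the stored value is
  restricted; the address may contain products.\<close>

primrec well_formed :: "lcom \<Rightarrow> bool" where
  "well_formed LSkip = True"
| "well_formed (Assign x i e) = product_free e"
| "well_formed (Out e) = True"
| "well_formed (c ;; d) = (well_formed c \<and> well_formed d)"
| "well_formed (LIf b c d) = (well_formed c \<and> well_formed d)"
| "well_formed (For x e c) = (well_formed c \<and> x \<notin> writes c \<and> avars e \<inter> insert x (writes c) = {})"

primrec loop_bounds :: "lcom \<Rightarrow> aexp set" where
  "loop_bounds LSkip = {}"
| "loop_bounds (Assign x i e) = {}"
| "loop_bounds (Out e) = {}"
| "loop_bounds (c ;; d) = loop_bounds c \<union> loop_bounds d"
| "loop_bounds (LIf b c d) = loop_bounds c \<union> loop_bounds d"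
| "loop_bounds (For x e c) = insert e (loop_bounds c)"

text \<open>Constants are counted by absolute value, not by length; this is coarse, but they are
  fixed together with the program. The square \<open>aweight\<close> pays for an evaluation because
  there are at most \<open>asize\<close> subexpressions, each with a value whose size is bounded in
  terms of \<open>asize\<close>.\<close>

primrec asize :: "aexp \<Rightarrow> nat" where
  "asize (N k) = nat \<bar>k\<bar> + 1"
| "asize (Cell x i) = asize i + 1"
| "asize (Plus a b) = asize a + asize b + 1"
| "asize (Minus a b) = asize a + asize b + 1"
| "asize (Times a b) = asize a + asize b + 1"

abbreviation aweight :: "aexp \<Rightarrow> nat" where
  "aweight e \<equiv> asize e * asize e"

primrec bweight :: "bexp \<Rightarrow> nat" where
  "bweight (Less a b) = 1 + aweight a + aweight b"
| "bweight (BNot b) = 1 + bweight b"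
| "bweight (BAnd b c) = 1 + bweight b + bweight c"

text \<open>
  Evaluated at a bound for the loop lengths, this bounds both the weighted number of steps
  and the number of bits by which the memory contents can grow.
\<close>

primrec step_poly :: "lcom \<Rightarrow> nat poly" where
  "step_poly LSkip = [:1:]"
| "step_poly (Assign x i e) = [:1 + aweight i + aweight e:]"
| "step_poly (Out e) = [:1 + aweight e:]"
| "step_poly (c ;; d) = step_poly c + step_poly d"
| "step_poly (LIf b c d) = [:1 + bweight b:] + step_poly c + step_poly d"
| "step_poly (For x e c) =
     [:8 + aweight e:] + [:0, 1:] * (step_poly c + [:33 + aweight e:])"

section \<open>Bit lengths and running time of compiled loop programs\<close>

definition mem_bound :: "memory \<Rightarrow> nat \<Rightarrow> bool" where
  "mem_bound m v \<longleftrightarrow> (\<forall>x i. \<bar>m x i\<bar> < 2 ^ v)"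

lemma mem_bound_mono: "mem_bound m v \<Longrightarrow> v \<le> w \<Longrightarrow> mem_bound m w"
  unfolding mem_bound_def by (meson order_less_le_trans power_increasing one_le_numeral)

lemma int_size_le: "\<bar>x\<bar> < 2 ^ k \<Longrightarrow> int_size x \<le> 1 + k"
  by (simp add: int_size_def floorlog_le_iff nat_less_iff)

lemma pow2_mono_int: "a \<le> b \<Longrightarrow> (2::int) ^ a \<le> 2 ^ b"
  by (simp add: power_increasing)

lemma pow2_add_less:
  fixes a b :: int assumes "\<bar>a\<bar> < 2 ^ k" "\<bar>b\<bar> < 2 ^ l" "k < n" "l < n"
  shows "\<bar>a + b\<bar> < 2 ^ n" "\<bar>a - b\<bar> < 2 ^ n"
proof -
  obtain n' where n: "n = Suc n'" using assms by (cases n) auto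
  have "(2::int) ^ k \<le> 2 ^ n'" "(2::int) ^ l \<le> 2 ^ n'"
    using assms n by (auto intro!: pow2_mono_int)
  then have "\<bar>a\<bar> < 2 ^ n'" "\<bar>b\<bar> < 2 ^ n'" using assms by linarith+
  then show "\<bar>a + b\<bar> < 2 ^ n" "\<bar>a - b\<bar> < 2 ^ n"
    unfolding n power_Suc by linarith+
qed

lemma abs_less_pow2: "\<bar>k :: int\<bar> < 2 ^ (nat \<bar>k\<bar> + 1)"
proof -
  have "int (nat \<bar>k\<bar>) < int (2 ^ (nat \<bar>k\<bar> + 1))"
    by (subst of_nat_less_iff) (metis less_exp less_add_one order_less_trans)
  then show ?thesis by simp
qed

lemma asize_pos [simp]: "0 < asize e" by (cases e) auto

lemma aval_product_free_bound:
  assumes "mem_bound m v" "product_free e"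
  shows "\<bar>aval e m\<bar> < 2 ^ (v + asize e)"
  using assms(2)
proof (induction e)
  case (N k)
  show ?case using order_less_le_trans[OF abs_less_pow2 pow2_mono_int[of "nat \<bar>k\<bar> + 1" "v + (nat \<bar>k\<bar> + 1)"]]
    by simp
next
  case (Cell x i)
  have "\<bar>m x (aval i m)\<bar> < 2 ^ v" using assms by (simp add: mem_bound_def)
  also have "\<dots> \<le> 2 ^ (v + asize (Cell x i))" by (rule pow2_mono_int) simp
  finally show ?case by simp
next
  case (Plus a b)
  then show ?case using pow2_add_less(1)[of "aval a m" "v + asize a" "aval b m" "v + asize b" "v + asize (Plus a b)"]
    by (simp del: power_Suc)
next
  case (Minus a b)
  then show ?case using pow2_add_less(2)[of "aval a m" "v + asize a" "aval b m" "v + asize b" "v + asize (Minus a b)"]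
    by (simp del: power_Suc)
qed auto

text \<open>A product adds the bit lengths of its factors, so with products the exponent becomes a
  multiple of \<open>v + 1\<close> instead of \<open>v\<close> plus a constant. Such a bound could
  not be iterated along a loop; it serves only to estimate costs.\<close>

lemma aval_bound:
  assumes "mem_bound m v"
  shows "\<bar>aval e m\<bar> < 2 ^ ((v + 1) * asize e)"
proof (induction e)
  case (N k)
  have "nat \<bar>k\<bar> + 1 \<le> (v + 1) * (nat \<bar>k\<bar> + 1)" by simp
  then show ?case using order_less_le_trans[OF abs_less_pow2[of k] pow2_mono_int] by (simp only: aval.simps asize.simps)
next
  case (Cell x i)
  have "\<bar>m x (aval i m)\<bar> < 2 ^ v" using assms by (simp add: mem_bound_def)
  also have "\<dots> \<le> 2 ^ ((v + 1) * asize (Cell x i))" by (rule pow2_mono_int) (simp add: algebra_simps)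
  finally show ?case by simp
next
  case (Plus a b)
  then show ?case
    by (simp only: aval.simps) (rule pow2_add_less(1), auto simp: algebra_simps)
next
  case (Minus a b)
  then show ?case
    by (simp only: aval.simps) (rule pow2_add_less(2), auto simp: algebra_simps)
next
  case (Times a b)
  have "\<bar>aval a m\<bar> * \<bar>aval b m\<bar> < 2 ^ ((v + 1) * asize a) * 2 ^ ((v + 1) * asize b)"
    by (rule mult_strict_mono') (use Times in auto)
  also have "\<dots> = 2 ^ ((v + 1) * asize a + (v + 1) * asize b)" by (simp only: power_add)
  also have "\<dots> \<le> 2 ^ ((v + 1) * asize (Times a b))" by (rule pow2_mono_int) (simp add: algebra_simps)
  finally show ?case by (simp add: abs_mult)
qed

lemma int_size_aval:
  assumes "mem_bound m v" shows "int_size (aval e m) \<le> (v + 2) * asize e"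
proof -
  have "int_size (aval e m) \<le> 1 + (v + 1) * asize e"
    using aval_bound[OF assms] int_size_le by blast
  also have "\<dots> \<le> (v + 2) * asize e" using asize_pos[of e] by (simp add: algebra_simps del: asize_pos)
  finally show ?thesis .
qed

text \<open>Each node adds the size of its value, at most \<open>(v + 2) * asize\<close>. The square
  absorbs this: if \<open>z = x + y + 1\<close>, then
  \<open>x * x + y * y + z \<le> z * z\<close>.\<close>

lemma acost_bound:
  assumes "mem_bound m v" shows "acost e m \<le> (v + 2) * aweight e"
proof -
  have bin: "acost a m + acost b m + int_size (aval c m) \<le> (v + 2) * aweight c"
    if "acost a m \<le> (v + 2) * aweight a" "acost b m \<le> (v + 2) * aweight b" "asize c = asize a + asize b + 1" for a b c
  proof -
    have "aweight a + aweight b + asize c \<le> aweight c" using that(3) by (simp add: algebra_simps)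
    then have "(v + 2) * (aweight a + aweight b + asize c) \<le> (v + 2) * aweight c" by (rule mult_le_mono2)
    then show ?thesis using that(1,2) int_size_aval[OF assms, of c] by (simp only: distrib_left)
  qed
  show ?thesis
  proof (induction e)
    case (N k)
    have "(v + 2) * asize (N k) \<le> (v + 2) * aweight (N k)"
      by (rule mult_le_mono2) simp
    then show ?case using int_size_aval[OF assms, of "N k"] by simp
  next
    case (Cell x i)
    have "asize i * asize i + (asize i + 1) \<le> aweight (Cell x i)" by simp
    then have "(v + 2) * (asize i * asize i + (asize i + 1)) \<le> (v + 2) * aweight (Cell x i)" by (rule mult_le_mono2)
    then show ?case using Cell int_size_aval[OF assms, of "Cell x i"]
      by (simp only: acost.simps aval.simps asize.simps distrib_left)
  qed (simp_all only: acost.simps bin[OF _ _ asize.simps(3), unfolded aval.simps]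
      bin[OF _ _ asize.simps(4), unfolded aval.simps] bin[OF _ _ asize.simps(5), unfolded aval.simps])
qed

lemma bcost_bound:
  assumes "mem_bound m v" shows "bcost b m \<le> (v + 2) * bweight b"
proof (induction b)
  case (Less a b)
  then show ?case using acost_bound[OF assms, of a] acost_bound[OF assms, of b]
    by (simp add: distrib_left)
qed (simp_all add: distrib_left)

lemma mem_bound_store:
  assumes "mem_bound m v" "\<bar>k\<bar> < 2 ^ w" "v \<le> w"
  shows "mem_bound (store m x i k) w"
  using mem_bound_mono[OF assms(1,3)] assms(2) by (simp add: mem_bound_def store_apply)

text \<open>The price of a step depends on the bit lengths present when it runs, and these grow
  during the run. \<open>L\<close> is a ceiling fixed in advance for all of them, so that growth and
  time can be bounded in one induction. The premise on loop bounds ranges over every memory that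
  agrees with \<open>m\<close> on the unwritten arrays, because inner bounds are evaluated in later
  states.\<close>

lemma exec_compile:
  assumes "well_formed c" "mem_bound m v"
    and "\<And>e m'. e \<in> loop_bounds c \<Longrightarrow> (\<And>x. x \<notin> writes c \<Longrightarrow> m' x = m x) \<Longrightarrow> aval e m' \<le> int K"
    and "v + poly (step_poly c) K \<le> L"
  shows "mem_bound (lmem c m) (v + poly (step_poly c) K) \<and>
     (\<exists>t \<le> (L + 2) * poly (step_poly c) K. exec (compile c) (m, out) t (lmem c m, out @ lout c m))"
  using assms
proof (induction c arbitrary: m v out)
  case LSkip
  then show ?case using exec.Skip[of "(m, out)"] by (auto intro: mem_bound_mono intro!: exI[of _ 1])
next
  case (Assign x i e)
  have b: "mem_bound m L" using Assign.prems mem_bound_mono by (metis add_leE)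
  have "asize e \<le> 1 + aweight i + aweight e" using le_square[of "asize e"] by linarith
  then have "\<bar>aval e m\<bar> < 2 ^ (v + (1 + aweight i + aweight e))"
    using order_less_le_trans[OF aval_product_free_bound[OF Assign.prems(2), of e] pow2_mono_int, of "v + (1 + aweight i + aweight e)"]
      Assign.prems(1) by (simp only: well_formed.simps add_le_cancel_left)
  then have "mem_bound (lmem (Assign x i e) m) (v + poly (step_poly (Assign x i e)) K)"
    using mem_bound_store[OF Assign.prems(2)] by simp
  moreover have "1 + acost i m + acost e m \<le> (L + 2) * poly (step_poly (Assign x i e)) K"
    using acost_bound[OF b, of i] acost_bound[OF b, of e] by (simp add: distrib_left)
  ultimately show ?case using exec.Store[of x i e m out] by auto
next
  case (Out e)
  have b: "mem_bound m L" using Out.prems mem_bound_mono by (metis add_leE)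
  have "1 + acost e m \<le> (L + 2) * poly (step_poly (Out e)) K"
    using acost_bound[OF b, of e] by (simp add: distrib_left)
  then show ?case using exec.Write[of e m out] Out.prems
    by (auto intro: mem_bound_mono)
next
  case (LSeq c d)
  let ?g = "poly (step_poly c) K" and ?h = "poly (step_poly d) K"
  have 1: "mem_bound (lmem c m) (v + ?g) \<and>
     (\<exists>t \<le> (L + 2) * ?g. exec (compile c) (m, out) t (lmem c m, out @ lout c m))"
    by (rule LSeq.IH) (use LSeq.prems in auto)
  have 2: "mem_bound (lmem d (lmem c m)) (v + ?g + ?h) \<and>
     (\<exists>t \<le> (L + 2) * ?h. exec (compile d) (lmem c m, out @ lout c m) t
        (lmem d (lmem c m), (out @ lout c m) @ lout d (lmem c m)))"
  proof (rule LSeq.IH)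
    fix e m' assume e: "e \<in> loop_bounds d" "\<And>x. x \<notin> writes d \<Longrightarrow> m' x = lmem c m x"
    show "aval e m' \<le> int K"
      by (rule LSeq.prems(3)) (use e in \<open>auto simp: lmem_frame\<close>)
  qed (use LSeq.prems 1 in auto)
  from 1 2 obtain t1 t2 where
    "t1 \<le> (L + 2) * ?g" "exec (compile c) (m, out) t1 (lmem c m, out @ lout c m)"
    "t2 \<le> (L + 2) * ?h" "exec (compile d) (lmem c m, out @ lout c m) t2
        (lmem d (lmem c m), (out @ lout c m) @ lout d (lmem c m))" by blast
  then have "exec (compile (c ;; d)) (m, out) (t1 + t2) (lmem (c ;; d) m, out @ lout (c ;; d) m)"
    "t1 + t2 \<le> (L + 2) * (?g + ?h)" using exec.Seq by (fastforce simp: distrib_left)+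
  then show ?case using 2 by (auto simp: add.assoc)
next
  case (LIf b c d)
  let ?g = "poly (step_poly c) K" and ?h = "poly (step_poly d) K"
  have bb: "mem_bound m L" using LIf.prems mem_bound_mono by (metis add_leE)
  show ?case
  proof (cases "bval b m")
    case True
    have 1: "mem_bound (lmem c m) (v + ?g) \<and>
       (\<exists>t \<le> (L + 2) * ?g. exec (compile c) (m, out) t (lmem c m, out @ lout c m))"
      by (rule LIf.IH) (use LIf.prems in auto)
    then obtain t where t: "t \<le> (L + 2) * ?g" "exec (compile c) (m, out) t (lmem c m, out @ lout c m)"
      by blast
    have "1 + bcost b m + t \<le> (L + 2) * poly (step_poly (LIf b c d)) K"
      using t bcost_bound[OF bb, of b] by (simp add: distrib_left)
    moreover have "mem_bound (lmem c m) (v + poly (step_poly (LIf b c d)) K)"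
      using 1 by (auto intro: mem_bound_mono)
    ultimately show ?thesis using True exec.IfTrue[OF True t(2)] by auto
  next
    case False
    have 1: "mem_bound (lmem d m) (v + ?h) \<and>
       (\<exists>t \<le> (L + 2) * ?h. exec (compile d) (m, out) t (lmem d m, out @ lout d m))"
      by (rule LIf.IH) (use LIf.prems in auto)
    then obtain t where t: "t \<le> (L + 2) * ?h" "exec (compile d) (m, out) t (lmem d m, out @ lout d m)"
      by blast
    have "1 + bcost b m + t \<le> (L + 2) * poly (step_poly (LIf b c d)) K"
      using t bcost_bound[OF bb, of b] by (simp add: distrib_left)
    moreover have "mem_bound (lmem d m) (v + poly (step_poly (LIf b c d)) K)"
      using 1 by (auto intro: mem_bound_mono)
    ultimately show ?thesis using False exec.IfFalse[OF False t(2)] by auto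
  qed
next
  case (For x e c)
  \<comment> \<open>The weight 33 of a round is 6 for the test (apart from \<open>aweight e\<close>)
    plus 27 for the increment; the 8 outside the rounds is 6 for the last test and 2 for setting the
    counter to 0.\<close>
  let ?g = "poly (step_poly c) K" and ?w = "33 + aweight e"
  let ?test = "Less (Cell x (N 0)) e"
  let ?incr = "Store x (N 0) (Plus (Cell x (N 0)) (N 1))"
  let ?body = "Seq (compile c) ?incr"
  define k where "k = nat (aval e m)"
  define hd where "hd i = store (loop_state x c m i) x 0 (int i)" for i
  define o' where "o' i = out @ concat (map (\<lambda>i. lout c (hd i)) [0..<i])" for i
  have kK: "k \<le> K"
    using For.prems(3)[of e m] by (simp add: k_def)
  have frame: "hd i y = m y" if "y \<notin> insert x (writes c)" for i y
    using that by (simp add: hd_def store_other loop_state_frame)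
  have e_hd: "aval e (hd i) = aval e m" for i
    by (rule aval_cong, rule frame) (use For.prems(1) in auto)
  have xc: "x \<notin> writes c" and wf: "well_formed c" using For.prems(1) by auto
  have hd_x: "hd i x 0 = int i" for i by (simp add: hd_def store_apply)
  have hd_Suc: "hd (Suc i) = store (lmem c (hd i)) x 0 (int (Suc i))" for i
    by (simp add: hd_def store_def)
  have o'_Suc: "o' (Suc i) = o' i @ lout c (hd i)" for i
    by (simp add: o'_def)
  have poly_For: "poly (step_poly (For x e c)) K = 8 + aweight e + K * (?g + ?w)" by simp
  have L: "v + 1 + k * (?g + ?w) \<le> L" and
    G: "v + 1 + k * (?g + ?w) \<le> v + poly (step_poly (For x e c)) K"
  proof -
    have "k * (?g + ?w) \<le> K * (?g + ?w)" using kK by (rule mult_le_mono1)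
    then show "v + 1 + k * (?g + ?w) \<le> v + poly (step_poly (For x e c)) K" unfolding poly_For by linarith
    then show "v + 1 + k * (?g + ?w) \<le> L" using For.prems(4) by linarith
  qed
  have body: "mem_bound (lmem c (hd i)) (v + 1 + i * (?g + ?w) + ?g) \<and>
      (\<exists>t \<le> (L + 2) * ?g. exec (compile c) (hd i, o' i) t (lmem c (hd i), o' i @ lout c (hd i)))"
    if b: "mem_bound (hd i) (v + 1 + i * (?g + ?w))" and "i < k" for i
  proof (rule For.IH[OF wf b])
    fix e' m' assume e': "e' \<in> loop_bounds c" "\<And>y. y \<notin> writes c \<Longrightarrow> m' y = hd i y"
    show "aval e' m' \<le> int K"
      by (rule For.prems(3)) (use e' frame in auto)
  next
    have "Suc i * (?g + ?w) \<le> k * (?g + ?w)" using that by (intro mult_le_mono1) simp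
    then show "v + 1 + i * (?g + ?w) + ?g \<le> L" using L by simp
  qed
  have hd_bound: "i \<le> k \<Longrightarrow> mem_bound (hd i) (v + 1 + i * (?g + ?w))" for i
  proof (induction i)
    case 0
    show ?case
      unfolding hd_def by (rule mem_bound_store[OF _ _ order_refl])
        (use For.prems(2) mem_bound_mono in auto)
  next
    case (Suc i)
    have b: "mem_bound (lmem c (hd i)) (v + 1 + i * (?g + ?w) + ?g)"
      using body[of i] Suc by simp
    \<comment> \<open>The body does not write the counter, so the bound for the memory after the
      body applies to it; adding 1 costs one further bit, which \<open>?w\<close> provides.\<close>
    then have "\<bar>int i\<bar> < 2 ^ (v + 1 + i * (?g + ?w) + ?g)"
      using lmem_frame[OF xc, of "hd i"] hd_x[of i] unfolding mem_bound_def by metis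
    then have "\<bar>int i + 1\<bar> < 2 ^ (v + 1 + Suc i * (?g + ?w))"
      by (rule pow2_add_less(1)[where l = 1]) auto
    then show ?case unfolding hd_Suc
      by (intro mem_bound_store[OF b]) (auto simp: add.commute)
  qed
  have hd_L: "mem_bound (hd i) L" if "i \<le> k" for i
  proof (rule mem_bound_mono[OF hd_bound[OF that]])
    have "i * (?g + ?w) \<le> k * (?g + ?w)" using that by (rule mult_le_mono1)
    then show "v + 1 + i * (?g + ?w) \<le> L" using L by linarith
  qed
  have test: "1 + bcost ?test (hd i) \<le> (L + 2) * (6 + aweight e)" if "i \<le> k" for i
    using bcost_bound[OF hd_L[OF that], of ?test] by (simp add: algebra_simps)
  have iter: "\<exists>t. 1 + bcost ?test (hd i) + t \<le> (L + 2) * (?g + ?w) \<and>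
      exec ?body (hd i, o' i) t (hd (Suc i), o' (Suc i))" if ik: "i < k" for i
  proof -
    obtain t where t: "t \<le> (L + 2) * ?g"
      "exec (compile c) (hd i, o' i) t (lmem c (hd i), o' (Suc i))"
      using body[OF hd_bound] ik by (auto simp: o'_Suc)
    let ?m = "lmem c (hd i)"
    have "Suc i * (?g + ?w) \<le> k * (?g + ?w)" using ik by (intro mult_le_mono1) simp
    then have "v + 1 + i * (?g + ?w) + ?g \<le> L" using L by simp
    then have "mem_bound ?m L" using body[OF hd_bound] ik mem_bound_mono by auto
    from acost_bound[OF this, of "N 0"] acost_bound[OF this, of "Plus (Cell x (N 0)) (N 1)"]
    have u: "1 + acost (N 0) ?m + acost (Plus (Cell x (N 0)) (N 1)) ?m \<le> (L + 2) * 27"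
      by (simp add: algebra_simps)
    have "store ?m x (aval (N 0) ?m) (aval (Plus (Cell x (N 0)) (N 1)) ?m) = hd (Suc i)"
      using lmem_frame[OF xc, of "hd i"] hd_x[of i] by (simp add: hd_Suc add.commute)
    then have "exec ?body (hd i, o' i)
        (t + (1 + acost (N 0) ?m + acost (Plus (Cell x (N 0)) (N 1)) ?m)) (hd (Suc i), o' (Suc i))"
      using exec.Seq[OF t(2) exec.Store[of x "N 0" "Plus (Cell x (N 0)) (N 1)" ?m]] by simp
    moreover have "1 + bcost ?test (hd i) +
        (t + (1 + acost (N 0) ?m + acost (Plus (Cell x (N 0)) (N 1)) ?m)) \<le> (L + 2) * (?g + ?w)"
      using t(1) u test[of i] ik by (simp add: distrib_left)
    ultimately show ?thesis by blast
  qed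
  have loop: "i \<le> k \<Longrightarrow> \<exists>t \<le> (L + 2) * ((k - i) * (?g + ?w) + 6 + aweight e).
      exec (While ?test ?body) (hd i, o' i) t (hd k, o' k)" for i
  proof (induction "k - i" arbitrary: i)
    case 0
    then have ik: "i = k" by simp
    have "\<not> bval ?test (hd k)" using hd_x[of k] by (simp add: e_hd k_def)
    from exec.WhileFalse[OF this] test[of k] show ?case
      unfolding ik by (intro exI[of _ "1 + bcost ?test (hd k)"]) simp
  next
    case (Suc j)
    then have ik: "i < k" by simp
    obtain t where t: "t \<le> (L + 2) * ((k - Suc i) * (?g + ?w) + 6 + aweight e)"
      "exec (While ?test ?body) (hd (Suc i), o' (Suc i)) t (hd k, o' k)"
    proof -
      have "j = k - Suc i" "Suc i \<le> k" using Suc.hyps(2) by linarith+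
      from Suc.hyps(1)[OF this] show thesis using that by blast
    qed
    obtain u where u: "1 + bcost ?test (hd i) + u \<le> (L + 2) * (?g + ?w)"
      "exec ?body (hd i, o' i) u (hd (Suc i), o' (Suc i))" using iter[OF ik] by blast
    have "bval ?test (hd i)" using hd_x[of i] ik by (simp add: e_hd k_def)
    then have "exec (While ?test ?body) (hd i, o' i) (1 + bcost ?test (hd i) + u + t) (hd k, o' k)"
      using u(2) t(2) exec.WhileTrue by blast
    moreover have "1 + bcost ?test (hd i) + u + t \<le> (L + 2) * ((k - i) * (?g + ?w) + 6 + aweight e)"
    proof -
      have "(k - i) * (?g + ?w) = (?g + ?w) + (k - Suc i) * (?g + ?w)"
        using ik by (metis Suc_diff_Suc mult_Suc)
      then have "(L + 2) * ((k - i) * (?g + ?w) + 6 + aweight e) =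
          (L + 2) * (?g + ?w) + (L + 2) * ((k - Suc i) * (?g + ?w) + 6 + aweight e)"
        by (simp only: distrib_left add.assoc)
      then show ?thesis using t(1) u(1) by linarith
    qed
    ultimately show ?case by blast
  qed
  obtain t where t: "t \<le> (L + 2) * (k * (?g + ?w) + 6 + aweight e)"
    "exec (While ?test ?body) (hd 0, o' 0) t (hd k, o' k)" using loop[of 0] by auto
  have "exec (Store x (N 0) (N 0)) (m, out) 3 (hd 0, o' 0)"
    using exec.Store[of x "N 0" "N 0" m out] by (simp add: hd_def o'_def int_size_def floorlog_def eval_nat_numeral)
  then have "exec (compile (For x e c)) (m, out) (3 + t) (hd k, o' k)"
    using t(2) exec.Seq by (simp only: compile.simps)
  moreover have "3 + t \<le> (L + 2) * poly (step_poly (For x e c)) K"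
  proof -
    have "k * (?g + ?w) \<le> K * (?g + ?w)" using kK by (rule mult_le_mono1)
    then have "(k * (?g + ?w) + 6 + aweight e) + 2 \<le> poly (step_poly (For x e c)) K" unfolding poly_For by linarith
    then have "(L + 2) * ((k * (?g + ?w) + 6 + aweight e) + 2) \<le> (L + 2) * poly (step_poly (For x e c)) K"
      by (rule mult_le_mono2)
    moreover have "3 \<le> (L + 2) * 2" by simp
    ultimately show ?thesis using t(1) by (simp only: distrib_left)
  qed
  moreover have "hd k = lmem (For x e c) m" "o' k = out @ lout (For x e c) m"
    by (simp_all add: hd_def o'_def k_def)
  moreover have "mem_bound (hd k) (v + poly (step_poly (For x e c)) K)"
    using mem_bound_mono[OF hd_bound G] by simp
  ultimately show ?case by metis
qed

lemma length_le_input_size: "length xs \<le> input_size xs"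
proof -
  have "length xs = (\<Sum>x\<leftarrow>xs. 1)" by (simp add: sum_list_triv)
  also have "\<dots> \<le> input_size xs"
    unfolding input_size_def by (intro sum_list_mono) (simp add: int_size_def)
  finally show ?thesis .
qed

lemma initial_memory_bounded: "mem_bound (initial_memory xs) (input_size xs + 1)"
proof -
  have int: "\<bar>x\<bar> < 2 ^ (input_size xs + 1)" if "x \<in> set xs" for x
  proof -
    have "int_size x \<le> input_size xs"
      unfolding input_size_def using that by (intro member_le_sum_list) auto
    then have "floorlog 2 (nat \<bar>x\<bar>) \<le> input_size xs + 1" by (simp add: int_size_def)
    then have "nat \<bar>x\<bar> < 2 ^ (input_size xs + 1)"
      using floorlog_le_iff[of 2 "nat \<bar>x\<bar>" "input_size xs + 1"] by simp
    then show ?thesis by (simp add: nat_less_iff)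
  qed
  have "length xs \<le> input_size xs" by (rule length_le_input_size)
  also have "\<dots> < 2 ^ (input_size xs + 1)"
    by (metis less_exp less_add_one order_less_trans)
  finally have "length xs < 2 ^ (input_size xs + 1)" .
  then have "int (length xs) < 2 ^ (input_size xs + 1)" by (metis of_nat_less_iff of_nat_numeral of_nat_power)
  moreover have "(0::int) < 2 ^ (input_size xs + 1)" by simp
  ultimately show ?thesis
    unfolding mem_bound_def initial_memory_def using int
    by (auto simp: nat_less_iff)
qed

theorem compile_polynomial:
  assumes "well_formed c" "''in'' \<notin> writes c"
    and "\<And>xs e m. xs \<in> X \<Longrightarrow> e \<in> loop_bounds c \<Longrightarrow> m ''in'' = initial_memory xs ''in'' \<Longrightarrow>
      aval e m \<le> 2 * int (length xs) + 1"
  shows "polynomial_time_on X (compile c)"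
    and "\<And>xs. xs \<in> X \<Longrightarrow> \<exists>t. run (compile c) xs t (lout c (initial_memory xs))"
proof -
  \<comment> \<open>With \<open>s\<close> the input size, loop bounds are at most
    \<open>2 * s + 1\<close>, and \<open>L + 2\<close> equals \<open>s + 3\<close> plus the growth,
    since the initial memory fits into \<open>s + 1\<close> bits.\<close>
  define P where "P = (step_poly c \<circ>\<^sub>p [:1, 2:] + [:3, 1:]) * (step_poly c \<circ>\<^sub>p [:1, 2:])"
  have *: "\<exists>t \<le> poly P (input_size xs). run (compile c) xs t (lout c (initial_memory xs))" if "xs \<in> X" for xs
  proof -
    let ?s = "input_size xs" let ?K = "2 * ?s + 1"
    let ?G = "poly (step_poly c) ?K"
    have "mem_bound (lmem c (initial_memory xs)) (?s + 1 + ?G) \<and>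
      (\<exists>t \<le> (?s + 1 + ?G + 2) * ?G. exec (compile c) (initial_memory xs, []) t
         (lmem c (initial_memory xs), [] @ lout c (initial_memory xs)))"
    proof (rule exec_compile[OF assms(1) initial_memory_bounded _ order_refl])
      fix e m' assume "e \<in> loop_bounds c" "\<And>x. x \<notin> writes c \<Longrightarrow> m' x = initial_memory xs x"
      then have "aval e m' \<le> 2 * int (length xs) + 1" using assms(2,3) that by blast
      then show "aval e m' \<le> int ?K" using length_le_input_size[of xs] by simp
    qed
    moreover have "(?s + 1 + ?G + 2) * ?G = poly P ?s"
      by (simp add: P_def poly_pcompose mult_2 mult_2_right add.commute add.left_commute distrib_right numeral_eq_Suc)
    ultimately show ?thesis by (auto simp: run_def)
  qed
  then show "polynomial_time_on X (compile c)" unfolding polynomial_time_on_def by blast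
  show "\<And>xs. xs \<in> X \<Longrightarrow> \<exists>t. run (compile c) xs t (lout c (initial_memory xs))" using * by blast
qed

text \<open>\<open>I i\<close> describes the memory after \<open>i\<close> rounds, when the counter
  is about to be overwritten; hence it must not depend on the counter cell (\<open>stable\<close>).
  The step receives frame equations for everything the loop does not write, so an invariant needs to
  mention only what changes.\<close>

lemma For_invariant:
  assumes "nat (aval e m) = k" "I 0 m"
    and step: "\<And>i m'. i < k \<Longrightarrow> (\<And>y. y \<notin> insert x (writes c) \<Longrightarrow> m' y = m y) \<Longrightarrow> m' x 0 = int i \<Longrightarrow>
      I i m' \<Longrightarrow> I (Suc i) (lmem c m')"
    and stable: "\<And>i m' v. I i m' \<Longrightarrow> I i (store m' x 0 v)"
  shows "I k (lmem (For x e c) m)"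
proof -
  have "i \<le> k \<Longrightarrow> I i (loop_state x c m i)" for i
  proof (induction i)
    case (Suc i)
    show ?case unfolding nat.rec
      by (rule step) (use Suc in \<open>auto simp: store_apply[of _ _ _ _ x] store_other loop_state_frame intro: stable\<close>)
  qed (use assms(2) in simp)
  then show ?thesis using assms(1) stable by simp
qed

text \<open>The invariant is indexed by the set of pairs handled so far, in row-major order. Claims
  about all tried candidates or all relaxed pairs then need no case distinction between finished
  rows and the current one.\<close>

lemma nested_For_invariant:
  assumes e: "nat (aval e m) = k" and I: "I {} m"
    and fixed: "avars e \<inter> ({x, y} \<union> writes c) = {}" and x: "x \<notin> writes c" "x \<noteq> y"
    and step: "\<And>i j m'. i < k \<Longrightarrow> j < k \<Longrightarrow> m' x 0 = int i \<Longrightarrow> m' y 0 = int j \<Longrightarrow>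
      (\<And>z. z \<notin> {x, y} \<union> writes c \<Longrightarrow> m' z = m z) \<Longrightarrow> I ({..<i} \<times> {..<k} \<union> {i} \<times> {..<j}) m' \<Longrightarrow>
      I (insert (i, j) ({..<i} \<times> {..<k} \<union> {i} \<times> {..<j})) (lmem c m')"
    and stable: "\<And>D m' v. I D m' \<Longrightarrow> I D (store m' x 0 v)" "\<And>D m' v. I D m' \<Longrightarrow> I D (store m' y 0 v)"
  shows "I ({..<k} \<times> {..<k}) (lmem (For x e (For y e c)) m)"
proof (rule For_invariant[where I = "\<lambda>i. I ({..<i} \<times> {..<k})"])
  fix i m1 assume i: "i < k" and fr1: "\<And>z. z \<notin> insert x (writes (For y e c)) \<Longrightarrow> m1 z = m z"
    and x1: "m1 x 0 = int i" and I1: "I ({..<i} \<times> {..<k}) m1"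
  have "I ({..<i} \<times> {..<k} \<union> {i} \<times> {..<k}) (lmem (For y e c) m1)"
  proof (rule For_invariant[where I = "\<lambda>j. I ({..<i} \<times> {..<k} \<union> {i} \<times> {..<j})"])
    have "aval e m1 = aval e m" by (rule aval_cong, rule fr1) (use fixed in auto)
    then show "nat (aval e m1) = k" using e by simp
    fix j m2 assume j: "j < k" and fr2: "\<And>z. z \<notin> insert y (writes c) \<Longrightarrow> m2 z = m1 z"
      and y2: "m2 y 0 = int j" and I2: "I ({..<i} \<times> {..<k} \<union> {i} \<times> {..<j}) m2"
    have "{..<i} \<times> {..<k} \<union> {i} \<times> {..<Suc j} = insert (i, j) ({..<i} \<times> {..<k} \<union> {i} \<times> {..<j})" by auto
    then show "I ({..<i} \<times> {..<k} \<union> {i} \<times> {..<Suc j}) (lmem c m2)"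
      using step[OF i j _ y2 _ I2] x x1 fr1 fr2 by simp
  qed (use I1 stable in auto)
  moreover have "{..<Suc i} \<times> {..<k} = {..<i} \<times> {..<k} \<union> {i} \<times> {..<k}" by auto
  ultimately show "I ({..<Suc i} \<times> {..<k}) (lmem (For y e c) m1)" by simp
qed (use e I stable in auto)

lemma For_output:
  assumes "nat (aval e m) = k"
    and "\<And>i m'. i < k \<Longrightarrow> (\<And>y. y \<notin> insert x (writes c) \<Longrightarrow> m' y = m y) \<Longrightarrow> m' x 0 = int i \<Longrightarrow>
      lout c m' = g i"
  shows "lout (For x e c) m = concat (map g [0..<k])"
proof -
  have "lout c (store (loop_state x c m i) x 0 (int i)) = g i" if "i < k" for i
    by (rule assms(2)[OF that]) (auto simp: store_apply[of _ _ _ _ x] store_other loop_state_frame)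
  then show ?thesis using assms(1) by (auto intro!: arg_cong[of _ _ concat])
qed

primrec silent :: "lcom \<Rightarrow> bool" where
  "silent LSkip = True"
| "silent (Assign x i e) = True"
| "silent (Out e) = False"
| "silent (c ;; d) = (silent c \<and> silent d)"
| "silent (LIf b c d) = (silent c \<and> silent d)"
| "silent (For x e c) = silent c"

lemma lout_silent: "silent c \<Longrightarrow> lout c m = []"
  by (induction c arbitrary: m) auto

declare lmem.simps(6) [simp del] lout.simps(6) [simp del]

section \<open>Minimum busy time of non-preemptive jobs\<close>

lemma fmeasurable_ico: "{a..<b::real} \<in> fmeasurable lborel"
  by (cases "a \<le> b") (auto intro: fmeasurableI)

definition total_length :: "(real \<times> real) set \<Rightarrow> real" where
  "total_length I = (\<Sum>(a, b)\<in>I. b - a)"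

lemma measure_disjoint_intervals:
  fixes I :: "(real \<times> real) set"
  assumes "finite I" "\<And>a b. (a, b) \<in> I \<Longrightarrow> a \<le> b"
    and "\<And>a b c d. (a, b) \<in> I \<Longrightarrow> (c, d) \<in> I \<Longrightarrow> (a, b) \<noteq> (c, d) \<Longrightarrow> {a..<b} \<inter> {c..<d} = {}"
  shows "measure lborel (\<Union>(a, b)\<in>I. {a..<b}) = total_length I"
proof -
  have "measure lborel (\<Union>x\<in>I. case x of (a, b) \<Rightarrow> {a..<b}) =
      (\<Sum>x\<in>I. measure lborel (case x of (a, b) \<Rightarrow> {a..<b}))"
  proof (rule measure_finite_Union[OF assms(1)])
    show "disjoint_family_on (\<lambda>x. case x of (a, b) \<Rightarrow> {a..<b}) I"
      using assms(3) unfolding disjoint_family_on_def by fast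
    show "emeasure lborel (case x of (a, b) \<Rightarrow> {a..<b}) \<noteq> \<infinity>" if "x \<in> I" for x
      using assms(2) that by (cases x) simp
  qed (auto split: prod.splits)
  also have "\<dots> = total_length I"
    unfolding total_length_def by (intro sum.cong) (use assms(2) in \<open>auto split: prod.splits\<close>)
  finally show ?thesis .
qed

text \<open>
  Among the families of intervals that contain each given interval in one of their members and
  have no larger union, one of minimal cardinality is disjoint, since two overlapping members
  could be replaced by their convex hull.
\<close>

lemma disjoint_hull_family:
  fixes J :: "(real \<times> real) set"
  assumes "finite J" "\<And>a b. (a, b) \<in> J \<Longrightarrow> a \<le> b"
  obtains I where "finite I" "\<And>a b. (a, b) \<in> I \<Longrightarrow> a \<le> b"
    "\<And>c d. (c, d) \<in> J \<Longrightarrow> \<exists>(a, b)\<in>I. a \<le> c \<and> d \<le> b"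
    "total_length I \<le> measure lborel (\<Union>(a, b)\<in>J. {a..<b})"
proof -
  define U where "U = (\<Union>(a, b)\<in>J. {a..<b})"
  define P where "P I \<longleftrightarrow> finite I \<and> (\<forall>(a, b)\<in>I. a \<le> b) \<and>
    (\<forall>(c, d)\<in>J. \<exists>(a, b)\<in>I. a \<le> c \<and> d \<le> b) \<and> (\<Union>(a, b)\<in>I. {a..<b}) \<subseteq> U" for I
  have "P J" unfolding P_def U_def using assms by auto
  then obtain I where I: "P I" "\<And>I'. P I' \<Longrightarrow> card I \<le> card I'"
    using ex_has_least_nat[of P J card] by blast
  have fin: "finite I" and le: "\<And>a b. (a, b) \<in> I \<Longrightarrow> a \<le> b" using I(1) unfolding P_def by auto
  have cov: "\<exists>(a, b)\<in>I. a \<le> x \<and> y \<le> b" if "(x, y) \<in> J" for x y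
    using I(1) that unfolding P_def by auto
  have sub: "(\<Union>(a, b)\<in>I. {a..<b}) \<subseteq> U" using I(1) unfolding P_def by simp
  have disj: "{a..<b} \<inter> {c..<d} = {}" if ab: "(a, b) \<in> I" and cd: "(c, d) \<in> I" and ne: "(a, b) \<noteq> (c, d)" for a b c d
  proof (rule ccontr)
    assume *: "{a..<b} \<inter> {c..<d} \<noteq> {}"
    define I' where "I' = insert (min a c, max b d) (I - {(a, b), (c, d)})"
    have un: "{min a c..<max b d} = {a..<b} \<union> {c..<d}" using * by auto
    have "finite I'" using fin by (simp add: I'_def)
    moreover have "\<forall>(a, b)\<in>I'. a \<le> b" using le[OF ab] le[OF cd] le
      by (auto simp: I'_def min_le_iff_disj le_max_iff_disj)
    moreover have "\<exists>(a', b')\<in>I'. a' \<le> x \<and> y \<le> b'" if xy: "(x, y) \<in> J" for x y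
    proof -
      obtain a1 b1 where 1: "(a1, b1) \<in> I" "a1 \<le> x" "y \<le> b1" using cov[OF xy] by auto
      show ?thesis
      proof (cases "(a1, b1) \<in> {(a, b), (c, d)}")
        case True
        then have "min a c \<le> x \<and> y \<le> max b d" using 1 by auto
        then show ?thesis by (auto simp: I'_def)
      next
        case False
        then show ?thesis using 1 by (auto simp: I'_def)
      qed
    qed
    moreover have "(\<Union>(a, b)\<in>I'. {a..<b}) \<subseteq> U"
    proof -
      have "(\<Union>(a, b)\<in>I'. {a..<b}) \<subseteq> (\<Union>(a, b)\<in>I. {a..<b})"
      proof
        fix t assume "t \<in> (\<Union>(a, b)\<in>I'. {a..<b})"
        then obtain x y where xy: "(x, y) \<in> I'" "t \<in> {x..<y}" by auto
        have mem: "(u, v) \<in> I \<Longrightarrow> t \<in> {u..<v} \<Longrightarrow> t \<in> (\<Union>(a, b)\<in>I. {a..<b})" for u v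
          by (rule UN_I[of "(u, v)"]) simp_all
        show "t \<in> (\<Union>(a, b)\<in>I. {a..<b})"
        proof (cases "(x, y) \<in> I")
          case False
          then have "(x, y) = (min a c, max b d)" using xy(1) unfolding I'_def by blast
          then have "t \<in> {a..<b} \<union> {c..<d}" using xy(2) unfolding un[symmetric] by (metis prod.inject)
          then show ?thesis using mem[OF ab] mem[OF cd] by (metis UnE)
        qed (use mem xy in metis)
      qed
      then show ?thesis using sub by (rule order_trans)
    qed
    ultimately have "P I'" unfolding P_def by auto
    moreover have "card I' < card I"
    proof -
      have "card (I - {(a, b), (c, d)}) = card I - 2"
        using ab cd ne fin by (subst card_Diff_subset) auto
      moreover have "card {(a, b), (c, d)} \<le> card I" using ab cd fin by (intro card_mono) auto
      ultimately show ?thesis using ne fin by (auto simp: I'_def card_insert_if)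
    qed
    ultimately show False using I(2) by fastforce
  qed
  have "total_length I = measure lborel (\<Union>(a, b)\<in>I. {a..<b})"
    using measure_disjoint_intervals[OF fin le disj] by simp
  also have "\<dots> \<le> measure lborel U"
  proof (rule measure_mono_fmeasurable)
    show "(\<Union>(a, b)\<in>I. {a..<b}) \<subseteq> U" by (rule sub)
    show "(\<Union>(a, b)\<in>I. {a..<b}) \<in> sets lborel" using fin by (auto intro!: sets.finite_UN split: prod.splits)
    show "U \<in> fmeasurable lborel" unfolding U_def using assms(1)
      by (auto intro!: fmeasurable.finite_UN fmeasurable_ico split: prod.splits)
  qed
  finally have len: "total_length I \<le> measure lborel U" .
  from that[OF fin le cov] len show ?thesis unfolding U_def by blast
qed

locale jobs =
  fixes n :: nat and r p d :: "nat \<Rightarrow> int"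
  assumes p_nonneg: "\<And>j. j < n \<Longrightarrow> 0 \<le> p j"
    and fits: "\<And>j. j < n \<Longrightarrow> r j + p j \<le> d j"
begin

definition e :: "nat \<Rightarrow> int" where "e j = r j + p j"
definition l :: "nat \<Rightarrow> int" where "l j = d j - p j"

text \<open>
  \<open>e j\<close> is the earliest completion time and \<open>l j\<close> the latest start time, so that \<open>serves (a, b) j\<close> says
  that job \<open>j\<close> can be run within \<open>{a..<b}\<close>.
\<close>

fun serves :: "real \<times> real \<Rightarrow> nat \<Rightarrow> bool" where
  "serves (a, b) j \<longleftrightarrow> a \<le> real_of_int (l j) \<and> real_of_int (e j) \<le> b \<and> real_of_int (p j) \<le> b - a"

definition covers :: "(real \<times> real) set \<Rightarrow> nat set \<Rightarrow> bool" where
  "covers I Q \<longleftrightarrow> finite I \<and> (\<forall>(a, b)\<in>I. a \<le> b) \<and> (\<forall>j\<in>Q. \<exists>x\<in>I. serves x j)"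

definition busy :: "nat set \<Rightarrow> (nat \<Rightarrow> real) \<Rightarrow> real set" where
  "busy Q s = (\<Union>j\<in>Q. {s j..<s j + p j})"

text \<open>A certificate of optimality: the integer starts achieve \<open>f\<close>, and no cover
  is shorter. Competing with covers by real intervals, rather than with schedules, makes induction
  possible, since any part of a cover is again a cover of the jobs it serves.\<close>

definition solution :: "nat set \<Rightarrow> int \<Rightarrow> (nat \<Rightarrow> int) \<Rightarrow> bool" where
  "solution Q f s \<longleftrightarrow> (\<forall>j\<in>Q. r j \<le> s j \<and> s j \<le> l j) \<and> measure lborel (busy Q s) \<le> f \<and>
     (\<forall>I. covers I Q \<longrightarrow> f \<le> total_length I)"

text \<open>Runs of different jobs may overlap, and then the sum of their lengths exceeds the busy
  time. Merging them into disjoint hulls repairs this, and a hull containing an admissible run of a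
  job serves that job. So lower bounds for covers apply to schedules with real start times.\<close>

lemma schedule_covers:
  fixes s :: "nat \<Rightarrow> real"
  assumes "Q \<subseteq> {..<n}" "\<And>j. j \<in> Q \<Longrightarrow> r j \<le> s j \<and> s j \<le> l j"
  obtains I where "covers I Q" "total_length I \<le> measure lborel (busy Q s)"
proof -
  have fin: "finite Q" using assms(1) finite_subset by blast
  have le: "a \<le> b" if "(a, b) \<in> (\<lambda>j. (s j, s j + p j)) ` Q" for a b
    using that assms(1) p_nonneg by auto
  obtain I where I: "finite I" "\<And>a b. (a, b) \<in> I \<Longrightarrow> a \<le> b"
    "\<And>c d. (c, d) \<in> (\<lambda>j. (s j, s j + p j)) ` Q \<Longrightarrow> \<exists>(a, b)\<in>I. a \<le> c \<and> d \<le> b"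
    "total_length I \<le> measure lborel (\<Union>(a, b)\<in>(\<lambda>j. (s j, s j + p j)) ` Q. {a..<b})"
    by (rule disjoint_hull_family[OF finite_imageI[OF fin], of "\<lambda>j. (s j, s j + p j)"]) (rule le, assumption, rule that)
  have "\<exists>x\<in>I. serves x j" if j: "j \<in> Q" for j
  proof -
    obtain a b where ab: "(a, b) \<in> I" "a \<le> s j" "s j + p j \<le> b" using I(3) j by blast
    have "real_of_int (e j) \<le> s j + p j" "s j \<le> l j" using assms(2)[OF j] by (auto simp: e_def)
    then have "serves (a, b) j" using ab unfolding serves.simps by auto
    then show ?thesis using ab by blast
  qed
  then have "covers I Q" using I(1,2) unfolding covers_def by auto
  moreover have "(\<Union>(a, b)\<in>(\<lambda>j. (s j, s j + p j)) ` Q. {a..<b}) = busy Q s"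
    by (auto simp: busy_def)
  ultimately show ?thesis using that I(4) by metis
qed

lemma fmeasurable_busy: "finite Q \<Longrightarrow> busy Q s \<in> fmeasurable lborel"
  unfolding busy_def by (auto intro!: fmeasurable.finite_UN fmeasurable_ico)

lemma solution_empty: "solution {} 0 s"
proof -
  have "0 \<le> total_length I" if "covers I {}" for I
    unfolding total_length_def by (rule sum_nonneg) (use that in \<open>auto simp: covers_def\<close>)
  then show ?thesis by (simp add: solution_def busy_def)
qed

text \<open>
  In a cover \<open>M\<close> of minimal cardinality, let \<open>(a\<^sub>0, b\<^sub>0)\<close> serve the longest job; tightening it to
  \<open>[a, b]\<close> keeps all the jobs it serves. A further member of \<open>M\<close> that serves both a job with \<open>l j < a\<close>
  and a job with \<open>e j > b\<close> would contain \<open>[a, b]\<close>, and so would make \<open>(a\<^sub>0, b\<^sub>0)\<close> redundant.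
\<close>

lemma lower_bound_split:
  assumes Q: "Q \<subseteq> {..<n}" and J: "J \<in> Q" and longest: "\<And>j. j \<in> Q \<Longrightarrow> p j \<le> p J"
    and cov: "covers I Q"
  obtains i k IL IR where "i < n" "k < n"
    "covers IL {j \<in> Q. l j < min (l i) (l J)}"
    "covers IR {j \<in> Q. max (e k) (max (e J) (min (l i) (l J) + p J)) < e j}"
    "max (e k) (max (e J) (min (l i) (l J) + p J)) - min (l i) (l J) + total_length IL + total_length IR
       \<le> total_length I"
proof -
  have "\<exists>I'. covers I' Q \<and> total_length I' \<le> total_length I \<and>
      (\<forall>I''. covers I'' Q \<and> total_length I'' \<le> total_length I \<longrightarrow> card I' \<le> card I'')"
    using ex_has_least_nat[of "\<lambda>I'. covers I' Q \<and> total_length I' \<le> total_length I" I card] cov by auto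
  then obtain M where M: "covers M Q" "total_length M \<le> total_length I"
    and least: "\<And>I'. covers I' Q \<Longrightarrow> total_length I' \<le> total_length I \<Longrightarrow> card M \<le> card I'"
    by blast
  obtain a0 b0 where ab0: "(a0, b0) \<in> M" and sJ: "serves (a0, b0) J"
    using M(1) J unfolding covers_def by fast
  have finM: "finite M" and leM: "\<And>a b. (a, b) \<in> M \<Longrightarrow> a \<le> b" using M(1) unfolding covers_def by auto
  define S where "S = {j \<in> Q. serves (a0, b0) j}"
  have S: "finite S" "J \<in> S" "S \<subseteq> Q" "S \<subseteq> {..<n}" "l ` S \<noteq> {}" "e ` S \<noteq> {}"
    using Q J sJ finite_subset[OF Q] by (auto simp: S_def)
  obtain i where i: "i \<in> S" "l i = Min (l ` S)" using Min_in[of "l ` S"] S by (metis finite_imageI imageE)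
  obtain k where k: "k \<in> S" "e k = Max (e ` S)" using Max_in[of "e ` S"] S by (metis finite_imageI imageE)
  \<comment> \<open>\<open>a\<close> is the largest left end that still serves all of
    \<open>S\<close>, and \<open>b\<close> the smallest right end that goes with it. Both are
    expressed by the indices \<open>i\<close>, \<open>k\<close> and \<open>J\<close> alone, in the
    form in which the program enumerates them.\<close>
  define a where "a = min (l i) (l J)"
  define b where "b = max (e k) (max (e J) (a + p J))"
  have ai: "a = l i" using i S by (auto simp: a_def)
  have la: "a \<le> l j" and eb: "e j \<le> b" if "j \<in> S" for j
    using that i k S by (auto simp: ai b_def le_max_iff_disj)
  have pJ: "p J \<le> b - a" by (auto simp: b_def)
  \<comment> \<open>\<open>a0\<close> is at most \<open>a\<close>, the values \<open>e k\<close> and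
    \<open>e J\<close> are at most \<open>b0\<close>, and \<open>p J\<close> is at most
    \<open>b0 - a0\<close>, so each of the three terms of the maximum gives the bound.\<close>
  have ab_le: "real_of_int (b - a) \<le> b0 - a0"
    using i(1) k(1) S(2) unfolding S_def serves.simps b_def ai by auto
  have out: "(a1, b1) \<in> M \<Longrightarrow> (a1, b1) \<noteq> (a0, b0) \<Longrightarrow> j1 \<in> Q \<Longrightarrow> l j1 < a \<Longrightarrow> serves (a1, b1) j1 \<Longrightarrow>
      j2 \<in> Q \<Longrightarrow> b < e j2 \<Longrightarrow> serves (a1, b1) j2 \<Longrightarrow> False" for a1 b1 j1 j2
  proof -
    assume x: "(a1, b1) \<in> M" "(a1, b1) \<noteq> (a0, b0)" and 1: "j1 \<in> Q" "l j1 < a" "serves (a1, b1) j1"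
      and 2: "j2 \<in> Q" "b < e j2" "serves (a1, b1) j2"
    have a1: "a1 < a" and b1: "b < b1" using 1 2 unfolding serves.simps by auto
    have "serves (a1, b1) j" if "j \<in> S" for j
    proof -
      have "real_of_int (p j) \<le> b1 - a1" using longest[of j] that S(3) pJ a1 b1 by auto
      then show ?thesis using la[OF that] eb[OF that] a1 b1 unfolding serves.simps by auto
    qed
    then have "covers (M - {(a0, b0)}) Q"
      using M(1) x unfolding covers_def S_def by fast
    moreover have "total_length (M - {(a0, b0)}) \<le> total_length I"
      using M(2) ab0 finM leM[OF ab0] by (simp add: total_length_def sum_diff1)
    ultimately have "card M \<le> card (M - {(a0, b0)})" by (rule least)
    then show False using card_Diff1_less[OF finM ab0] by linarith
  qed
  \<comment> \<open>Serving one left job puts an interval on the left; by \<open>out\<close> it then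
    serves no right job, so the remaining intervals suffice for the right side.\<close>
  define IL where "IL = {x \<in> M - {(a0, b0)}. \<exists>j\<in>Q. l j < a \<and> serves x j}"
  define IR where "IR = M - {(a0, b0)} - IL"
  have notS: "\<not> serves (a0, b0) j" if "j \<in> Q" "l j < a \<or> b < e j" for j
    using that la[of j] eb[of j] unfolding S_def by force
  have cL: "covers IL {j \<in> Q. l j < a}"
    unfolding covers_def
  proof (intro conjI ballI)
    fix j assume j: "j \<in> {j \<in> Q. l j < a}"
    then obtain x where x: "x \<in> M" "serves x j" using M(1) unfolding covers_def by blast
    moreover have "x \<noteq> (a0, b0)" using j x notS by auto
    ultimately have "x \<in> IL" unfolding IL_def using j by blast
    then show "\<exists>x\<in>IL. serves x j" using x by blast
  qed (use finM leM in \<open>auto simp: IL_def\<close>)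
  have cR: "covers IR {j \<in> Q. b < e j}"
    unfolding covers_def
  proof (intro conjI ballI)
    fix j assume j: "j \<in> {j \<in> Q. b < e j}"
    then obtain x where x: "x \<in> M" "serves x j" using M(1) unfolding covers_def by blast
    moreover have "x \<noteq> (a0, b0)" using j x notS by auto
    moreover have "x \<notin> IL" using out[of "fst x" "snd x" _ j] x j unfolding IL_def by auto
    ultimately show "\<exists>x\<in>IR. serves x j" unfolding IR_def by auto
  qed (use finM leM in \<open>auto simp: IR_def\<close>)
  have "total_length M = (b0 - a0) + (total_length IL + total_length IR)"
  proof -
    have "total_length M = (b0 - a0) + total_length (M - {(a0, b0)})"
      using sum.remove[OF finM ab0, of "\<lambda>(a, b). b - a"] by (simp add: total_length_def)
    moreover have "total_length (M - {(a0, b0)}) = total_length IR + total_length IL"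
      unfolding total_length_def IR_def using finM by (intro sum.subset_diff) (auto simp: IL_def)
    ultimately show ?thesis by simp
  qed
  then have "(b - a) + total_length IL + total_length IR \<le> total_length I"
    using ab_le M(2) by linarith
  then show ?thesis using that[of i k IL IR] cL cR i(1) k(1) S(4)
    unfolding b_def a_def by auto
qed

text \<open>The recurrence of the dynamic program: \<open>f\<close> is attained by the candidate
  \<open>(i0, k0)\<close> and exceeds no candidate. With \<open>a\<close>, \<open>b\<close> the ends
  for \<open>(i0, k0)\<close>, a job left to the central interval starts at
  \<open>max a (r j)\<close> and ends at \<open>max (a + p j) (e j) \<le> b\<close>, because
  \<open>p j \<le> p J\<close>. For the lower bound, \<open>lower_bound_split\<close> names the
  candidate that a given cover has to be compared with.\<close>

lemma solution_step:
  assumes Q: "Q \<subseteq> {..<n}" and J: "J \<in> Q" and longest: "\<And>j. j \<in> Q \<Longrightarrow> p j \<le> p J"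
    and a_def: "\<And>i. a i = min (l i) (l J)"
    and b_def: "\<And>i k. b i k = max (e k) (max (e J) (a i + p J))"
    and le: "\<And>i k. i < n \<Longrightarrow> k < n \<Longrightarrow> \<exists>fL sL fR sR. solution {j \<in> Q. l j < a i} fL sL \<and>
      solution {j \<in> Q. b i k < e j} fR sR \<and> f \<le> b i k - a i + fL + fR"
    and eq: "f = b i0 k0 - a i0 + fL + fR"
    and SL: "solution {j \<in> Q. l j < a i0} fL sL"
    and SR: "solution {j \<in> Q. b i0 k0 < e j} fR sR"
    and s: "\<And>j. j \<in> Q \<Longrightarrow> s j = (if l j < a i0 then sL j
      else if b i0 k0 < e j then sR j else max (a i0) (r j))"
  shows "solution Q f s"
  unfolding solution_def
proof (intro conjI allI impI)
  let ?a = "a i0" and ?b = "b i0 k0"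
  let ?QL = "{j \<in> Q. l j < ?a}" and ?QR = "{j \<in> Q. ?b < e j}"
  have rl: "r j \<le> l j" if "j \<in> Q" for j using Q that fits[of j] by (auto simp: l_def)
  have pJ: "?a + p J \<le> ?b" by (simp add: b_def)
  have LR: "\<not> (l j < ?a \<and> ?b < e j)" if "j \<in> Q" for j
  proof -
    have "e j \<le> l j + p J" using longest[OF that] fits[of j] Q that by (auto simp: e_def l_def)
    then show ?thesis using pJ by linarith
  qed
  show "\<forall>j\<in>Q. r j \<le> s j \<and> s j \<le> l j"
    using s SL SR rl unfolding solution_def by auto
  have fin: "finite Q" using Q finite_subset by blast
  have "busy Q s \<subseteq> busy ?QL sL \<union> busy ?QR sR \<union> {real_of_int ?a..<?b}"
  proof
    fix x assume "x \<in> busy Q s"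
    then obtain j where j: "j \<in> Q" "s j \<le> x" "x < s j + p j" by (auto simp: busy_def)
    consider "l j < ?a" | "\<not> l j < ?a" "?b < e j" | "?a \<le> l j" "e j \<le> ?b" by linarith
    then show "x \<in> busy ?QL sL \<union> busy ?QR sR \<union> {real_of_int ?a..<?b}"
    proof cases
      case 1 then show ?thesis using s[of j] j by (auto simp: busy_def)
    next
      case 2 then show ?thesis using s[of j] j by (auto simp: busy_def)
    next
      case 3
      then have sj: "s j = max ?a (r j)" using s[of j] j by auto
      have "s j + p j \<le> ?b" unfolding sj using pJ longest[OF j(1)] 3 by (auto simp: e_def)
      then have "real_of_int (s j) + p j \<le> ?b" by linarith
      moreover have "real_of_int ?a \<le> s j" unfolding sj by simp
      ultimately show ?thesis using j by auto
    qed
  qed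
  then have "measure lborel (busy Q s) \<le>
      measure lborel (busy ?QL sL \<union> busy ?QR sR \<union> {real_of_int ?a..<?b})"
    using fin by (intro measure_mono_fmeasurable fmeasurable.Un fmeasurable_busy fmeasurable_ico
        fmeasurableD[OF fmeasurable_busy]) auto
  also have "\<dots> \<le> measure lborel (busy ?QL sL \<union> busy ?QR sR) + measure lborel {real_of_int ?a..<?b}"
    using fin by (intro measure_Un_le sets.Un fmeasurableD[OF fmeasurable_busy]) auto
  also have "\<dots> \<le> measure lborel (busy ?QL sL) + measure lborel (busy ?QR sR) + measure lborel {real_of_int ?a..<?b}"
    using fin by (intro add_right_mono measure_Un_le fmeasurableD[OF fmeasurable_busy]) auto
  also have "measure lborel {real_of_int ?a..<?b} = ?b - ?a"
    using pJ p_nonneg[of J] Q J by auto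
  also have "measure lborel (busy ?QL sL) + measure lborel (busy ?QR sR) + real_of_int (?b - ?a) \<le> f"
    using SL SR eq unfolding solution_def by auto
  finally show "measure lborel (busy Q s) \<le> f" .
  fix I assume cov: "covers I Q"
  obtain i k IL IR where *: "i < n" "k < n"
    "covers IL {j \<in> Q. l j < a i}" "covers IR {j \<in> Q. b i k < e j}"
    "b i k - a i + total_length IL + total_length IR \<le> total_length I"
    using lower_bound_split[OF Q J longest cov, folded a_def, folded b_def] by blast
  obtain fL sL fR sR where "solution {j \<in> Q. l j < a i} fL sL" "solution {j \<in> Q. b i k < e j} fR sR"
    and f: "f \<le> b i k - a i + fL + fR" using le[OF *(1,2)] by blast
  then have "fL \<le> total_length IL" "fR \<le> total_length IR" using *(3,4) unfolding solution_def by auto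
  moreover have "real_of_int f \<le> b i k - a i + fL + fR" using f by linarith
  ultimately show "f \<le> total_length I" using *(5) by linarith
qed

end

section \<open>Difference constraints of preemptive jobs\<close>

definition satisfies :: "('v \<times> 'v \<times> int) set \<Rightarrow> ('v \<Rightarrow> real) \<Rightarrow> bool" where
  "satisfies E Y \<longleftrightarrow> (\<forall>(s, t, w)\<in>E. Y s + w \<le> Y t)"

text \<open>
  Let \<open>Z\<close> be the least nonnegative solution. As long as \<open>X k\<close> and \<open>Z\<close> differ somewhere, some
  constraint from a vertex where they agree to one where they differ is tight for \<open>Z\<close>, as otherwise
  \<open>Z\<close> could be lowered uniformly where they differ. So each round settles one more vertex.
\<close>

lemma relaxation_converges:
  fixes X :: "nat \<Rightarrow> 'v \<Rightarrow> int"
  assumes V: "finite V" and E: "E \<subseteq> V \<times> V \<times> UNIV" "finite E"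
    and Y0: "satisfies E Y0" "\<And>v. v \<in> V \<Longrightarrow> 0 \<le> Y0 v"
    and below: "\<And>(Y :: 'v \<Rightarrow> real) k v. satisfies E Y \<Longrightarrow> (\<And>v. v \<in> V \<Longrightarrow> 0 \<le> Y v) \<Longrightarrow> v \<in> V \<Longrightarrow> X k v \<le> Y v"
    and nonneg: "\<And>k v. v \<in> V \<Longrightarrow> 0 \<le> X k v"
    and mono: "\<And>k v. v \<in> V \<Longrightarrow> X k v \<le> X (Suc k) v"
    and step: "\<And>k s t w. (s, t, w) \<in> E \<Longrightarrow> X k s + w \<le> X (Suc k) t"
    and k: "card V \<le> k"
  shows "satisfies E (\<lambda>v. X k v)"
proof -
  define S where "S = {Y. satisfies E Y \<and> (\<forall>v\<in>V. 0 \<le> Y v)}"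
  define Z where "Z v = (INF Y\<in>S. Y v)" for v
  have S0: "S \<noteq> {}" using Y0 unfolding S_def by blast
  have bdd: "bdd_below ((\<lambda>Y. Y v) ` S)" if "v \<in> V" for v
    using that unfolding S_def by (intro bdd_belowI2[of _ 0]) auto
  have Z_le: "Z v \<le> Y v" if "Y \<in> S" "v \<in> V" for Y v
    unfolding Z_def by (rule cINF_lower[OF bdd]) (use that in auto)
  have Z_ge: "c \<le> Z v" if "\<And>Y. Y \<in> S \<Longrightarrow> c \<le> Y v" for v c
    unfolding Z_def by (rule cINF_greatest[OF S0]) (use that in auto)
  have XZ: "X k v \<le> Z v" if "v \<in> V" for k v
    by (rule Z_ge) (use below that in \<open>auto simp: S_def\<close>)
  have Z0: "0 \<le> Z v" if "v \<in> V" for v using XZ[OF that, of 0] nonneg[OF that, of 0] by linarith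
  have satZ: "satisfies E Z"
    unfolding satisfies_def
  proof clarify
    fix s t w assume st: "(s, t, w) \<in> E"
    have "Z s + w \<le> Y t" if "Y \<in> S" for Y
    proof -
      have "Y s + w \<le> Y t" using st that unfolding S_def satisfies_def by auto
      then show ?thesis using Z_le[OF that, of s] st E(1) by auto
    qed
    then show "Z s + w \<le> Z t" by (rule Z_ge)
  qed
  define F where "F k = {v \<in> V. X k v = Z v}" for k
  have tight: "\<exists>s t w. (s, t, w) \<in> E \<and> s \<in> F k \<and> t \<in> V - F k \<and> Z t = Z s + w" if ne: "F k \<noteq> V" for k
  proof (rule ccontr)
    assume none: "\<not> ?thesis"
    define D where "D = V - F k"
    define C where "C = {(s, t, w) \<in> E. s \<in> F k \<and> t \<in> D}"
    \<comment> \<open>These are the amounts by which \<open>Z\<close> may be lowered on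
      \<open>D\<close>: its values there, by nonnegativity, and the slack of constraints entering
      \<open>D\<close> from outside. Constraints inside \<open>D\<close> or leaving it stay valid
      anyway.\<close>
    define A where "A = Z ` D \<union> (\<lambda>(s, t, w). Z t - Z s - w) ` C"
    have "finite C" by (rule finite_subset[OF _ E(2)]) (auto simp: C_def)
    then have fin: "finite A" using V by (auto simp: A_def D_def)
    have "D \<noteq> {}" using ne by (auto simp: D_def F_def)
    then have A0: "A \<noteq> {}" by (simp add: A_def)
    have pos: "0 < x" if x: "x \<in> A" for x
    proof -
      consider v where "v \<in> D" "x = Z v" | s t w where "(s, t, w) \<in> C" "x = Z t - Z s - w"
        using x by (auto simp: A_def)
      then show ?thesis
      proof cases
        case 1
        then have "X k v \<le> Z v" "X k v \<noteq> Z v" "0 \<le> X k v" using XZ nonneg by (auto simp: D_def F_def)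
        then show ?thesis using 1 by linarith
      next
        case 2
        then have "Z s + w \<le> Z t" "Z t \<noteq> Z s + w" using satZ none
          unfolding satisfies_def C_def D_def by auto
        then show ?thesis using 2 by linarith
      qed
    qed
    define c where "c = Min A"
    have c: "0 < c" "\<And>x. x \<in> A \<Longrightarrow> c \<le> x" using pos[OF Min_in[OF fin A0]] fin by (auto simp: c_def)
    define Z' where "Z' v = (if v \<in> D then Z v - c else Z v)" for v
    have "satisfies E Z'"
      unfolding satisfies_def
    proof clarify
      fix s t w assume st: "(s, t, w) \<in> E"
      then have le: "Z s + w \<le> Z t" using satZ unfolding satisfies_def by auto
      show "Z' s + w \<le> Z' t"
      proof (cases "t \<in> D \<and> s \<notin> D")
        case True
        then have "(s, t, w) \<in> C" using st E(1) by (auto simp: C_def D_def)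
        then have "Z t - Z s - w \<in> A" by (force simp: A_def)
        then have "c \<le> Z t - Z s - w" by (rule c)
        then show ?thesis using True by (simp add: Z'_def)
      next
        case False
        then show ?thesis using le c(1) by (auto simp: Z'_def)
      qed
    qed
    moreover have "0 \<le> Z' v" if "v \<in> V" for v
      using Z0[OF that] c(2)[of "Z v"] by (auto simp: Z'_def A_def)
    ultimately have "Z' \<in> S" by (auto simp: S_def)
    obtain v where v: "v \<in> D" using \<open>D \<noteq> {}\<close> by blast
    then have "Z v \<le> Z' v" using Z_le[OF \<open>Z' \<in> S\<close>] by (auto simp: D_def)
    then show False using c(1) v by (simp add: Z'_def)
  qed
  have F_mono: "F k \<subseteq> F (Suc k)" for k
    using mono XZ unfolding F_def by (smt (verit) Collect_mono_iff of_int_le_iff)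
  have "F k = V \<or> k \<le> card (F k)" for k
  proof (induction k)
    case (Suc k)
    show ?case
    proof (cases "F k = V")
      case True
      then show ?thesis using F_mono[of k] by (auto simp: F_def)
    next
      case False
      then obtain s t w where st: "(s, t, w) \<in> E" "s \<in> F k" "t \<in> V - F k" "Z t = Z s + w"
        using tight by blast
      have "real_of_int (X k s + w) \<le> X (Suc k) t" by (simp only: of_int_le_iff step[OF st(1)])
      then have "X (Suc k) t = Z t" using st XZ[of t "Suc k"] by (auto simp: F_def)
      then have "insert t (F k) \<subseteq> F (Suc k)" using st F_mono[of k] by (auto simp: F_def)
      moreover have "finite (F (Suc k))" using V by (auto simp: F_def)
      ultimately have "card (insert t (F k)) \<le> card (F (Suc k))" by (intro card_mono)
      moreover have "card (insert t (F k)) = Suc (card (F k))" using st V by (auto simp: F_def)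
      ultimately show ?thesis using Suc False by linarith
    qed
  qed simp
  moreover have "F k \<subseteq> V" "card (F k) \<le> card V" using V by (auto simp: F_def intro: card_mono)
  ultimately have "F k = V" using k V by (metis card_subset_eq le_antisym le_trans)
  then have "X k v = Z v" if "v \<in> V" for v using that by (auto simp: F_def)
  then show ?thesis using satZ E(1) unfolding satisfies_def by fastforce
qed

section \<open>Difference constraints over time points and the schedules read off from their
  solutions\<close>

definition nxt :: "int set \<Rightarrow> int \<Rightarrow> int" where
  "nxt P s = Min {t \<in> P. s < t}"

lemma nxt:
  assumes "finite P" "d \<in> P" "s < d"
  shows "nxt P s \<in> P" "s < nxt P s" "nxt P s \<le> d"
proof -
  have "Min {t \<in> P. s < t} \<in> {t \<in> P. s < t}" using assms by (intro Min_in) auto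
  then show "nxt P s \<in> P" "s < nxt P s" by (auto simp: nxt_def)
  show "nxt P s \<le> d" unfolding nxt_def using assms by (intro Min_le) auto
qed

lemma nxt_le: "finite P \<Longrightarrow> t \<in> P \<Longrightarrow> s < t \<Longrightarrow> nxt P s \<le> t"
  unfolding nxt_def by auto

lemma telescope_nxt:
  fixes f :: "int \<Rightarrow> int"
  assumes P: "finite P" "d \<in> P" and "r \<in> P" "r \<le> d"
  shows "(\<Sum>s\<in>{s \<in> P. r \<le> s \<and> s < d}. f (nxt P s) - f s) = f d - f r"
  using assms(3,4)
proof (induction "nat (d - r)" arbitrary: r rule: less_induct)
  case less
  show ?case
  proof (cases "r = d")
    case False
    then have rd: "r < d" using less by simp
    note n = nxt[OF P rd]
    have "{s \<in> P. r \<le> s \<and> s < d} = insert r {s \<in> P. nxt P r \<le> s \<and> s < d}"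
      using less.prems rd n nxt_le[OF P(1)] by force
    moreover have "r \<notin> {s \<in> P. nxt P r \<le> s \<and> s < d}" using n by simp
    ultimately show ?thesis using less.hyps[of "nxt P r"] n rd P(1) by simp
  next
    case True
    then have "{s \<in> P. r \<le> s \<and> s < d} = {}" by auto
    then show ?thesis unfolding True by (simp only: sum.empty)
  qed
qed

text \<open>All ordered pairs of points are constrained, not just neighbours, so the program need
  not sort them. The second set says \<open>X t - X s \<le> t - s\<close>, written as an edge
  backwards in time.\<close>

definition constraints :: "int set \<Rightarrow> (int \<times> int \<times> int) set \<Rightarrow> (int \<times> int \<times> int) set" where
  "constraints P K = {(s, t, 0) | s t. s \<in> P \<and> t \<in> P \<and> s \<le> t} \<union>
     {(t, s, s - t) | s t. s \<in> P \<and> t \<in> P \<and> s \<le> t} \<union> K"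

lemma constraints_finite: "finite P \<Longrightarrow> finite K \<Longrightarrow> finite (constraints P K)"
proof -
  assume *: "finite P" "finite K"
  have "constraints P K \<subseteq> (\<lambda>(s, t). (s, t, 0)) ` (P \<times> P) \<union> (\<lambda>(s, t). (t, s, s - t)) ` (P \<times> P) \<union> K"
    unfolding constraints_def by force
  then show ?thesis by (rule finite_subset) (use * in auto)
qed

lemma satisfies_constraints:
  fixes X :: "int \<Rightarrow> int"
  assumes "satisfies (constraints P K) (\<lambda>v. X v)"
  shows "s \<in> P \<Longrightarrow> t \<in> P \<Longrightarrow> s \<le> t \<Longrightarrow> X s \<le> X t"
    and "s \<in> P \<Longrightarrow> t \<in> P \<Longrightarrow> s \<le> t \<Longrightarrow> X t - X s \<le> t - s"
    and "(s, t, w) \<in> K \<Longrightarrow> X s + w \<le> X t"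
proof -
  have *: "X s + w \<le> X t" if "(s, t, w) \<in> constraints P K" for s t w
  proof -
    have "real_of_int (X s) + real_of_int w \<le> real_of_int (X t)" using assms that unfolding satisfies_def by auto
    then show ?thesis by linarith
  qed
  show "s \<in> P \<Longrightarrow> t \<in> P \<Longrightarrow> s \<le> t \<Longrightarrow> X s \<le> X t" using *[of s t 0] by (auto simp: constraints_def)
  show "s \<in> P \<Longrightarrow> t \<in> P \<Longrightarrow> s \<le> t \<Longrightarrow> X t - X s \<le> t - s" using *[of t s "s - t"] by (auto simp: constraints_def)
  show "(s, t, w) \<in> K \<Longrightarrow> X s + w \<le> X t" using *[of s t w] by (auto simp: constraints_def)
qed

text \<open>The growth of \<open>X\<close> from \<open>s\<close> to the next point, cut off at the
  level \<open>c\<close>. For a job with release date \<open>r\<close> and length \<open>p\<close>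
  the level is \<open>c = X r + p\<close>, where the job is complete. At the last point
  \<open>nxt\<close> has no useful value; the pieces of a schedule all start before some later point
  of \<open>P\<close>.\<close>

definition piece :: "int set \<Rightarrow> (int \<Rightarrow> int) \<Rightarrow> int \<Rightarrow> int \<Rightarrow> int" where
  "piece P X c s = min (X (nxt P s)) c - min (X s) c"

locale solved =
  fixes P :: "int set" and K and X :: "int \<Rightarrow> int"
  assumes P: "finite P" and sat: "satisfies (constraints P K) (\<lambda>v. X v)"
begin

lemmas X_mono = satisfies_constraints(1)[OF sat]
lemmas X_cap = satisfies_constraints(2)[OF sat]
lemmas X_job = satisfies_constraints(3)[OF sat]

lemma piece_bounds:
  assumes "s \<in> P" "t \<in> P" "s < t"
  shows "0 \<le> piece P X c s" "s + piece P X c s \<le> t" "piece P X c s \<le> X (nxt P s) - X s"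
proof -
  note n = nxt[OF P assms(2,3)]
  have "X s \<le> X (nxt P s)" "X (nxt P s) - X s \<le> nxt P s - s"
    using X_mono[of s "nxt P s"] X_cap[of s "nxt P s"] n assms by auto
  then show "0 \<le> piece P X c s" "s + piece P X c s \<le> t" "piece P X c s \<le> X (nxt P s) - X s"
    using n(3) unfolding piece_def by linarith+
qed

text \<open>The lengths telescope to \<open>min (X d) c - min (X r) c\<close> for the window from
  \<open>r\<close> to \<open>d\<close>, where \<open>c = X r + p\<close>. The job constraint says
  \<open>c \<le> X d\<close>, so this is exactly \<open>p\<close>; the slope constraints keep each
  piece in front of the next point.\<close>

lemma pieces_feasible:
  assumes job: "(int (release e), int (deadline e), int (proc e)) \<in> K" and pre: "preemptive e"
    and pts: "int (release e) \<in> P" "int (deadline e) \<in> P" "release e \<le> deadline e"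
    and J: "J = (\<lambda>s. (real_of_int s, real_of_int (s + piece P X (X (release e) + proc e) s))) `
              {s \<in> P. int (release e) \<le> s \<and> s < int (deadline e)}"
  shows "feasible_job e J"
  unfolding feasible_job_def
proof (intro conjI)
  let ?A = "{s \<in> P. int (release e) \<le> s \<and> s < int (deadline e)}"
  let ?p = "piece P X (X (release e) + proc e)"
  have b: "0 \<le> ?p s" "s + ?p s \<le> int (deadline e)" if "s \<in> ?A" for s
    using piece_bounds[of s "int (deadline e)"] that pts by auto
  show "finite J" using P J by simp
  show "\<forall>(a, b)\<in>J. real (release e) \<le> a \<and> a \<le> b \<and> b \<le> real (deadline e)"
  proof -
    have "real (release e) \<le> real_of_int s \<and> real_of_int s \<le> real_of_int (s + ?p s) \<and>
        real_of_int (s + ?p s) \<le> real (deadline e)" if "s \<in> ?A" for s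
    proof -
      have "int (release e) \<le> s \<and> s \<le> s + ?p s \<and> s + ?p s \<le> int (deadline e)" using b[OF that] that by simp
      then show ?thesis by (metis of_int_of_nat_eq of_int_le_iff)
    qed
    then show ?thesis unfolding J by auto
  qed
  have dis: "{real_of_int s..<real_of_int (s + ?p s)} \<inter> {real_of_int t..<real_of_int (t + ?p t)} = {}"
    if "s \<in> ?A" "t \<in> ?A" "s < t" for s t
  proof -
    have "s + ?p s \<le> t" using piece_bounds[of s t] that by auto
    then have "real_of_int (s + ?p s) \<le> t" by linarith
    then show ?thesis by auto
  qed
  show "\<forall>(a, b)\<in>J. \<forall>(c, d)\<in>J. (a, b) \<noteq> (c, d) \<longrightarrow> {a..<b} \<inter> {c..<d} = {}"
  proof -
    have "{real_of_int s..<real_of_int (s + ?p s)} \<inter> {real_of_int t..<real_of_int (t + ?p t)} = {}"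
      if "s \<in> ?A" "t \<in> ?A" "s \<noteq> t" for s t
      using dis[OF that(1,2)] dis[OF that(2,1)] that(3) by (metis inf_commute linorder_neqE)
    then show ?thesis unfolding J by fast
  qed
  have "(\<Sum>(a, b)\<in>J. b - a) = (\<Sum>s\<in>?A. real_of_int (?p s))"
  proof -
    have "inj_on (\<lambda>s. (real_of_int s, real_of_int (s + ?p s))) ?A" by (rule inj_onI) simp
    from sum.reindex[OF this, of "\<lambda>(a, b). b - a"] show ?thesis unfolding J by (simp only: o_def case_prod_conv of_int_add add_diff_cancel_left')
  qed
  also have "\<dots> = real_of_int (\<Sum>s\<in>?A. ?p s)" by simp
  also have "(\<Sum>s\<in>?A. ?p s) = min (X (deadline e)) (X (release e) + proc e) - min (X (release e)) (X (release e) + proc e)"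
    unfolding piece_def using pts
    by (intro telescope_nxt[OF P, where f = "\<lambda>x. min (X x) (X (release e) + proc e)"]) auto
  also have "\<dots> = proc e" using X_job[OF job] by simp
  finally show "(\<Sum>(a, b)\<in>J. b - a) = real (proc e)" by simp
qed (use pre in simp)

text \<open>In each gap the pieces of all jobs start at the same point \<open>s\<close> and are no
  longer than the growth of \<open>X\<close>; being nested, they together cost no more than this
  growth, however many jobs share the gap.\<close>

definition busy_points :: "real set" where
  "busy_points = (\<Union>s\<in>{s \<in> P. \<exists>t\<in>P. s < t}. {real_of_int s..<real_of_int (s + (X (nxt P s) - X s))})"

lemma piece_subset:
  assumes "s \<in> P" "t \<in> P" "s < t"
  shows "{real_of_int s..<real_of_int (s + piece P X c s)} \<subseteq> busy_points"
proof -
  have "real_of_int (s + piece P X c s) \<le> real_of_int (s + (X (nxt P s) - X s))"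
    using piece_bounds(3)[OF assms] by (simp flip: of_int_add of_int_diff)
  then show ?thesis using assms unfolding busy_points_def by fastforce
qed

lemma fmeasurable_busy_points: "busy_points \<in> fmeasurable lborel"
  unfolding busy_points_def using P by (auto intro!: fmeasurable.finite_UN fmeasurable_ico)

lemma measure_busy_points:
  assumes "m \<in> P" "\<And>s. s \<in> P \<Longrightarrow> s \<le> m" "\<And>s. s \<in> P \<Longrightarrow> 0 \<le> X s"
  shows "measure lborel busy_points \<le> X m"
proof -
  let ?A = "{s \<in> P. \<exists>t\<in>P. s < t}"
  have minP: "Min P \<in> P" using assms(1) P by (intro Min_in) auto
  have "measure lborel busy_points \<le>
      (\<Sum>s\<in>?A. measure lborel {real_of_int s..<real_of_int (s + (X (nxt P s) - X s))})"
    unfolding busy_points_def using P by (intro measure_UNION_le) auto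
  also have "\<dots> = (\<Sum>s\<in>?A. real_of_int (X (nxt P s) - X s))"
  proof (rule sum.cong)
    fix s assume "s \<in> ?A"
    then obtain t where t: "s \<in> P" "t \<in> P" "s < t" by blast
    have "0 \<le> X (nxt P s) - X s" using piece_bounds[OF t, of 0] by linarith
    then show "measure lborel {real_of_int s..<real_of_int (s + (X (nxt P s) - X s))} = real_of_int (X (nxt P s) - X s)"
      by (simp flip: of_int_add of_int_diff)
  qed simp
  also have "\<dots> = real_of_int (\<Sum>s\<in>?A. X (nxt P s) - X s)" by simp
  also have "?A = {s \<in> P. Min P \<le> s \<and> s < m}" using assms P by force
  also have "(\<Sum>s\<in>{s \<in> P. Min P \<le> s \<and> s < m}. X (nxt P s) - X s) = X m - X (Min P)"
    using assms P minP by (intro telescope_nxt[where f = X]) auto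
  also have "real_of_int (X m - X (Min P)) \<le> X m"
 using assms(3) minP by simp
  finally show ?thesis .
qed

end

text \<open>Measuring \<open>U\<close> up to time \<open>t\<close> turns a busy set into a solution:
  the function grows with slope between 0 and 1 and by at least \<open>w\<close> on each window. Its
  values are real, which is why \<open>satisfies\<close> speaks of real functions and minimality
  must be proved against real solutions.\<close>

lemma satisfies_measure:
  fixes U :: "real set"
  assumes U: "U \<in> sets borel" and P: "\<And>t. t \<in> P \<Longrightarrow> 0 \<le> t"
    and K: "\<And>s t w. (s, t, w) \<in> K \<Longrightarrow> s \<in> P \<and> t \<in> P \<and> s \<le> t \<and> w \<le> measure lborel (U \<inter> {s..<t})"
  shows "satisfies (constraints P K) (\<lambda>t. measure lborel (U \<inter> {0..<real_of_int t}))"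
proof -
  let ?Y = "\<lambda>t. measure lborel (U \<inter> {0..<real_of_int t})"
  have fm: "U \<inter> {a..<b} \<in> fmeasurable lborel" for a b
    using U by (intro fmeasurable_Int_fmeasurable[OF fmeasurable_ico, simplified Int_commute]) auto
  have fin: "emeasure lborel (U \<inter> {a..<b}) \<noteq> \<infinity>" for a b
    using fmeasurableD2[OF fm] by simp
  have diff: "?Y t = ?Y s + measure lborel (U \<inter> {real_of_int s..<t})" if "0 \<le> s" "s \<le> t" for s t
  proof -
    have "U \<inter> {0..<real_of_int t} = (U \<inter> {0..<real_of_int s}) \<union> (U \<inter> {real_of_int s..<t})"
      using that by auto
    moreover have "(U \<inter> {0..<real_of_int s}) \<inter> (U \<inter> {real_of_int s..<t}) = {}" by auto
    ultimately show ?thesis by (simp add: measure_Union[OF fin fin fm[THEN fmeasurableD] fm[THEN fmeasurableD]])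
  qed
  have cap: "measure lborel (U \<inter> {real_of_int s..<t}) \<le> t - s" if "s \<le> t" for s t :: int
  proof -
    have "measure lborel (U \<inter> {real_of_int s..<t}) \<le> measure lborel {real_of_int s..<t}"
      by (intro measure_mono_fmeasurable fmeasurableD[OF fm] fmeasurable_ico) auto
    then show ?thesis using that by simp
  qed
  show ?thesis
    unfolding satisfies_def
  proof clarify
    fix s t w assume "(s, t, w) \<in> constraints P K"
    then consider "s \<in> P" "t \<in> P" "s \<le> t" "w = 0" | "s \<in> P" "t \<in> P" "t \<le> s" "w = t - s" | "(s, t, w) \<in> K"
      unfolding constraints_def by auto
    then show "?Y s + real_of_int w \<le> ?Y t"
    proof cases
      case 1 then show ?thesis using diff[of s t] P by simp
    next
      case 2 then show ?thesis using diff[of t s] cap[of t s] P by simp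
    next
      case 3 then show ?thesis using diff[of s t] P K[of s t w] by auto
    qed
  qed
qed

section \<open>Maintenance on a path\<close>

text \<open>The unordered vertex pairs along a simple path are distinct, so each step of the path is
  realized by exactly one edge of the list and no other edge can replace a maintained one.\<close>

lemma disconnected_iff_maintained:
  assumes "path_network G"
  shows "disconnected G S t \<longleftrightarrow> (\<exists>i<length (edges G). maintained S i t)"
proof -
  obtain vs where vs: "vs \<noteq> []" "distinct vs" "hd vs = source G" "last vs = sink G"
    and m: "mset (map ends (edges G)) = mset (map2 (\<lambda>u v. {u, v}) vs (tl vs))"
    using assms unfolding path_network_def by blast
  define ps where "ps = map2 (\<lambda>u v. {u, v}) vs (tl vs)"
  define N where "N = length vs - 1"
  have lps: "length ps = N" by (simp add: ps_def N_def)
  have lvs: "length vs = Suc N" using vs(1) by (simp add: N_def)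
  have ps: "ps ! j = {vs ! j, vs ! Suc j}" if "j < N" for j
    using that lvs by (simp add: ps_def nth_tl)
  have eqv: "vs ! i = vs ! j \<longleftrightarrow> i = j" if "i \<le> N" "j \<le> N" for i j
    using that lvs vs(2) by (simp add: nth_eq_iff_index_eq)
  have "distinct ps"
    unfolding distinct_conv_nth lps
  proof (intro allI impI)
    fix i j assume ij: "i < N" "j < N" "i \<noteq> j"
    have "\<not> (vs ! i = vs ! j \<and> vs ! Suc i = vs ! Suc j)" "\<not> (vs ! i = vs ! Suc j \<and> vs ! Suc i = vs ! j)"
      using eqv[of i j] eqv[of i "Suc j"] eqv[of "Suc i" j] ij by auto
    then show "ps ! i \<noteq> ps ! j" unfolding ps[OF ij(1)] ps[OF ij(2)] doubleton_eq_iff by blast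
  qed
  then have dist: "distinct (map ends (edges G))"
    using mset_eq_imp_distinct_iff[OF m] by (simp add: ps_def)
  have sets: "ends ` set (edges G) = set ps"
    using mset_eq_setD[OF m] by (simp add: ps_def)
  have edge: "\<exists>j<N. ends (edges G ! i) = {vs ! j, vs ! Suc j}" if "i < length (edges G)" for i
  proof -
    have "ends (edges G ! i) \<in> set ps" using that sets by (metis imageI nth_mem)
    then obtain j where "j < N" "ps ! j = ends (edges G ! i)" by (auto simp: in_set_conv_nth lps)
    then show ?thesis using ps by auto
  qed
  have s: "source G = vs ! 0" and e: "sink G = vs ! N"
    using vs lvs by (auto simp: hd_conv_nth last_conv_nth)
  show ?thesis
  proof
    assume "disconnected G S t"
    show "\<exists>i<length (edges G). maintained S i t"
    proof (rule ccontr)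
      assume none: "\<not> ?thesis"
      have "(source G, vs ! j) \<in> (available_adj G S t)\<^sup>*" if "j \<le> N" for j
        using that
      proof (induction j)
        case (Suc j)
        have "{vs ! j, vs ! Suc j} \<in> set ps" using ps[of j] Suc.prems lps by (metis Suc_le_eq nth_mem)
        then obtain i where "i < length (edges G)" "ends (edges G ! i) = {vs ! j, vs ! Suc j}"
          using sets by (metis imageE in_set_conv_nth)
        then have "(vs ! j, vs ! Suc j) \<in> available_adj G S t" using none unfolding available_adj_def by blast
        then show ?case using Suc by (auto intro: rtrancl_into_rtrancl)
      qed (simp add: s)
      then show False using \<open>disconnected G S t\<close> e unfolding disconnected_def by auto
    qed
  next
    assume "\<exists>i<length (edges G). maintained S i t"
    then obtain i where i: "i < length (edges G)" "maintained S i t" by blast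
    obtain k where k: "k < N" "ends (edges G ! i) = {vs ! k, vs ! Suc k}" using edge[OF i(1)] by blast
    \<comment> \<open>Without edge \<open>i\<close>, which is step \<open>k\<close> of the path, the
      search cannot pass \<open>vs ! k\<close>: every available edge belongs to a step other than
      \<open>k\<close>.\<close>
    have "\<exists>j\<le>k. x = vs ! j" if "(source G, x) \<in> (available_adj G S t)\<^sup>*" for x
      using that
    proof (induction rule: rtrancl_induct)
      case (step u v)
      then obtain j where j: "j \<le> k" "u = vs ! j" by blast
      obtain i' where i': "i' < length (edges G)" "ends (edges G ! i') = {u, v}" "\<not> maintained S i' t"
        using step(2) unfolding available_adj_def by blast
      then obtain j' where j': "j' < N" "{u, v} = {vs ! j', vs ! Suc j'}" using edge[OF i'(1)] by auto
      have "i' \<noteq> i" using i i' by auto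
      then have "ends (edges G ! i') \<noteq> ends (edges G ! i)"
        using nth_eq_iff_index_eq[OF dist, of i' i] i(1) i'(1) by simp
      then have "j' \<noteq> k" using k i' j' by auto
      from j'(2) consider "u = vs ! j'" "v = vs ! Suc j'" | "u = vs ! Suc j'" "v = vs ! j'"
        by (auto simp: doubleton_eq_iff)
      then show ?case
      proof cases
        case 1
        have "vs ! j' = vs ! j" using 1(1) j(2) by simp
        then have "j' = j" using eqv[of j' j] j(1) j'(1) k(1) by simp
        then show ?thesis using 1(2) j(1) \<open>j' \<noteq> k\<close> by (intro exI[of _ "Suc j'"]) simp
      next
        case 2
        have "vs ! Suc j' = vs ! j" using 2(1) j(2) by simp
        then have "Suc j' = j" using eqv[of "Suc j'" j] j(1) j'(1) k(1) by simp
        then show ?thesis using 2(2) j(1) by (intro exI[of _ j']) simp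
      qed
    qed (auto simp: s)
    moreover have "vs ! N \<noteq> vs ! j" if "j \<le> k" for j using eqv[of N j] k(1) that by simp
    ultimately show "disconnected G S t" unfolding disconnected_def e by blast
  qed
qed

definition busy_times :: "network \<Rightarrow> schedule \<Rightarrow> real set" where
  "busy_times G S = (\<Union>i<length (edges G). \<Union>(a, b)\<in>S i. {a..<b})"

lemma disconnected_time_eq:
  assumes "path_network G" "feasible G S"
  shows "disconnected_time G S = measure lborel (busy_times G S)"
proof -
  have "{t \<in> {0..real (horizon G)}. disconnected G S t} = busy_times G S"
  proof (intro set_eqI iffI)
    fix t assume t: "t \<in> busy_times G S"
    then obtain i a b where i: "i < length (edges G)" "(a, b) \<in> S i" "a \<le> t" "t < b"
      unfolding busy_times_def by auto
    then have "\<forall>(a, b)\<in>S i. real (release (edges G ! i)) \<le> a \<and> a \<le> b \<and> b \<le> real (deadline (edges G ! i))"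
      using assms(2) unfolding feasible_def feasible_job_def by simp
    then have "real (release (edges G ! i)) \<le> a \<and> b \<le> real (deadline (edges G ! i))"
      using i(2) by auto
    moreover have "deadline (edges G ! i) \<le> horizon G" unfolding horizon_def using i(1) by (intro Max_ge) auto
    ultimately have "0 \<le> t" "t \<le> real (horizon G)" using i(3,4) by linarith+
    moreover have "disconnected G S t"
      unfolding disconnected_iff_maintained[OF assms(1)] maintained_def using i
      by (intro exI[of _ i] conjI bexI[of _ "(a, b)"]) auto
    ultimately show "t \<in> {t \<in> {0..real (horizon G)}. disconnected G S t}" by simp
  next
    fix t assume "t \<in> {t \<in> {0..real (horizon G)}. disconnected G S t}"
    then obtain i where i: "i < length (edges G)" "maintained S i t"
      using disconnected_iff_maintained[OF assms(1)] by auto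
    then obtain a b where "(a, b) \<in> S i" "t \<in> {a..<b}" unfolding maintained_def by auto
    then show "t \<in> busy_times G S" using i(1) unfolding busy_times_def by blast
  qed
  then show ?thesis by (simp add: disconnected_time_def)
qed

text \<open>Preemptive edges take part in the non-preemptive problem as empty jobs.\<close>

definition nonpre :: "network \<Rightarrow> (edge \<Rightarrow> nat) \<Rightarrow> nat \<Rightarrow> int" where
  "nonpre G f j = (if preemptive (edges G ! j) then 0 else int (f (edges G ! j)))"

definition points :: "network \<Rightarrow> int set" where
  "points G = (\<lambda>j. int (release (edges G ! j))) ` {..<length (edges G)} \<union>
     (\<lambda>j. int (deadline (edges G ! j))) ` {..<length (edges G)}"

text \<open>Empty jobs are left out: a preemptive job of length 0 is feasible even if its deadline
  precedes its release date, and its constraint would then wrongly forbid growth of \<open>X\<close>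
  between the two.\<close>

definition pre_jobs :: "network \<Rightarrow> (int \<times> int \<times> int) set" where
  "pre_jobs G = (\<lambda>j. (int (release (edges G ! j)), int (deadline (edges G ! j)), int (proc (edges G ! j)))) `
     {j. j < length (edges G) \<and> preemptive (edges G ! j) \<and> 0 < proc (edges G ! j)}"

lemma finite_points: "finite (points G)"
  by (simp add: points_def)

lemma feasible_job_single:
  assumes "feasible_job e J" "\<not> preemptive e"
  obtains a where "J = {(a, a + real (proc e))}" "real (release e) \<le> a" "a + real (proc e) \<le> real (deadline e)"
proof -
  have "card J = 1" using assms unfolding feasible_job_def by simp
  then obtain x where "J = {x}" by (rule card_1_singletonE)
  then obtain a b where J: "J = {(a, b)}" by (cases x) auto
  then have "b = a + real (proc e)" "real (release e) \<le> a" "b \<le> real (deadline e)"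
    using assms(1) unfolding feasible_job_def by auto
  then show ?thesis using that[of a] J by simp
qed

lemma fmeasurable_busy_times:
  assumes "feasible G S" shows "busy_times G S \<in> fmeasurable lborel"
proof -
  have "finite (S i)" if "i < length (edges G)" for i
    using assms that unfolding feasible_def feasible_job_def by simp
  then show ?thesis unfolding busy_times_def
    by (intro fmeasurable.finite_UN) (auto intro!: fmeasurable_ico split: prod.splits)
qed

lemma feasible_jobs:
  assumes "feasible G S"
  shows "jobs (length (edges G)) (nonpre G release) (nonpre G proc) (nonpre G deadline)"
proof
  fix j assume j: "j < length (edges G)"
  show "0 \<le> nonpre G proc j" by (simp add: nonpre_def)
  show "nonpre G release j + nonpre G proc j \<le> nonpre G deadline j"
  proof (cases "preemptive (edges G ! j)")
    case False
    have "feasible_job (edges G ! j) (S j)" using assms j by (simp add: feasible_def)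
    from feasible_job_single[OF this False]
    have "real (release (edges G ! j)) + real (proc (edges G ! j)) \<le> real (deadline (edges G ! j))" by fastforce
    then show ?thesis using False by (simp add: nonpre_def)
  qed (simp add: nonpre_def)
qed

text \<open>The non-preemptive runs of \<open>S\<close> form a schedule of the restricted problem,
  with preemptive edges as empty runs at time 0. Their union lies inside the busy times of
  \<open>S\<close>, and the cover derived from them is at least \<open>f\<close> long.\<close>

lemma nonpreemptive_lower_bound:
  assumes feas: "feasible G S"
    and sol: "jobs.solution (nonpre G release) (nonpre G proc) (nonpre G deadline) {..<length (edges G)} f s"
  shows "real_of_int f \<le> measure lborel (busy_times G S)"
proof -
  interpret jobs "length (edges G)" "nonpre G release" "nonpre G proc" "nonpre G deadline"
    by (rule feasible_jobs[OF feas])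
  have "\<exists>a. (\<not> preemptive (edges G ! j) \<longrightarrow> S j = {(a, a + real (proc (edges G ! j)))} \<and>
      real (release (edges G ! j)) \<le> a \<and> a + real (proc (edges G ! j)) \<le> real (deadline (edges G ! j))) \<and>
      (preemptive (edges G ! j) \<longrightarrow> a = 0)" if "j < length (edges G)" for j
  proof (cases "preemptive (edges G ! j)")
    case False
    have "feasible_job (edges G ! j) (S j)" using feas that by (simp add: feasible_def)
    from feasible_job_single[OF this False] show ?thesis using False by metis
  qed auto
  then obtain a where a: "\<And>j. j < length (edges G) \<Longrightarrow> \<not> preemptive (edges G ! j) \<Longrightarrow>
      S j = {(a j, a j + real (proc (edges G ! j)))} \<and>
      real (release (edges G ! j)) \<le> a j \<and> a j + real (proc (edges G ! j)) \<le> real (deadline (edges G ! j))"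
    "\<And>j. j < length (edges G) \<Longrightarrow> preemptive (edges G ! j) \<Longrightarrow> a j = 0" by metis
  have "real_of_int (nonpre G release j) \<le> a j \<and> a j \<le> real_of_int (l j)" if "j \<in> {..<length (edges G)}" for j
    using a[of j] that by (auto simp: nonpre_def l_def)
  then obtain I where I: "covers I {..<length (edges G)}" "total_length I \<le> measure lborel (busy {..<length (edges G)} a)"
    using schedule_covers[of "{..<length (edges G)}" a] by auto
  have "busy {..<length (edges G)} a \<subseteq> busy_times G S"
  proof
    fix t assume "t \<in> busy {..<length (edges G)} a"
    then obtain j where j: "j < length (edges G)" "t \<in> {a j..<a j + real_of_int (nonpre G proc j)}"
      by (auto simp: busy_def)
    then have np: "\<not> preemptive (edges G ! j)" by (auto simp: nonpre_def)
    then have "S j = {(a j, a j + real (proc (edges G ! j)))}" using a(1) j by blast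
    then show "t \<in> busy_times G S" using j np
      unfolding busy_times_def by (auto simp: nonpre_def intro!: bexI[of _ j])
  qed
  then have "measure lborel (busy {..<length (edges G)} a) \<le> measure lborel (busy_times G S)"
    by (intro measure_mono_fmeasurable fmeasurableD[OF fmeasurable_busy] fmeasurable_busy_times[OF feas]) auto
  then show ?thesis using I sol unfolding solution_def by fastforce
qed

text \<open>The disjoint intervals of a preemptive job lie in its window and in the busy set, so the
  busy set has measure at least the processing time there. Positive length also guarantees an
  interval, and with it the order of release date and deadline.\<close>

lemma preemptive_constraints:
  assumes feas: "feasible G S"
  shows "satisfies (constraints (points G) (pre_jobs G))
     (\<lambda>t. measure lborel (busy_times G S \<inter> {0..<real_of_int t}))"
proof (rule satisfies_measure)
  let ?U = "busy_times G S"
  show U: "?U \<in> sets borel" using fmeasurableD[OF fmeasurable_busy_times[OF feas]] by simp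
  fix s t w assume "(s, t, w) \<in> pre_jobs G"
  then obtain j where j: "j < length (edges G)" "preemptive (edges G ! j)" "0 < proc (edges G ! j)"
    and stw: "s = int (release (edges G ! j))" "t = int (deadline (edges G ! j))" "w = int (proc (edges G ! j))"
    unfolding pre_jobs_def by auto
  have J: "finite (S j)" "\<forall>(a, b)\<in>S j. real (release (edges G ! j)) \<le> a \<and> a \<le> b \<and> b \<le> real (deadline (edges G ! j))"
    "\<forall>(a, b)\<in>S j. \<forall>(c, d)\<in>S j. (a, b) \<noteq> (c, d) \<longrightarrow> {a..<b} \<inter> {c..<d} = {}"
    "total_length (S j) = real (proc (edges G ! j))"
    using feas j(1) unfolding feasible_def feasible_job_def total_length_def by auto
  have "S j \<noteq> {}" using J(4) j(3) by (auto simp: total_length_def)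
  then obtain a b where "(a, b) \<in> S j" by auto
  then have "real (release (edges G ! j)) \<le> real (deadline (edges G ! j))" using J(2) by fastforce
  then have "s \<le> t" using stw by simp
  moreover have "s \<in> points G" "t \<in> points G" using j stw by (auto simp: points_def)
  moreover have "real_of_int w \<le> measure lborel (?U \<inter> {real_of_int s..<real_of_int t})"
  proof -
    have m: "measure lborel (\<Union>(a, b)\<in>S j. {a..<b}) = total_length (S j)"
      by (rule measure_disjoint_intervals[OF J(1)]) (use J(2,3) in fast)+
    have sub: "{a..<b} \<subseteq> ?U \<inter> {real_of_int s..<real_of_int t}" if "(a, b) \<in> S j" for a b
    proof
      fix x assume x: "x \<in> {a..<b}"
      have "real (release (edges G ! j)) \<le> a \<and> b \<le> real (deadline (edges G ! j))" using J(2) that by auto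
      moreover have "x \<in> ?U" unfolding busy_times_def
        by (rule UN_I[of j], use j in simp, rule UN_I[OF that]) (use x in simp)
      ultimately show "x \<in> ?U \<inter> {real_of_int s..<real_of_int t}" using x stw by simp
    qed
    have "measure lborel (\<Union>(a, b)\<in>S j. {a..<b}) \<le> measure lborel (?U \<inter> {real_of_int s..<real_of_int t})"
    proof (rule measure_mono_fmeasurable)
      show "(\<Union>(a, b)\<in>S j. {a..<b}) \<subseteq> ?U \<inter> {real_of_int s..<real_of_int t}"
      proof (rule UN_least)
        fix x assume "x \<in> S j"
        then show "(case x of (a, b) \<Rightarrow> {a..<b}) \<subseteq> ?U \<inter> {real_of_int s..<real_of_int t}"
          using sub[of "fst x" "snd x"] by (simp only: prod.collapse prod.case_eq_if)
      qed
      show "(\<Union>(a, b)\<in>S j. {a..<b}) \<in> sets lborel"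
        using J(1) by (intro sets.finite_UN) (auto split: prod.splits)
      show "?U \<inter> {real_of_int s..<real_of_int t} \<in> fmeasurable lborel"
        by (intro fmeasurable_Int_fmeasurable fmeasurable_busy_times[OF feas]) simp
    qed
    then show ?thesis using m J(4) stw by simp
  qed
  ultimately show "s \<in> points G \<and> t \<in> points G \<and> s \<le> t \<and> real_of_int w \<le> measure lborel (?U \<inter> {real_of_int s..<real_of_int t})"
    by blast
qed (auto simp: points_def)

text \<open>The approximation argument, independent of the program. The schedule costs at most
  \<open>f + X m\<close>, where \<open>m\<close> is the last time point; in any feasible schedule
  the busy set has measure at least \<open>f\<close> and, by minimality of \<open>X\<close>, at
  least \<open>X m\<close>.\<close>

lemma union_schedule:
  assumes path: "path_network G" and ex: "\<exists>S. feasible G S"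
    and sol: "jobs.solution (nonpre G release) (nonpre G proc) (nonpre G deadline) {..<length (edges G)} f s"
    and sat: "satisfies (constraints (points G) (pre_jobs G)) (\<lambda>v. X v)"
    and X0: "\<And>v. v \<in> points G \<Longrightarrow> 0 \<le> X v"
    and X_least: "\<And>(Y :: int \<Rightarrow> real) v. satisfies (constraints (points G) (pre_jobs G)) Y \<Longrightarrow>
      (\<And>v. v \<in> points G \<Longrightarrow> 0 \<le> Y v) \<Longrightarrow> v \<in> points G \<Longrightarrow> X v \<le> Y v"
    and S_np: "\<And>j. j < length (edges G) \<Longrightarrow> \<not> preemptive (edges G ! j) \<Longrightarrow>
      S j = {(real_of_int (s j), real_of_int (s j + int (proc (edges G ! j))))}"
    and S_p0: "\<And>j. j < length (edges G) \<Longrightarrow> preemptive (edges G ! j) \<Longrightarrow> proc (edges G ! j) = 0 \<Longrightarrow> S j = {}"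
    and S_p: "\<And>j. j < length (edges G) \<Longrightarrow> preemptive (edges G ! j) \<Longrightarrow> 0 < proc (edges G ! j) \<Longrightarrow>
      S j = (\<lambda>t. (real_of_int t, real_of_int (t + piece (points G) X
          (X (int (release (edges G ! j))) + int (proc (edges G ! j))) t))) `
         {t \<in> points G. int (release (edges G ! j)) \<le> t \<and> t < int (deadline (edges G ! j))}"
  shows "feasible G S \<and> disconnected_time G S \<le> 2 * min_connectivity_opt G"
proof
  obtain S0 where S0: "feasible G S0" using ex by blast
  interpret jobs "length (edges G)" "nonpre G release" "nonpre G proc" "nonpre G deadline"
    by (rule feasible_jobs[OF S0])
  interpret solved "points G" "pre_jobs G" X
    using finite_points sat by unfold_locales
  let ?n = "length (edges G)"
  have job: "(int (release (edges G ! j)), int (deadline (edges G ! j)), int (proc (edges G ! j))) \<in> pre_jobs G"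
    and pts: "int (release (edges G ! j)) \<in> points G" "int (deadline (edges G ! j)) \<in> points G"
    if "j < ?n" "preemptive (edges G ! j)" "0 < proc (edges G ! j)" for j
    using that by (auto simp: pre_jobs_def points_def)
  have rd: "release (edges G ! j) \<le> deadline (edges G ! j)"
    if "j < ?n" "preemptive (edges G ! j)" "0 < proc (edges G ! j)" for j
  proof -
    have fj: "feasible_job (edges G ! j) (S0 j)" using S0 that by (simp add: feasible_def)
    then have "S0 j \<noteq> {}" using that(3) unfolding feasible_job_def by auto
    then obtain a b where "(a, b) \<in> S0 j" by auto
    moreover have "\<forall>(a, b)\<in>S0 j. real (release (edges G ! j)) \<le> a \<and> a \<le> b \<and> b \<le> real (deadline (edges G ! j))"
      using fj unfolding feasible_job_def by simp
    ultimately show ?thesis by fastforce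
  qed
  have s: "nonpre G release j \<le> s j \<and> s j \<le> l j" if "j < ?n" for j
    using sol that unfolding solution_def by auto
  show feas: "feasible G S"
    unfolding feasible_def
  proof (intro allI impI)
    fix j assume j: "j < ?n"
    consider "\<not> preemptive (edges G ! j)" | "preemptive (edges G ! j)" "proc (edges G ! j) = 0"
      | "preemptive (edges G ! j)" "0 < proc (edges G ! j)" by auto
    then show "feasible_job (edges G ! j) (S j)"
    proof cases
      case 1
      then have "int (release (edges G ! j)) \<le> s j" "s j + int (proc (edges G ! j)) \<le> int (deadline (edges G ! j))"
        using s[OF j] by (auto simp: nonpre_def l_def)
      then have "real (release (edges G ! j)) \<le> real_of_int (s j)"
        "real_of_int (s j + int (proc (edges G ! j))) \<le> real (deadline (edges G ! j))"
        by (metis of_int_of_nat_eq of_int_le_iff)+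
      then show ?thesis using S_np[OF j 1] 1 by (simp add: feasible_job_def)
    next
      case 2
      then show ?thesis using S_p0[OF j] by (simp add: feasible_job_def)
    next
      case 3
      show ?thesis
        by (rule pieces_feasible[OF job[OF j 3] 3(1) pts[OF j 3] rd[OF j 3] S_p[OF j 3]])
    qed
  qed
  have sub: "busy_times G S \<subseteq> busy {..<?n} s \<union> busy_points"
  proof
    fix t assume "t \<in> busy_times G S"
    then obtain j a b where j: "j < ?n" "(a, b) \<in> S j" "t \<in> {a..<b}"
      unfolding busy_times_def by auto
    consider "\<not> preemptive (edges G ! j)" | "preemptive (edges G ! j)" "proc (edges G ! j) = 0"
      | "preemptive (edges G ! j)" "0 < proc (edges G ! j)" by auto
    then show "t \<in> busy {..<?n} s \<union> busy_points"
    proof cases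
      case 1
      then have "t \<in> busy {..<?n} s" unfolding busy_def
        using j S_np[OF j(1) 1] by (intro UN_I[of j]) (auto simp: nonpre_def)
      then show ?thesis by blast
    next
      case 2
      then show ?thesis using S_p0[OF j(1)] j by simp
    next
      case 3
      obtain x where x: "x \<in> points G" "x < int (deadline (edges G ! j))"
        "a = real_of_int x" "b = real_of_int (x + piece (points G) X (X (int (release (edges G ! j))) + int (proc (edges G ! j))) x)"
        using j(2) unfolding S_p[OF j(1) 3] by auto
      show ?thesis using piece_subset[OF x(1) pts(2)[OF j(1) 3] x(2)] j(3) unfolding x(3,4) by blast
    qed
  qed
  define m where "m = Max (points G)"
  have "points G \<noteq> {}" using path unfolding path_network_def points_def by (auto simp: lessThan_empty_iff)
  then have m: "m \<in> points G" "\<And>s. s \<in> points G \<Longrightarrow> s \<le> m" using finite_points by (auto simp: m_def)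
  have fb: "busy {..<?n} s \<in> fmeasurable lborel" by (rule fmeasurable_busy) simp
  have "disconnected_time G S = measure lborel (busy_times G S)"
    by (rule disconnected_time_eq[OF path feas])
  also have "\<dots> \<le> measure lborel (busy {..<?n} s \<union> busy_points)"
    by (intro measure_mono_fmeasurable sub fmeasurableD[OF fmeasurable_busy_times[OF feas]]
        fmeasurable.Un fb fmeasurable_busy_points)
  also have "\<dots> \<le> measure lborel (busy {..<?n} s) + measure lborel busy_points"
    by (intro measure_Un_le fmeasurableD[OF fb] fmeasurableD[OF fmeasurable_busy_points])
  also have "\<dots> \<le> f + X m"
  proof -
    have "measure lborel busy_points \<le> X m" by (rule measure_busy_points[OF m X0])
    moreover have "measure lborel (busy {..<?n} s) \<le> f" using sol unfolding solution_def by simp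
    ultimately show ?thesis by simp
  qed
  finally have ub: "disconnected_time G S \<le> f + X m" .
  have lb: "f + X m \<le> 2 * disconnected_time G S'" if S': "feasible G S'" for S'
  proof -
    let ?U = "busy_times G S'"
    have fU: "?U \<in> fmeasurable lborel" by (rule fmeasurable_busy_times[OF S'])
    have "X m \<le> measure lborel (?U \<inter> {0..<real_of_int m})"
      by (rule X_least[OF preemptive_constraints[OF S'] _ m(1)]) simp
    also have "\<dots> \<le> measure lborel ?U"
      using fU by (intro measure_mono_fmeasurable) (auto dest: fmeasurableD)
    finally have "X m \<le> measure lborel ?U" .
    moreover have "f \<le> measure lborel ?U" by (rule nonpreemptive_lower_bound[OF S' sol])
    ultimately show ?thesis using disconnected_time_eq[OF path S'] by simp
  qed
  have "(f + X m) / 2 \<le> min_connectivity_opt G"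
    unfolding min_connectivity_opt_def
    by (rule cINF_greatest) (use S0 lb in \<open>auto simp: field_simps\<close>)
  then show "disconnected_time G S \<le> 2 * min_connectivity_opt G" using ub by simp
qed

section \<open>The dynamic program\<close>

abbreviation V :: "vname \<Rightarrow> aexp" where "V x \<equiv> Cell x (N 0)"

abbreviation num :: aexp where "num \<equiv> V ''in''"

abbreviation LWhen :: "bexp \<Rightarrow> lcom \<Rightarrow> lcom" where "LWhen b c \<equiv> LIf b c LSkip"

text \<open>Arrays are one-dimensional, so rows are laid out with length \<open>n + 1\<close>; the
  extra column belongs to the sentinel \<open>n\<close>. The product occurs only in
  addresses.\<close>

definition entry :: "aexp \<Rightarrow> aexp \<Rightarrow> aexp" where
  "entry A B = Plus (Times A (Plus num (N 1))) B"

text \<open>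
  A state of the dynamic program is a pair of indices \<open>A, B \<le> n\<close>, read from \<open>a\<close> and \<open>b\<close>; it stands
  for the jobs \<open>j\<close> with \<open>e j > e A\<close> and \<open>l j < l B\<close>, where index \<open>n\<close> is a sentinel. The optimal value
  is kept in \<open>F\<close> and the start times in \<open>S\<close>.
\<close>

definition update_longest :: lcom where
  "update_longest = LWhen (BAnd (BAnd (Less (Cell ''e'' (V ''a'')) (Cell ''e'' (V ''j'')))
         (Less (Cell ''l'' (V ''j'')) (Cell ''l'' (V ''b''))))
         (Less (Cell ''p'' (V ''J'')) (Cell ''p'' (V ''j''))))
       (Assign ''J'' (N 0) (V ''j''))"

text \<open>The sentinel \<open>n\<close> has length -1 in \<open>p\<close>, so it loses against
  every job, even an empty one, and survives exactly if the state contains no job.\<close>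

definition find_longest :: lcom where
  "find_longest = Assign ''J'' (N 0) num ;; For ''j'' num update_longest"

text \<open>The left end is kept as an index \<open>u\<close> with
  \<open>l u = min (l i) (l J)\<close>, because the left subproblem is named by it. The right end is
  kept as a number \<open>v\<close>: it may be \<open>l u + p J\<close>, which need not be the
  earliest completion time of any job.\<close>

definition pick_interval :: lcom where
  "pick_interval =
     LIf (Less (Cell ''l'' (V ''i'')) (Cell ''l'' (V ''J'')))
       (Assign ''u'' (N 0) (V ''i'')) (Assign ''u'' (N 0) (V ''J'')) ;;
     Assign ''v'' (N 0) (Plus (Cell ''l'' (V ''u'')) (Cell ''p'' (V ''J''))) ;;
     LWhen (Less (V ''v'') (Cell ''e'' (V ''J''))) (Assign ''v'' (N 0) (Cell ''e'' (V ''J''))) ;;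
     LWhen (Less (V ''v'') (Cell ''e'' (V ''k''))) (Assign ''v'' (N 0) (Cell ''e'' (V ''k'')))"

definition update_pred :: lcom where
  "update_pred = LWhen (BAnd (BNot (Less (V ''v'') (Cell ''e'' (V ''h''))))
         (Less (Cell ''e'' (V ''w'')) (Cell ''e'' (V ''h''))))
       (Assign ''w'' (N 0) (V ''h''))"

text \<open>Turns the right end \<open>v\<close> into an index: with \<open>e w\<close> the largest
  earliest completion time not exceeding \<open>v\<close>, the conditions \<open>e j > v\<close> and
  \<open>e j > e w\<close> agree.\<close>

definition find_pred :: lcom where
  "find_pred = Assign ''w'' (N 0) num ;; For ''h'' num update_pred"

definition start_addr :: "aexp \<Rightarrow> aexp \<Rightarrow> aexp" where
  "start_addr A B = entry (entry A B) (V ''h'')"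

text \<open>Start times are copied from the two subproblems when a candidate is adopted, which
  replaces backtracking through the table: at the end the row of the state \<open>(n, n)\<close> is
  the complete schedule.\<close>

definition combine_start :: lcom where
  "combine_start = LIf (Less (Cell ''l'' (V ''h'')) (Cell ''l'' (V ''u'')))
       (Assign ''S'' (start_addr (V ''a'') (V ''b'')) (Cell ''S'' (start_addr (V ''a'') (V ''u''))))
       (LIf (Less (V ''v'') (Cell ''e'' (V ''h'')))
         (Assign ''S'' (start_addr (V ''a'') (V ''b'')) (Cell ''S'' (start_addr (V ''w'') (V ''b''))))
         (LIf (Less (Cell ''l'' (V ''u'')) (Cell ''r'' (V ''h'')))
           (Assign ''S'' (start_addr (V ''a'') (V ''b'')) (Cell ''r'' (V ''h'')))
           (Assign ''S'' (start_addr (V ''a'') (V ''b'')) (Cell ''l'' (V ''u'')))))"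

definition combine_starts :: lcom where
  "combine_starts = For ''h'' num combine_start"

text \<open>The test \<open>0 < i + k\<close> makes the first candidate unconditional. It stands in
  for an infinite initial value and discards whatever an earlier sweep, possibly with unfinished
  subproblems, left in the cell.\<close>

definition try_interval :: lcom where
  "try_interval = pick_interval ;; find_pred ;;
     Assign ''x'' (N 0) (Plus (Plus (Minus (V ''v'') (Cell ''l'' (V ''u'')))
       (Cell ''F'' (entry (V ''a'') (V ''u'')))) (Cell ''F'' (entry (V ''w'') (V ''b'')))) ;;
     LWhen (BNot (BAnd (Less (N 0) (Plus (V ''i'') (V ''k'')))
         (BNot (Less (V ''x'') (Cell ''F'' (entry (V ''a'') (V ''b'')))))))
       (Assign ''F'' (entry (V ''a'') (V ''b'')) (V ''x'') ;; combine_starts)"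

definition solve_state :: lcom where
  "solve_state = find_longest ;;
     LWhen (Less (V ''J'') num) (For ''i'' num (For ''k'' num try_interval))"

text \<open>Indices are not sorted by \<open>e\<close> or \<open>l\<close>, so no loop order is
  known to put subproblems first. Instead the table is swept \<open>n\<close> times; since
  subproblems have fewer jobs, the first \<open>k\<close> sweeps settle all states with at most
  \<open>k\<close> jobs.\<close>

definition dynamic_program :: lcom where
  "dynamic_program = For ''t'' num (For ''a'' (Plus num (N 1)) (For ''b'' (Plus num (N 1)) solve_state))"

lemma writes_dp [simp]:
  "writes update_longest = {''J''}"
  "writes update_pred = {''w''}"
  "writes combine_start = {''S''}"
  "writes find_longest = {''J'', ''j''}"
  "writes pick_interval = {''u'', ''v''}"
  "writes find_pred = {''w'', ''h''}"
  "writes combine_starts = {''h'', ''S''}"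
  "writes try_interval = {''u'', ''v'', ''w'', ''h'', ''x'', ''F'', ''S''}"
  "writes solve_state = {''J'', ''j'', ''i'', ''k'', ''u'', ''v'', ''w'', ''h'', ''x'', ''F'', ''S''}"
  "writes dynamic_program = {''t'', ''a'', ''b'', ''J'', ''j'', ''i'', ''k'', ''u'', ''v'', ''w'', ''h'', ''x'', ''F'', ''S''}"
  unfolding update_longest_def update_pred_def combine_start_def find_longest_def pick_interval_def find_pred_def combine_starts_def try_interval_def
    solve_state_def dynamic_program_def by auto

section \<open>Correctness of the dynamic program\<close>

locale dp = jobs +
  fixes big :: int
  assumes r_nonneg: "\<And>j. j < n \<Longrightarrow> 0 \<le> r j" and l_less_big: "\<And>j. j < n \<Longrightarrow> l j < big"
begin

text \<open>Index \<open>n\<close> acts as minus infinity for \<open>e\<close> and plus infinity for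
  \<open>l\<close>: earliest completion times are nonnegative and \<open>big\<close> exceeds all
  latest start times. Thus the state \<open>(n, n)\<close> contains every job.\<close>

definition e' :: "nat \<Rightarrow> int" where "e' A = (if A < n then e A else - 1)"
definition l' :: "nat \<Rightarrow> int" where "l' B = (if B < n then l B else big)"
definition p' :: "nat \<Rightarrow> int" where "p' j = (if j < n then p j else - 1)"

lemma sentinel_simps [simp]: "j < n \<Longrightarrow> e' j = e j" "j < n \<Longrightarrow> l' j = l j" "j < n \<Longrightarrow> p' j = p j"
  "e' n = - 1" "l' n = big" "p' n = - 1"
  by (auto simp: e'_def l'_def p'_def)

definition Q :: "nat \<Rightarrow> nat \<Rightarrow> nat set" where
  "Q A B = {j \<in> {..<n}. e' A < e j \<and> l j < l' B}"

definition tables :: "memory \<Rightarrow> bool" where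
  "tables m \<longleftrightarrow> m ''in'' 0 = int n \<and> (\<forall>j\<le>n. m ''e'' (int j) = e' j \<and> m ''l'' (int j) = l' j \<and>
     m ''p'' (int j) = p' j) \<and> (\<forall>j<n. m ''r'' (int j) = r j)"

lemma tables_frame:
  assumes "tables m" "\<And>y. y \<in> {''in'', ''e'', ''l'', ''p'', ''r''} \<Longrightarrow> m' y = m y"
  shows "tables m'"
  using assms unfolding tables_def by simp

lemma e_nonneg: "j < n \<Longrightarrow> 0 \<le> e j"
  using r_nonneg p_nonneg by (simp add: e_def)

definition idx :: "nat \<Rightarrow> nat \<Rightarrow> int" where
  "idx A B = int A * (int n + 1) + int B"

definition sidx :: "nat \<Rightarrow> nat \<Rightarrow> nat \<Rightarrow> int" where
  "sidx A B h = idx A B * (int n + 1) + int h"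

lemma digits_inject:
  fixes a b :: int assumes "0 \<le> b" "b < M" "0 \<le> b'" "b' < M"
  shows "a * M + b = a' * M + b' \<longleftrightarrow> a = a' \<and> b = b'"
proof
  assume *: "a * M + b = a' * M + b'"
  have "(a * M + b) div M = a" "(a' * M + b') div M = a'" using assms by auto
  then show "a = a' \<and> b = b'" using * by auto
qed simp

lemma idx_inject: "B \<le> n \<Longrightarrow> B' \<le> n \<Longrightarrow> idx A B = idx A' B' \<longleftrightarrow> A = A' \<and> B = B'"
  unfolding idx_def by (subst digits_inject) auto

lemma sidx_inject: "B \<le> n \<Longrightarrow> B' \<le> n \<Longrightarrow> h < n \<Longrightarrow> h' < n \<Longrightarrow>
    sidx A B h = sidx A' B' h' \<longleftrightarrow> A = A' \<and> B = B' \<and> h = h'"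
  unfolding sidx_def by (subst digits_inject) (auto simp: idx_inject)

definition F :: "memory \<Rightarrow> nat \<Rightarrow> nat \<Rightarrow> int" where "F m A B = m ''F'' (idx A B)"
definition S :: "memory \<Rightarrow> nat \<Rightarrow> nat \<Rightarrow> nat \<Rightarrow> int" where "S m A B h = m ''S'' (sidx A B h)"

lemma Collect_lessThan_Suc: "R \<inter> {..<Suc i} = (if i \<in> R then insert i (R \<inter> {..<i}) else R \<inter> {..<i})"
  by (auto simp: less_Suc_eq)

lemma find_longest:
  assumes t: "tables m" and ab: "m ''a'' 0 = int A" "m ''b'' 0 = int B" "A \<le> n" "B \<le> n"
  shows "\<exists>J\<le>n. lmem find_longest m ''J'' 0 = int J \<and>
     (if Q A B = {} then J = n else J \<in> Q A B \<and> (\<forall>j\<in>Q A B. p j \<le> p J))"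
proof -
  define m1 where "m1 = store m ''J'' 0 (int n)"
  define I where "I i m' \<longleftrightarrow> (\<exists>J\<le>n. m' ''J'' 0 = int J \<and> (if Q A B \<inter> {..<i} = {} then J = n
     else J \<in> Q A B \<inter> {..<i} \<and> (\<forall>j\<in>Q A B \<inter> {..<i}. p j \<le> p J)))" for i and m' :: memory
  have n: "m ''in'' 0 = int n" using t by (simp add: tables_def)
  have "I n (lmem (For ''j'' num update_longest) m1)"
  proof (rule For_invariant)
    show "nat (aval num m1) = n" by (simp add: m1_def store_apply n)
    show "I 0 m1" by (simp add: I_def m1_def store_apply)
    show "I i (store m' ''j'' 0 v)" if "I i m'" for i m' v
      using that by (simp add: I_def store_apply)
  next
    fix i m' assume i: "i < n" and fr: "\<And>y. y \<notin> insert ''j'' (writes update_longest) \<Longrightarrow> m' y = m1 y"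
      and j: "m' ''j'' 0 = int i" and I: "I i m'"
    have eqs: "m' ''e'' = m ''e''" "m' ''l'' = m ''l''" "m' ''p'' = m ''p''" "m' ''a'' = m ''a''" "m' ''b'' = m ''b''"
      using fr by (simp_all add: m1_def store_other)
    from I obtain J where J: "J \<le> n" "m' ''J'' 0 = int J" "if Q A B \<inter> {..<i} = {} then J = n
     else J \<in> Q A B \<inter> {..<i} \<and> (\<forall>j\<in>Q A B \<inter> {..<i}. p j \<le> p J)" unfolding I_def by blast
    have *: "lmem update_longest m' = (if i \<in> Q A B \<and> p' J < p i then store m' ''J'' 0 (int i) else m')"
      using t i J(1) ab j J(2) unfolding update_longest_def Q_def tables_def by (simp add: eqs)
    show "I (Suc i) (lmem update_longest m')"
    proof (cases "i \<in> Q A B")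
      case False
      then show ?thesis using I unfolding * I_def Collect_lessThan_Suc by simp
    next
      case iQ: True
      show ?thesis
      proof (cases "p' J < p i")
        case True
        have "p j \<le> p i" if "j \<in> Q A B \<inter> {..<i}" for j
        proof -
          have "J \<in> Q A B" "p j \<le> p J" using J(3) that by (auto split: if_splits)
          then show ?thesis using True by (simp add: Q_def)
        qed
        then show ?thesis using True iQ i unfolding * I_def Collect_lessThan_Suc
          by (intro exI[of _ i]) (auto simp: store_apply)
      next
        case False
        have "J \<noteq> n" using False p_nonneg[OF i] by auto
        then have "J \<in> Q A B \<inter> {..<i} \<and> (\<forall>j\<in>Q A B \<inter> {..<i}. p j \<le> p J)" using J(3) by presburger
        then show ?thesis using False iQ i J(1,2) unfolding * I_def Collect_lessThan_Suc
          by (intro exI[of _ J]) (auto simp: Q_def)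
      qed
    qed
  qed
  moreover have fl: "lmem find_longest m = lmem (For ''j'' num update_longest) m1"
    by (simp add: find_longest_def m1_def n)
  moreover have Qn: "Q A B \<inter> {..<n} = Q A B" by (auto simp: Q_def)
  ultimately show ?thesis unfolding I_def by (simp only: fl Qn)
qed

definition left :: "nat \<Rightarrow> nat \<Rightarrow> nat" where "left J i = (if l i < l J then i else J)"
definition right :: "nat \<Rightarrow> nat \<Rightarrow> nat \<Rightarrow> int" where
  "right J i k = max (e k) (max (e J) (l (left J i) + p J))"

definition pred_of :: "int \<Rightarrow> nat \<Rightarrow> bool" where
  "pred_of b w \<longleftrightarrow> w < n \<and> e w \<le> b \<and> (\<forall>h<n. e h \<le> b \<longrightarrow> e h \<le> e w)"

lemma left_less: "i < n \<Longrightarrow> J < n \<Longrightarrow> left J i < n"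
  by (simp add: left_def)

lemma pick_interval:
  assumes t: "tables m" and "m ''i'' 0 = int i" "m ''k'' 0 = int k" "m ''J'' 0 = int J" "i < n" "k < n" "J < n"
  shows "lmem pick_interval m ''u'' 0 = int (left J i)" "lmem pick_interval m ''v'' 0 = right J i k"
  using assms unfolding pick_interval_def tables_def left_def right_def
  by (auto simp: store_apply max_def)

text \<open>Some job with \<open>e h \<le> b\<close> is required so that the search does not end
  with the sentinel; in the application it is the longest job \<open>J\<close>, as
  \<open>e J\<close> never exceeds the right end.\<close>

lemma find_pred:
  assumes t: "tables m" and v: "m ''v'' 0 = b" and h: "h < n" "e h \<le> b"
  shows "\<exists>w. pred_of b w \<and> lmem find_pred m ''w'' 0 = int w"
proof -
  define m1 where "m1 = store m ''w'' 0 (int n)"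
  define I where "I i m' \<longleftrightarrow> (\<exists>w\<le>n. m' ''w'' 0 = int w \<and> e' w \<le> b \<and> (\<forall>h<i. e h \<le> b \<longrightarrow> e h \<le> e' w))"
    for i and m' :: memory
  have n: "m ''in'' 0 = int n" using t by (simp add: tables_def)
  have "I n (lmem (For ''h'' num update_pred) m1)"
  proof (rule For_invariant)
    show "nat (aval num m1) = n" by (simp add: m1_def store_apply n)
    have "- 1 \<le> b" using e_nonneg[OF h(1)] h(2) by simp
    then show "I 0 m1" by (simp add: I_def m1_def store_apply)
    show "I i (store m' ''h'' 0 v)" if "I i m'" for i m' v
      using that by (simp add: I_def store_apply)
  next
    fix i m' assume i: "i < n" and fr: "\<And>y. y \<notin> insert ''h'' (writes update_pred) \<Longrightarrow> m' y = m1 y"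
      and j: "m' ''h'' 0 = int i" and I: "I i m'"
    have eqs: "m' ''e'' = m ''e''" "m' ''v'' = m ''v''"
      using fr by (simp_all add: m1_def store_other)
    from I obtain w where w: "w \<le> n" "m' ''w'' 0 = int w" "e' w \<le> b" "\<forall>h<i. e h \<le> b \<longrightarrow> e h \<le> e' w"
      unfolding I_def by blast
    have *: "lmem update_pred m' = (if e i \<le> b \<and> e' w < e i then store m' ''w'' 0 (int i) else m')"
      using t i w(1) j w(2) v unfolding update_pred_def tables_def by (simp add: eqs not_less)
    show "I (Suc i) (lmem update_pred m')"
    proof (cases "e i \<le> b \<and> e' w < e i")
      case True
      then show ?thesis using w(4) i unfolding * I_def
        by (intro exI[of _ i]) (auto simp: store_apply less_Suc_eq)
    next
      case False
      then show ?thesis using w unfolding * I_def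
        by (intro exI[of _ w]) (auto simp: less_Suc_eq)
    qed
  qed
  then obtain w where w: "w \<le> n" "lmem (For ''h'' num update_pred) m1 ''w'' 0 = int w" "e' w \<le> b"
    "\<forall>h<n. e h \<le> b \<longrightarrow> e h \<le> e' w" unfolding I_def by blast
  have "w \<noteq> n" using w(4) h e_nonneg[OF h(1)] by force
  then have "pred_of b w" using w by (auto simp: pred_of_def)
  moreover have "lmem find_pred m = lmem (For ''h'' num update_pred) m1"
    by (simp add: find_pred_def m1_def n)
  ultimately show ?thesis using w(2) by auto
qed

definition starts :: "memory \<Rightarrow> nat \<Rightarrow> nat \<Rightarrow> nat \<Rightarrow> int \<Rightarrow> nat \<Rightarrow> nat \<Rightarrow> int" where
  "starts m A B u b w h = (if l h < l u then S m A u h else if b < e h then S m w B h else max (l u) (r h))"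

lemma aval_entry: "aval (entry x y) m = aval x m * (m ''in'' 0 + 1) + aval y m"
  by (simp add: entry_def)

lemma aval_start_addr: "tables m \<Longrightarrow> aval x m = int A \<Longrightarrow> aval y m = int B \<Longrightarrow> m ''h'' 0 = int h \<Longrightarrow>
    aval (start_addr x y) m = sidx A B h"
  by (simp add: start_addr_def aval_entry tables_def sidx_def idx_def)

text \<open>A row is overwritten while others are read. \<open>u \<noteq> B\<close> and
  \<open>w \<noteq> A\<close> guarantee that the source rows \<open>(A, u)\<close> and
  \<open>(w, B)\<close> differ from the target \<open>(A, B)\<close>, so all values read are the
  original ones.\<close>

lemma combine_starts:
  assumes t: "tables m" and regs: "m ''a'' 0 = int A" "m ''b'' 0 = int B" "m ''u'' 0 = int u"
      "m ''w'' 0 = int w" "m ''v'' 0 = b"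
    and le: "A \<le> n" "B \<le> n" "u < n" "w < n" "u \<noteq> B" "w \<noteq> A"
  shows "\<forall>h<n. S (lmem combine_starts m) A B h = starts m A B u b w h"
    and "\<forall>A' B'. B' \<le> n \<longrightarrow> (A', B') \<noteq> (A, B) \<longrightarrow>
      (\<forall>h<n. S (lmem combine_starts m) A' B' h = S m A' B' h)"
proof -
  define I where "I i m' \<longleftrightarrow> (\<forall>h<i. S m' A B h = starts m A B u b w h) \<and>
      (\<forall>A' B'. B' \<le> n \<longrightarrow> (A', B') \<noteq> (A, B) \<longrightarrow> (\<forall>h<n. S m' A' B' h = S m A' B' h))" for i m'
  have "I n (lmem combine_starts m)"
    unfolding combine_starts_def
  proof (rule For_invariant)
    show "nat (aval num m) = n" using t by (simp add: tables_def)
    show "I 0 m" by (simp add: I_def)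
    show "I i (store m' ''h'' 0 v)" if "I i m'" for i m' v
      using that by (simp add: I_def S_def store_apply)
  next
    fix i m' assume i: "i < n" and fr: "\<And>y. y \<notin> insert ''h'' (writes combine_start) \<Longrightarrow> m' y = m y"
      and h: "m' ''h'' 0 = int i" and I: "I i m'"
    have t': "tables m'" by (rule tables_frame[OF t], rule fr) auto
    have regs': "m' ''a'' 0 = int A" "m' ''b'' 0 = int B" "m' ''u'' 0 = int u" "m' ''w'' 0 = int w" "m' ''v'' 0 = b"
      using fr regs by simp_all
    have src: "S m' A u i = S m A u i" "S m' w B i = S m w B i"
      using I i le unfolding I_def by auto
    have *: "lmem combine_start m' = store m' ''S'' (sidx A B i) (starts m A B u b w i)"
      using t' i le regs' h src unfolding starts_def combine_start_def
      by (simp add: aval_start_addr S_def) (simp add: tables_def max_def)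
    show "I (Suc i) (lmem combine_start m')"
      using I i le(2) unfolding * I_def S_def
      by (auto simp: store_apply sidx_inject less_Suc_eq)
  qed
  then show "\<forall>h<n. S (lmem combine_starts m) A B h = starts m A B u b w h"
    "\<forall>A' B'. B' \<le> n \<longrightarrow> (A', B') \<noteq> (A, B) \<longrightarrow>
      (\<forall>h<n. S (lmem combine_starts m) A' B' h = S m A' B' h)"
    unfolding I_def by blast+
qed

definition changes_only :: "memory \<Rightarrow> memory \<Rightarrow> nat \<Rightarrow> nat \<Rightarrow> bool" where
  "changes_only m m' A B \<longleftrightarrow> (\<forall>A' B'. B' \<le> n \<longrightarrow> (A', B') \<noteq> (A, B) \<longrightarrow>
     F m' A' B' = F m A' B' \<and> (\<forall>h<n. S m' A' B' h = S m A' B' h))"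

definition cost :: "memory \<Rightarrow> nat \<Rightarrow> nat \<Rightarrow> nat \<Rightarrow> int \<Rightarrow> nat \<Rightarrow> int" where
  "cost m A B u b w = b - l u + F m A u + F m w B"

definition keeps :: "memory \<Rightarrow> memory \<Rightarrow> nat \<Rightarrow> nat \<Rightarrow> bool" where
  "keeps m m' A B \<longleftrightarrow> F m' A B = F m A B \<and> (\<forall>h<n. S m' A B h = S m A B h)"

definition adopts :: "memory \<Rightarrow> memory \<Rightarrow> nat \<Rightarrow> nat \<Rightarrow> nat \<Rightarrow> int \<Rightarrow> nat \<Rightarrow> bool" where
  "adopts m m' A B u b w \<longleftrightarrow> F m' A B = cost m A B u b w \<and> (\<forall>h<n. S m' A B h = starts m A B u b w h)"

lemma try_interval:
  assumes t: "tables m" and regs: "m ''a'' 0 = int A" "m ''b'' 0 = int B" "m ''J'' 0 = int J"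
      "m ''i'' 0 = int i" "m ''k'' 0 = int k"
    and le: "A \<le> n" "B \<le> n" "i < n" "k < n" "J \<in> Q A B"
  obtains w where "pred_of (right J i k) w" "changes_only m (lmem try_interval m) A B"
    "if 0 < i + k \<and> F m A B \<le> cost m A B (left J i) (right J i k) w
     then keeps m (lmem try_interval m) A B else adopts m (lmem try_interval m) A B (left J i) (right J i k) w"
proof -
  let ?u = "left J i" and ?b = "right J i k"
  have J: "J < n" "e' A < e J" "l J < l' B" using le(5) by (auto simp: Q_def)
  have u: "?u < n" by (rule left_less[OF le(3) J(1)])
  \<comment> \<open>Since \<open>l u \<le> l J < l' B\<close>, and likewise
    \<open>e' A < e J \<le> e w\<close> below, neither subproblem is the state itself.\<close>
  have "l ?u \<le> l J" by (simp add: left_def)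
  then have uB: "?u \<noteq> B" using J u by (auto simp: l'_def)
  have eJ: "e J \<le> ?b" by (simp add: right_def)
  define m1 where "m1 = lmem pick_interval m"
  have m1: "m1 y = m y" if "y \<notin> {''u'', ''v''}" for y
    unfolding m1_def by (rule lmem_frame) (use that in simp)
  have m1_uv: "m1 ''u'' 0 = int ?u" "m1 ''v'' 0 = ?b"
    unfolding m1_def using pick_interval[OF t regs(4,5,3) le(3,4) J(1)] by auto
  have t1: "tables m1" by (rule tables_frame[OF t], rule m1) auto
  obtain w where w: "pred_of ?b w" "lmem find_pred m1 ''w'' 0 = int w"
    using find_pred[OF t1 m1_uv(2) J(1) eJ] by blast
  have wn: "w < n" and "e J \<le> e w" using w(1) J(1) eJ by (auto simp: pred_of_def)
  then have wA: "w \<noteq> A" using J(2) by auto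
  define m2 where "m2 = lmem find_pred m1"
  have m2: "m2 y = m1 y" if "y \<notin> {''w'', ''h''}" for y
    unfolding m2_def by (rule lmem_frame) (use that in simp)
  have m2m: "m2 y = m y" if "y \<notin> {''u'', ''v'', ''w'', ''h''}" for y
    using m1 m2 that by simp
  have m2_uvw: "m2 ''u'' 0 = int ?u" "m2 ''v'' 0 = ?b" "m2 ''w'' 0 = int w"
    using m2 m1_uv w(2) by (auto simp: m2_def)
  have t2: "tables m2" by (rule tables_frame[OF t], rule m2m) auto
  let ?x = "cost m A B ?u ?b w"
  define m3 where "m3 = store m2 ''x'' 0 ?x"
  have x: "lmem (Assign ''x'' (N 0) (Plus (Plus (Minus (V ''v'') (Cell ''l'' (V ''u'')))
       (Cell ''F'' (entry (V ''a'') (V ''u'')))) (Cell ''F'' (entry (V ''w'') (V ''b''))))) m2 = m3"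
    using t2 u m2_uvw m2m regs unfolding m3_def cost_def F_def idx_def
    by (simp add: aval_entry) (simp add: tables_def)
  have F3: "F m3 A' B' = F m A' B'" and S3: "S m3 A' B' h = S m A' B' h" for A' B' h
    by (simp_all add: F_def S_def m3_def store_apply m2m)
  define m4 where "m4 = store m3 ''F'' (idx A B) ?x"
  have t4: "tables m4" by (rule tables_frame[OF t2]) (auto simp: m4_def m3_def store_other)
  have regs4: "m4 ''a'' 0 = int A" "m4 ''b'' 0 = int B" "m4 ''u'' 0 = int ?u" "m4 ''w'' 0 = int w" "m4 ''v'' 0 = ?b"
    using m2_uvw m2m regs by (simp_all add: m4_def m3_def store_apply)
  note cs = combine_starts[OF t4 regs4 le(1,2) u wn uB wA]
  have S4: "S m4 = S m3" by (intro ext) (simp add: S_def m4_def store_apply)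
  have idx0: "aval (entry (V ''a'') (V ''b'')) m3 = idx A B"
    using t2 m2m regs by (simp add: aval_entry m3_def store_apply idx_def tables_def)
  have test: "bval (BNot (BAnd (Less (N 0) (Plus (V ''i'') (V ''k'')))
         (BNot (Less (V ''x'') (Cell ''F'' (entry (V ''a'') (V ''b''))))))) m3 \<longleftrightarrow>
      \<not> (0 < i + k \<and> F m A B \<le> ?x)"
  proof -
    have "m3 ''i'' 0 = int i" "m3 ''k'' 0 = int k" "m3 ''x'' 0 = ?x" "m3 ''F'' (idx A B) = F m A B"
      using m2m regs F3[of A B] by (simp_all add: F_def) (simp_all add: m3_def store_apply)
    then show ?thesis by (simp add: idx0 not_less) linarith
  qed
  have upd: "lmem (Assign ''F'' (entry (V ''a'') (V ''b'')) (V ''x'') ;; combine_starts) m3 = lmem combine_starts m4"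
    by (simp add: idx0 m4_def) (simp add: m3_def store_apply)
  have m': "lmem try_interval m = (if 0 < i + k \<and> F m A B \<le> ?x then m3 else lmem combine_starts m4)"
    unfolding try_interval_def lmem.simps(4) m1_def[symmetric] m2_def[symmetric] x
    unfolding lmem.simps(5) test using upd by (simp del: bval.simps)
  have FS: "F (lmem combine_starts m4) = F m4" by (intro ext) (simp add: F_def lmem_frame)
  have F4: "F m4 A' B' = (if A' = A \<and> B' = B then ?x else F m A' B')" if "B' \<le> n" for A' B'
    using F3[of A' B'] idx_inject[OF that le(2)] by (simp add: F_def m4_def store_apply)
  have st: "starts m4 A B ?u ?b w h = starts m A B ?u ?b w h" for h
    by (simp add: starts_def S4 S3)
  show ?thesis
  proof (rule that[OF w(1)])
    show "changes_only m (lmem try_interval m) A B"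
      using cs(2) F4 unfolding m' changes_only_def by (auto simp: F3 S3 FS S4)
    show "if 0 < i + k \<and> F m A B \<le> ?x then keeps m (lmem try_interval m) A B
      else adopts m (lmem try_interval m) A B ?u ?b w"
      unfolding keeps_def adopts_def
      using cs(1) F4[OF le(2)] unfolding m' by (auto simp: F3 S3 FS st)
  qed
qed

definition good :: "memory \<Rightarrow> nat \<Rightarrow> nat \<Rightarrow> bool" where
  "good m A B \<longleftrightarrow> solution (Q A B) (F m A B) (S m A B)"

lemma solution_cong:
  assumes "\<And>j. j \<in> R \<Longrightarrow> s j = s' j"
  shows "solution R f s \<longleftrightarrow> solution R f s'"
proof -
  have "busy R (\<lambda>j. real_of_int (s j)) = busy R (\<lambda>j. real_of_int (s' j))"
    unfolding busy_def by (rule SUP_cong) (simp_all add: assms)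
  then show ?thesis unfolding solution_def by (simp add: assms)
qed

lemma good_changes_only:
  assumes "changes_only m m' A B" "B' \<le> n" "(A', B') \<noteq> (A, B)"
  shows "good m' A' B' \<longleftrightarrow> good m A' B'"
proof -
  have "F m' A' B' = F m A' B'" "\<And>h. h < n \<Longrightarrow> S m' A' B' h = S m A' B' h"
    using assms unfolding changes_only_def by blast+
  then show ?thesis unfolding good_def by (simp, intro solution_cong) (auto simp: Q_def)
qed

lemma Q_left:
  assumes "J \<in> Q A B" "i < n"
  shows "Q A (left J i) = {j \<in> Q A B. l j < min (l i) (l J)}"
  using assms by (auto simp: Q_def left_def min_def)

text \<open>\<open>e w\<close> is the largest \<open>e\<close> value up to \<open>b\<close>, so no
  job has \<open>e w < e j \<le> b\<close>; the condition on \<open>A\<close> is implied because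
  \<open>e' A < e J \<le> e w\<close>. Together with \<open>Q_left\<close> this keeps all
  subproblems among the states.\<close>

lemma Q_right:
  assumes "J \<in> Q A B" "pred_of b w" "e J \<le> b"
  shows "Q w B = {j \<in> Q A B. b < e j}"
proof -
  have w: "w < n" "e w \<le> b" "\<And>h. h < n \<Longrightarrow> e h \<le> b \<Longrightarrow> e h \<le> e w" using assms(2) by (auto simp: pred_of_def)
  have "e' A < e J" "e J \<le> e w" using assms w by (auto simp: Q_def)
  then show ?thesis using w by (auto simp: Q_def) (metis not_le)
qed

lemma card_subproblem:
  assumes "J \<in> Q A B" "R \<subseteq> Q A B" "J \<notin> R"
  shows "card R < card (Q A B)"
  by (rule psubset_card_mono) (use assms in \<open>auto simp: Q_def\<close>)

text \<open>The second statement assumes nothing about the old entry of a nonempty state, which may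
  be wrong from earlier sweeps. For an empty state the loops are skipped, so its entry must be right
  already.\<close>

lemma solve_state:
  assumes t: "tables m" and regs: "m ''a'' 0 = int A" "m ''b'' 0 = int B" "A \<le> n" "B \<le> n"
  shows "changes_only m (lmem solve_state m) A B"
    and "(\<And>A' B'. A' \<le> n \<Longrightarrow> B' \<le> n \<Longrightarrow> card (Q A' B') < card (Q A B) \<Longrightarrow> good m A' B') \<Longrightarrow>
      (Q A B = {} \<Longrightarrow> good m A B) \<Longrightarrow> good (lmem solve_state m) A B"
proof -
  obtain J where J: "lmem find_longest m ''J'' 0 = int J"
    "if Q A B = {} then J = n else J \<in> Q A B \<and> (\<forall>j\<in>Q A B. p j \<le> p J)"
    using find_longest[OF t regs] by blast
  define m0 where "m0 = lmem find_longest m"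
  have m0: "m0 y = m y" if "y \<notin> {''J'', ''j''}" for y
    unfolding m0_def by (rule lmem_frame) (use that in simp)
  have t0: "tables m0" by (rule tables_frame[OF t], rule m0) auto
  have FS0: "F m0 = F m" "S m0 = S m" by (intro ext; simp add: F_def S_def m0)+
  have n0: "m0 ''in'' 0 = int n" using t0 by (simp add: tables_def)
  have J0: "m0 ''J'' 0 = int J" using J(1) by (simp add: m0_def)
  have "changes_only m (lmem solve_state m) A B \<and>
     ((\<forall>A' B'. A' \<le> n \<longrightarrow> B' \<le> n \<longrightarrow> card (Q A' B') < card (Q A B) \<longrightarrow> good m A' B') \<longrightarrow>
      (Q A B = {} \<longrightarrow> good m A B) \<longrightarrow> good (lmem solve_state m) A B)"
  proof (cases "Q A B = {}")
    case True
    then have "lmem solve_state m = m0" using J n0 J0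
      by (simp add: solve_state_def m0_def[symmetric])
    then show ?thesis using True by (auto simp: changes_only_def good_def FS0)
  next
    case False
    then have JQ: "J \<in> Q A B" and longest: "\<And>j. j \<in> Q A B \<Longrightarrow> p j \<le> p J" using J(2) by auto
    then have Jn: "J < n" by (simp add: Q_def)
    let ?u = "left J" and ?b = "right J"
    define c where "c i k w = cost m0 A B (?u i) (?b i k) w" for i k w
    define best where "best i k w m' \<longleftrightarrow> pred_of (?b i k) w \<and> adopts m0 m' A B (?u i) (?b i k) w" for i k w m'
    \<comment> \<open>\<open>D\<close> holds the candidates tried so far: the entry is that of one
      of them and at most each of their costs. The index \<open>w\<close> is existential because
      jobs with equal \<open>e\<close> make it ambiguous. Costs refer to \<open>m0\<close>, as
      subproblem entries do not change.\<close>
    define inv where "inv D m' \<longleftrightarrow> changes_only m0 m' A B \<and>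
      (D \<noteq> {} \<longrightarrow> (\<exists>(i, k)\<in>D. \<exists>w. best i k w m')) \<and>
      (\<forall>(i, k)\<in>D. \<exists>w. pred_of (?b i k) w \<and> F m' A B \<le> c i k w)" for D and m' :: memory
    have inv_store: "inv D (store m' y i v) \<longleftrightarrow> inv D m'" if "y \<noteq> ''F''" "y \<noteq> ''S''" for D m' y i v
    proof -
      have "F (store m' y i v) = F m'" "S (store m' y i v) = S m'"
        using that by (intro ext; simp add: F_def S_def store_apply)+
      then show ?thesis by (simp add: inv_def best_def adopts_def changes_only_def)
    qed
    have step: "inv (insert (i, k) D) (lmem try_interval m')"
      if m': "\<And>y. y \<notin> {''i'', ''k'', ''u'', ''v'', ''w'', ''h'', ''x'', ''F'', ''S''} \<Longrightarrow> m' y = m0 y"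
        and ik: "m' ''i'' 0 = int i" "m' ''k'' 0 = int k" "i < n" "k < n"
        and D: "D = {} \<longleftrightarrow> i + k = 0" "D \<subseteq> {..<n} \<times> {..<n}" and I: "inv D m'" for i k D m'
    proof -
      have t': "tables m'" by (rule tables_frame[OF t0], rule m') auto
      have regs': "m' ''a'' 0 = int A" "m' ''b'' 0 = int B" "m' ''J'' 0 = int J"
        using m' m0 regs J0 by auto
      obtain w where w: "pred_of (?b i k) w" "changes_only m' (lmem try_interval m') A B"
        "if 0 < i + k \<and> F m' A B \<le> cost m' A B (?u i) (?b i k) w
         then keeps m' (lmem try_interval m') A B else adopts m' (lmem try_interval m') A B (?u i) (?b i k) w"
        by (rule try_interval[OF t' regs' ik(1,2) regs(3,4) ik(3,4) JQ])
      have co: "changes_only m0 m' A B" using I by (simp add: inv_def)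
      have co': "changes_only m0 (lmem try_interval m') A B"
        using co w(2) by (simp add: changes_only_def)
      have u: "?u i \<le> n" "?u i \<noteq> B"
        using left_less[OF ik(3) Jn] JQ by (auto simp: Q_def left_def l'_def split: if_splits)
      have wn: "w < n" "w \<noteq> A"
        using w(1) JQ Jn by (auto simp: Q_def pred_of_def right_def)
      have c': "cost m' A B (?u i) (?b i k) w = c i k w"
        using co u wn regs(4) by (simp add: cost_def c_def changes_only_def)
      have s': "starts m' A B (?u i) (?b i k) w h = starts m0 A B (?u i) (?b i k) w h" if "h < n" for h
        using co u wn regs(4) that by (simp add: starts_def changes_only_def)
      show ?thesis
      proof (cases "0 < i + k \<and> F m' A B \<le> c i k w")
        case True
        then have *: "keeps m' (lmem try_interval m') A B" using w(3) c' by simp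
        have "D \<noteq> {}" using True D by auto
        then obtain i0 k0 w0 where 0: "(i0, k0) \<in> D" "best i0 k0 w0 m'"
          using I unfolding inv_def by blast
        have old: "\<exists>w. pred_of (?b i' k') w \<and> F m' A B \<le> c i' k' w" if "(i', k') \<in> D" for i' k'
          using I that unfolding inv_def by blast
        show ?thesis unfolding inv_def
        proof (intro conjI impI ballI)
          show "changes_only m0 (lmem try_interval m') A B" by (rule co')
          show "\<exists>(i, k)\<in>insert (i, k) D. \<exists>w. best i k w (lmem try_interval m')"
            by (rule bexI[of _ "(i0, k0)"]) (use 0 * in \<open>auto simp: best_def adopts_def keeps_def\<close>)
          fix x assume "x \<in> insert (i, k) D"
          then show "case x of (i, k) \<Rightarrow> \<exists>w. pred_of (?b i k) w \<and> F (lmem try_interval m') A B \<le> c i k w"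
            using True w(1) * old by (cases x) (auto simp: keeps_def)
        qed
      next
        case False
        then have *: "adopts m0 (lmem try_interval m') A B (?u i) (?b i k) w"
          using w(3) c' s' by (auto simp: adopts_def c_def)
        then have **: "F (lmem try_interval m') A B = c i k w" by (simp add: adopts_def c_def)
        have old: "\<exists>w. pred_of (?b i' k') w \<and> F (lmem try_interval m') A B \<le> c i' k' w" if D': "(i', k') \<in> D" for i' k'
        proof -
          have "0 < i + k" using D D' by auto
          then have "c i k w < F m' A B" using False by auto
          moreover obtain w' where "pred_of (?b i' k') w'" "F m' A B \<le> c i' k' w'"
            using I D' unfolding inv_def by blast
          ultimately show ?thesis using ** by force
        qed
        show ?thesis unfolding inv_def
        proof (intro conjI impI ballI)
          show "changes_only m0 (lmem try_interval m') A B" by (rule co')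
          show "\<exists>(i, k)\<in>insert (i, k) D. \<exists>w. best i k w (lmem try_interval m')"
            by (rule bexI[of _ "(i, k)"]) (use w(1) * in \<open>auto simp: best_def\<close>)
          fix x assume "x \<in> insert (i, k) D"
          then show "case x of (i, k) \<Rightarrow> \<exists>w. pred_of (?b i k) w \<and> F (lmem try_interval m') A B \<le> c i k w"
            using w(1) ** old by (cases x) auto
        qed
      qed
    qed
    define m' where "m' = lmem (For ''i'' num (For ''k'' num try_interval)) m0"
    have "inv ({..<n} \<times> {..<n}) m'"
      unfolding m'_def
    proof (rule nested_For_invariant)
      show "inv {} m0" by (simp add: inv_def changes_only_def)
      show "inv (insert (i, k) ({..<i} \<times> {..<n} \<union> {i} \<times> {..<k})) (lmem try_interval m1)"
        if ik: "i < n" "k < n" "m1 ''i'' 0 = int i" "m1 ''k'' 0 = int k"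
          and fr: "\<And>y. y \<notin> {''i'', ''k''} \<union> writes try_interval \<Longrightarrow> m1 y = m0 y"
          and I: "inv ({..<i} \<times> {..<n} \<union> {i} \<times> {..<k}) m1" for i k m1
        by (rule step[OF fr ik(3,4,1,2) _ _ I]) (use ik in auto)
    qed (simp_all add: n0 inv_store)
    then have co: "changes_only m0 m' A B"
      and ex: "\<exists>(i, k)\<in>{..<n} \<times> {..<n}. \<exists>w. best i k w m'"
      and all: "\<forall>(i, k)\<in>{..<n} \<times> {..<n}. \<exists>w. pred_of (?b i k) w \<and> F m' A B \<le> c i k w"
      using Jn by (simp_all add: inv_def lessThan_empty_iff)
    from ex obtain i0 k0 w0
      where 0: "i0 < n" "k0 < n" "pred_of (?b i0 k0) w0" "F m' A B = c i0 k0 w0"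
        "\<forall>h<n. S m' A B h = starts m0 A B (?u i0) (?b i0 k0) w0 h"
      by (auto simp: best_def adopts_def c_def)
    have m': "lmem solve_state m = m'"
      using J0 n0 Jn by (simp add: solve_state_def m0_def[symmetric] m'_def)
    have "good m' A B" if small: "\<And>A' B'. A' \<le> n \<Longrightarrow> B' \<le> n \<Longrightarrow> card (Q A' B') < card (Q A B) \<Longrightarrow> good m A' B'"
    proof -
      have a: "l (?u i) = min (l i) (l J)" for i by (simp add: left_def)
      have b: "?b i k = max (e k) (max (e J) (l (?u i) + p J))" for i k by (simp add: right_def)
      have L: "solution {j \<in> Q A B. l j < l (?u i)} (F m A (?u i)) (S m A (?u i))" if "i < n" for i
      proof -
        have "Q A (?u i) = {j \<in> Q A B. l j < l (?u i)}" using Q_left[OF JQ that] by (simp add: a)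
        moreover have "card \<dots> < card (Q A B)" by (rule card_subproblem[OF JQ]) (auto simp: a)
        ultimately show ?thesis using small[of A "?u i"] regs(3) left_less[OF that Jn] by (simp add: good_def)
      qed
      have R: "solution {j \<in> Q A B. ?b i k < e j} (F m w B) (S m w B)" if "pred_of (?b i k) w" for i k w
      proof -
        have "Q w B = {j \<in> Q A B. ?b i k < e j}" using Q_right[OF JQ that] by (simp add: right_def)
        moreover have "card \<dots> < card (Q A B)" by (rule card_subproblem[OF JQ]) (auto simp: right_def)
        ultimately show ?thesis using small[of w B] regs(4) that by (simp add: good_def pred_of_def)
      qed
      show ?thesis
        unfolding good_def
      proof (rule solution_step[OF _ JQ longest a b, where fL = "F m A (?u i0)" and fR = "F m w0 B"])
        show "Q A B \<subseteq> {..<n}" by (auto simp: Q_def)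
        show "\<exists>fL sL fR sR. solution {j \<in> Q A B. l j < l (?u i)} fL sL \<and>
            solution {j \<in> Q A B. ?b i k < e j} fR sR \<and> F m' A B \<le> ?b i k - l (?u i) + fL + fR"
          if ik: "i < n" "k < n" for i k
        proof -
          obtain w where "pred_of (?b i k) w" "F m' A B \<le> c i k w" using all ik by auto
          then show ?thesis using L[OF ik(1)] R by (force simp: c_def cost_def FS0)
        qed
        show "F m' A B = ?b i0 k0 - l (?u i0) + F m A (?u i0) + F m w0 B"
          using 0(4) by (simp add: c_def cost_def FS0)
        show "solution {j \<in> Q A B. l j < l (?u i0)} (F m A (?u i0)) (S m A (?u i0))" by (rule L[OF 0(1)])
        show "solution {j \<in> Q A B. ?b i0 k0 < e j} (F m w0 B) (S m w0 B)" by (rule R[OF 0(3)])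
        show "S m' A B j = (if l j < l (?u i0) then S m A (?u i0) j
            else if ?b i0 k0 < e j then S m w0 B j else max (l (?u i0)) (r j))" if "j \<in> Q A B" for j
          using 0(5) that by (simp add: starts_def FS0 Q_def)
      qed
    qed
    moreover have "changes_only m m' A B" using co by (simp add: changes_only_def FS0)
    ultimately show ?thesis unfolding m' by blast
  qed
  then show "changes_only m (lmem solve_state m) A B"
    and "(\<And>A' B'. A' \<le> n \<Longrightarrow> B' \<le> n \<Longrightarrow> card (Q A' B') < card (Q A B) \<Longrightarrow> good m A' B') \<Longrightarrow>
      (Q A B = {} \<Longrightarrow> good m A B) \<Longrightarrow> good (lmem solve_state m) A B" by blast+
qed

lemma dynamic_program:
  assumes t: "tables m" and F0: "\<And>i. m ''F'' i = 0"
  shows "solution {..<n} (F (lmem dynamic_program m) n n) (S (lmem dynamic_program m) n n)"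
proof -
  \<comment> \<open>Describes the middle of a sweep: states with at most \<open>k\<close> jobs are
    right, and those with \<open>k + 1\<close> jobs as soon as they have been visited in this sweep.
    Solving a right state again keeps it right.\<close>
  define solved_upto where "solved_upto k D m' \<longleftrightarrow> (\<forall>A\<le>n. \<forall>B\<le>n. card (Q A B) \<le> k \<or> (A, B) \<in> D \<and> card (Q A B) \<le> Suc k \<longrightarrow> good m' A B)"
    for k D m'
  have solved_upto_store: "solved_upto k D (store m' y i v) \<longleftrightarrow> solved_upto k D m'" if "y \<noteq> ''F''" "y \<noteq> ''S''" for k D m' y i v
  proof -
    have "F (store m' y i v) = F m'" "S (store m' y i v) = S m'"
      using that by (intro ext; simp add: F_def S_def store_apply)+
    then show ?thesis by (simp add: solved_upto_def good_def)
  qed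
  have finQ: "finite (Q A B)" for A B by (simp add: Q_def)
  have step: "solved_upto k (insert (A, B) D) (lmem solve_state m')"
    if t': "tables m'" and ab: "m' ''a'' 0 = int A" "m' ''b'' 0 = int B" "A \<le> n" "B \<le> n" and d: "solved_upto k D m'" for k D m' A B
    unfolding solved_upto_def
  proof (intro allI impI)
    fix A' B' assume le: "A' \<le> n" "B' \<le> n"
      and c: "card (Q A' B') \<le> k \<or> (A', B') \<in> insert (A, B) D \<and> card (Q A' B') \<le> Suc k"
    show "good (lmem solve_state m') A' B'"
    proof (cases "(A', B') = (A, B)")
      case False
      then have "good m' A' B'" using c le d unfolding solved_upto_def by blast
      then show ?thesis using good_changes_only[OF solve_state(1)[OF t' ab] le(2) False] by simp
    next
      case True
      then have "card (Q A B) \<le> Suc k" using c by auto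
      have "good (lmem solve_state m') A B"
      proof (rule solve_state(2)[OF t' ab])
        show "good m' A'' B''" if "A'' \<le> n" "B'' \<le> n" "card (Q A'' B'') < card (Q A B)" for A'' B''
          using d that \<open>card (Q A B) \<le> Suc k\<close> unfolding solved_upto_def by auto
        show "good m' A B" if "Q A B = {}"
          using d that ab(3,4) unfolding solved_upto_def by simp
      qed
      then show ?thesis using True by simp
    qed
  qed
  have n: "m ''in'' 0 = int n" using t by (simp add: tables_def)
  have "solved_upto n {} (lmem dynamic_program m)"
    unfolding dynamic_program_def
  proof (rule For_invariant[where I = "\<lambda>k. solved_upto k {}"])
    show "nat (aval num m) = n" by (simp add: n)
    \<comment> \<open>Only states without jobs are claimed here; they need the value 0, which
      \<open>F0\<close> provides.\<close>
    show "solved_upto 0 {} m" unfolding solved_upto_def good_def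
    proof (intro allI impI)
      fix A B assume "card (Q A B) \<le> 0 \<or> (A, B) \<in> {} \<and> card (Q A B) \<le> Suc 0"
      then have "Q A B = {}" using finQ by simp
      then show "solution (Q A B) (F m A B) (S m A B)" using solution_empty F0 by (simp add: F_def)
    qed
    show "solved_upto k {} (store m' ''t'' 0 v)" if "solved_upto k {} m'" for k m' v using that by (simp add: solved_upto_store)
  next
    let ?rows = "For ''a'' (Plus num (N 1)) (For ''b'' (Plus num (N 1)) solve_state)"
    fix k m1 assume fr1: "\<And>y. y \<notin> insert ''t'' (writes ?rows) \<Longrightarrow> m1 y = m y" and d1: "solved_upto k {} m1"
    have "solved_upto k ({..<Suc n} \<times> {..<Suc n}) (lmem ?rows m1)"
    proof (rule nested_For_invariant)
      show "solved_upto k {} m1" by (rule d1)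
      show "nat (aval (Plus num (N 1)) m1) = Suc n" using fr1 by (simp add: n)
      show "solved_upto k (insert (A, B) ({..<A} \<times> {..<Suc n} \<union> {A} \<times> {..<B})) (lmem solve_state m2)"
        if AB: "A < Suc n" "B < Suc n" "m2 ''a'' 0 = int A" "m2 ''b'' 0 = int B"
          and fr2: "\<And>y. y \<notin> {''a'', ''b''} \<union> writes solve_state \<Longrightarrow> m2 y = m1 y"
          and d2: "solved_upto k ({..<A} \<times> {..<Suc n} \<union> {A} \<times> {..<B}) m2" for A B m2
      proof (rule step[OF _ AB(3,4) _ _ d2])
        show "tables m2"
        proof (rule tables_frame[OF t])
          fix y assume "y \<in> {''in'', ''e'', ''l'', ''p'', ''r''}"
          then show "m2 y = m y" using fr1[of y] fr2[of y] by auto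
        qed
      qed (use AB in auto)
    qed (simp_all add: solved_upto_store)
    then show "solved_upto (Suc k) {} (lmem ?rows m1)" unfolding solved_upto_def by auto
  qed
  moreover have "Q n n = {..<n}" using e_nonneg l_less_big unfolding Q_def by force
  ultimately show ?thesis unfolding solved_upto_def good_def by fastforce
qed

end

section \<open>Bellman-Ford\<close>

text \<open>The array \<open>X\<close> is addressed by the time points themselves, so equal release
  dates and deadlines share one cell and duplicates need no treatment. Only the bit length of an
  address is charged, so large times do no harm.\<close>

definition relax :: "aexp \<Rightarrow> aexp \<Rightarrow> aexp \<Rightarrow> lcom" where
  "relax s t w = LWhen (Less (Cell ''X'' t) (Plus (Cell ''X'' s) w)) (Assign ''X'' t (Plus (Cell ''X'' s) w))"

definition relax_pair :: lcom where
  "relax_pair = LWhen (BNot (Less (Cell ''T'' (V ''v'')) (Cell ''T'' (V ''u''))))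
     (relax (Cell ''T'' (V ''u'')) (Cell ''T'' (V ''v'')) (N 0) ;;
      relax (Cell ''T'' (V ''v'')) (Cell ''T'' (V ''u'')) (Minus (Cell ''T'' (V ''u'')) (Cell ''T'' (V ''v''))))"

definition relax_job :: lcom where
  "relax_job = LWhen (Less (N 0) (Cell ''q'' (V ''j'')))
     (relax (Cell ''T'' (V ''j'')) (Cell ''T'' (Plus (V ''j'') num)) (Cell ''q'' (V ''j'')))"

definition sweep :: lcom where
  "sweep = For ''u'' (Plus num num) (For ''v'' (Plus num num) relax_pair) ;; For ''j'' num relax_job"

definition bellman_ford :: lcom where
  "bellman_ford = For ''t'' (Plus num num) sweep"

lemma writes_bf [simp]:
  "writes (relax s t w) = {''X''}"
  "writes relax_pair = {''X''}"
  "writes relax_job = {''X''}"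
  "writes sweep = {''u'', ''v'', ''j'', ''X''}"
  "writes bellman_ford = {''t'', ''u'', ''v'', ''j'', ''X''}"
  unfolding relax_def relax_pair_def relax_job_def sweep_def bellman_ford_def by auto

lemma lmem_relax:
  "lmem (relax s t w) m ''X'' =
     (m ''X'')(aval t m := max (m ''X'' (aval t m)) (m ''X'' (aval s m) + aval w m))"
  by (auto simp: relax_def store_def)

section \<open>Correctness of Bellman-Ford\<close>

locale bf =
  fixes n :: nat and T q :: "nat \<Rightarrow> int"
begin

definition P :: "int set" where "P = T ` {..<n + n}"
definition K :: "(int \<times> int \<times> int) set" where "K = (\<lambda>j. (T j, T (j + n), q j)) ` {j. j < n \<and> 0 < q j}"

definition tables :: "memory \<Rightarrow> bool" where
  "tables m \<longleftrightarrow> m ''in'' 0 = int n \<and> (\<forall>i<n + n. m ''T'' (int i) = T i) \<and> (\<forall>j<n. m ''q'' (int j) = q j)"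

lemma tables_frame:
  assumes "tables m" "\<And>y. y \<in> {''in'', ''T'', ''q''} \<Longrightarrow> m' y = m y"
  shows "tables m'"
  using assms unfolding tables_def by simp

lemma finite_P: "finite P" and finite_K: "finite K"
  by (simp_all add: P_def K_def)

lemma K_P: "(s, t, w) \<in> K \<Longrightarrow> s \<in> P \<and> t \<in> P"
  by (auto simp: K_def P_def)

lemma constraints_P: "(s, t, w) \<in> constraints P K \<Longrightarrow> s \<in> P \<and> t \<in> P"
  using K_P unfolding constraints_def by auto

definition below_solutions :: "(int \<Rightarrow> int) \<Rightarrow> bool" where
  "below_solutions X \<longleftrightarrow> (\<forall>Y. satisfies (constraints P K) Y \<longrightarrow> (\<forall>v\<in>P. 0 \<le> Y v) \<longrightarrow>
     (\<forall>v\<in>P. real_of_int (X v) \<le> Y v))"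

text \<open>Compares the memory during a sweep with its state \<open>m\<close> at the start. Updates
  are made in place and may already use new values, so only the inequality against the old
  \<open>m ''X'' s\<close> is recorded; \<open>relaxation_converges\<close> asks no more of a
  round.\<close>

definition relaxed :: "memory \<Rightarrow> (int \<times> int \<times> int) set \<Rightarrow> memory \<Rightarrow> bool" where
  "relaxed m D m' \<longleftrightarrow> (\<forall>v. m ''X'' v \<le> m' ''X'' v) \<and>
     (below_solutions (m ''X'') \<longrightarrow> below_solutions (m' ''X'')) \<and>
     (\<forall>(s, t, w)\<in>D. m ''X'' s + w \<le> m' ''X'' t)"

lemma relaxed_store: "y \<noteq> ''X'' \<Longrightarrow> relaxed m D (store m' y i v) \<longleftrightarrow> relaxed m D m'"
  by (simp add: relaxed_def store_other)

lemma relax_step: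
  assumes I: "relaxed m D m'" and c: "(aval s m', aval t m', aval w m') \<in> constraints P K"
  shows "relaxed m (insert (aval s m', aval t m', aval w m') D) (lmem (relax s t w) m')"
proof -
  let ?s = "aval s m'" and ?t = "aval t m'" and ?w = "aval w m'" and ?X = "m' ''X''"
  let ?X' = "lmem (relax s t w) m' ''X''"
  have X': "?X' = ?X(?t := max (?X ?t) (?X ?s + ?w))" by (rule lmem_relax)
  have le: "?X v \<le> ?X' v" for v by (simp add: X')
  have "below_solutions ?X'" if b: "below_solutions ?X"
    unfolding below_solutions_def
  proof (intro allI impI ballI)
    fix Y v assume Y: "satisfies (constraints P K) Y" "\<forall>v\<in>P. 0 \<le> Y v" and v: "v \<in> P"
    have X: "real_of_int (?X v) \<le> Y v" if "v \<in> P" for v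
      using b Y that unfolding below_solutions_def by blast
    have "Y ?s + real_of_int ?w \<le> Y ?t" using Y(1) c unfolding satisfies_def by auto
    moreover have "real_of_int (?X ?s) \<le> Y ?s" using X constraints_P[OF c] by blast
    ultimately have "real_of_int (?X ?s + ?w) \<le> Y ?t" by simp
    then show "real_of_int (?X' v) \<le> Y v" using X[OF v] by (auto simp: X' max_def)
  qed
  moreover have "m ''X'' ?s + ?w \<le> ?X' ?t"
  proof -
    have "m ''X'' ?s \<le> ?X ?s" using I by (simp add: relaxed_def)
    then show ?thesis by (simp add: X')
  qed
  moreover have "m ''X'' s' + w' \<le> ?X' t'" if "(s', t', w') \<in> D" for s' t' w'
  proof -
    have "m ''X'' s' + w' \<le> ?X t'" using I that unfolding relaxed_def by auto
    then show ?thesis using le[of t'] by linarith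
  qed
  moreover have "m ''X'' v \<le> ?X' v" for v
    using I le[of v] unfolding relaxed_def by (meson order_trans)
  ultimately show ?thesis using I unfolding relaxed_def by auto
qed

definition pairs :: "nat \<Rightarrow> nat \<Rightarrow> (int \<times> int \<times> int) set" where
  "pairs u v = (if T u \<le> T v then {(T u, T v, 0), (T v, T u, T u - T v)} else {})"

definition jobs_upto :: "nat \<Rightarrow> (int \<times> int \<times> int) set" where
  "jobs_upto k = (\<lambda>j. (T j, T (j + n), q j)) ` {j. j < k \<and> 0 < q j}"

lemma relax_pair:
  assumes t: "tables m'" and uv: "m' ''u'' 0 = int u" "m' ''v'' 0 = int v" "u < n + n" "v < n + n"
    and I: "relaxed m D m'"
  shows "relaxed m (D \<union> pairs u v) (lmem relax_pair m')"
proof -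
  let ?u = "Cell ''T'' (V ''u'')" and ?v = "Cell ''T'' (V ''v'')"
  let ?r1 = "relax ?u ?v (N 0)"
  have T: "m' ''T'' (int u) = T u" "m' ''T'' (int v) = T v" using t uv by (auto simp: tables_def)
  show ?thesis
  proof (cases "T u \<le> T v")
    case False
    then show ?thesis using I uv T by (simp add: relax_pair_def pairs_def)
  next
    case True
    have c: "(T u, T v, 0) \<in> constraints P K" "(T v, T u, T u - T v) \<in> constraints P K"
      using True uv by (auto simp: constraints_def P_def)
    have 1: "relaxed m (insert (T u, T v, 0) D) (lmem ?r1 m')"
      using relax_step[OF I, of ?u ?v "N 0"] c uv T by simp
    have fr: "lmem ?r1 m' y = m' y" if "y \<noteq> ''X''" for y using that by (simp add: lmem_frame)
    have "relaxed m (insert (T v, T u, T u - T v) (insert (T u, T v, 0) D)) (lmem (relax ?v ?u (Minus ?u ?v)) (lmem ?r1 m'))"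
      using relax_step[OF 1, of ?v ?u "Minus ?u ?v"] c uv T by (simp add: fr)
    moreover have "D \<union> pairs u v = insert (T v, T u, T u - T v) (insert (T u, T v, 0) D)"
      using True by (auto simp: pairs_def)
    ultimately show ?thesis using True uv T by (simp add: relax_pair_def)
  qed
qed

lemma relax_job:
  assumes t: "tables m'" and j: "m' ''j'' 0 = int j" "j < n" and I: "relaxed m (D \<union> jobs_upto j) m'"
  shows "relaxed m (D \<union> jobs_upto (Suc j)) (lmem relax_job m')"
proof -
  have T: "m' ''T'' (int j) = T j" "m' ''T'' (int j + int n) = T (j + n)" "m' ''q'' (int j) = q j" "m' ''in'' 0 = int n"
    using t j by (auto simp: tables_def simp flip: of_nat_add)
  have S: "jobs_upto (Suc j) = (if 0 < q j then insert (T j, T (j + n), q j) (jobs_upto j) else jobs_upto j)"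
    by (auto simp: jobs_upto_def less_Suc_eq)
  show ?thesis
  proof (cases "0 < q j")
    case False
    then show ?thesis using I j T by (simp add: relax_job_def S)
  next
    case True
    have c: "(T j, T (j + n), q j) \<in> constraints P K"
      using True j by (auto simp: constraints_def K_def)
    show ?thesis
      using relax_step[OF I, of "Cell ''T'' (V ''j'')" "Cell ''T'' (Plus (V ''j'') num)" "Cell ''q'' (V ''j'')"]
        c True j T by (simp add: relax_job_def S)
  qed
qed

lemma sweep:
  assumes t: "tables m"
  shows "relaxed m (constraints P K) (lmem sweep m)"
proof -
  define D where "D A = (\<Union>(u, v)\<in>A. pairs u v)" for A
  let ?c1 = "For ''u'' (Plus num num) (For ''v'' (Plus num num) relax_pair)"
  let ?D = "D ({..<n + n} \<times> {..<n + n})"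
  have N: "m ''in'' 0 = int n" using t by (simp add: tables_def)
  have 1: "relaxed m ?D (lmem ?c1 m)"
  proof (rule nested_For_invariant)
    show "relaxed m (D {}) m" by (simp add: relaxed_def D_def)
    show "nat (aval (Plus num num) m) = n + n" by (simp add: N nat_add_distrib)
    show "relaxed m (D (insert (u, v) ({..<u} \<times> {..<n + n} \<union> {u} \<times> {..<v}))) (lmem relax_pair m1)"
      if uv: "u < n + n" "v < n + n" "m1 ''u'' 0 = int u" "m1 ''v'' 0 = int v"
        and fr: "\<And>y. y \<notin> {''u'', ''v''} \<union> writes relax_pair \<Longrightarrow> m1 y = m y"
        and I: "relaxed m (D ({..<u} \<times> {..<n + n} \<union> {u} \<times> {..<v})) m1" for u v m1
    proof -
      have "tables m1" by (rule tables_frame[OF t], rule fr) auto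
      from relax_pair[OF this uv(3,4,1,2) I] show ?thesis by (simp add: D_def Un_commute)
    qed
  qed (simp_all add: relaxed_store)
  have fr: "lmem ?c1 m y = m y" if "y \<notin> {''u'', ''v'', ''X''}" for y
    by (rule lmem_frame) (use that in simp)
  have "relaxed m (?D \<union> jobs_upto n) (lmem (For ''j'' num relax_job) (lmem ?c1 m))"
  proof (rule For_invariant[where I = "\<lambda>k. relaxed m (?D \<union> jobs_upto k)"])
    show "nat (aval num (lmem ?c1 m)) = n" by (simp add: N fr)
    show "relaxed m (?D \<union> jobs_upto 0) (lmem ?c1 m)" using 1 by (simp add: jobs_upto_def)
    show "relaxed m (?D \<union> jobs_upto k) (store m' ''j'' 0 v)" if "relaxed m (?D \<union> jobs_upto k) m'" for k m' v
      using that by (simp add: relaxed_store)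
  next
    fix j m3 assume j: "j < n" and fr3: "\<And>y. y \<notin> insert ''j'' (writes relax_job) \<Longrightarrow> m3 y = lmem ?c1 m y"
      and j3: "m3 ''j'' 0 = int j" and I3: "relaxed m (?D \<union> jobs_upto j) m3"
    have t3: "tables m3"
    proof (rule tables_frame[OF t])
      fix y assume "y \<in> {''in'', ''T'', ''q''}"
      then show "m3 y = m y" using fr[of y] fr3[of y] by auto
    qed
    show "relaxed m (?D \<union> jobs_upto (Suc j)) (lmem relax_job m3)"
      by (rule relax_job[OF t3 j3 j I3])
  qed
  moreover have "constraints P K \<subseteq> ?D \<union> jobs_upto n"
  proof -
    have "(s, t, 0) \<in> ?D \<and> (t, s, s - t) \<in> ?D" if st: "s \<in> P" "t \<in> P" "s \<le> t" for s t
    proof -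
      obtain u v where "u < n + n" "v < n + n" "s = T u" "t = T v" using st by (auto simp: P_def)
      then have "(s, t, 0) \<in> pairs u v" "(t, s, s - t) \<in> pairs u v" using st by (auto simp: pairs_def)
      then show ?thesis using \<open>u < n + n\<close> \<open>v < n + n\<close> unfolding D_def by fast
    qed
    moreover have "K = jobs_upto n" by (simp add: K_def jobs_upto_def)
    ultimately show ?thesis unfolding constraints_def by blast
  qed
  ultimately show ?thesis unfolding relaxed_def sweep_def lmem.simps by blast
qed

text \<open>The solution \<open>Y0\<close>, in use taken from a feasible schedule, rules out
  constraint cycles of positive weight. The \<open>n + n\<close> rounds are enough because there are
  at most that many distinct points.\<close>

lemma bellman_ford:
  assumes t: "tables m" and X0: "\<And>v. m ''X'' v = 0"
    and Y0: "satisfies (constraints P K) Y0" "\<And>v. v \<in> P \<Longrightarrow> 0 \<le> Y0 v"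
  defines "X \<equiv> lmem bellman_ford m ''X''"
  shows "satisfies (constraints P K) (\<lambda>v. real_of_int (X v))"
    and "\<And>v. 0 \<le> X v"
    and "\<And>(Y :: int \<Rightarrow> real) v. satisfies (constraints P K) Y \<Longrightarrow> (\<And>v. v \<in> P \<Longrightarrow> 0 \<le> Y v) \<Longrightarrow> v \<in> P \<Longrightarrow> X v \<le> Y v"
proof -
  define Xs where "Xs k = loop_state ''t'' sweep m k ''X''" for k
  have fr: "loop_state ''t'' sweep m k y = m y" if "y \<in> {''in'', ''T'', ''q''}" for k y
    by (rule loop_state_frame) (use that in auto)
  have step: "relaxed (store (loop_state ''t'' sweep m k) ''t'' 0 (int k)) (constraints P K) (loop_state ''t'' sweep m (Suc k))" for k
  proof -
    have "tables (store (loop_state ''t'' sweep m k) ''t'' 0 (int k))"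
      by (rule tables_frame[OF t]) (use fr in \<open>auto simp: store_other\<close>)
    from sweep[OF this] show ?thesis by simp
  qed
  have mono: "Xs k v \<le> Xs (Suc k) v"
    and bnd: "below_solutions (Xs k) \<Longrightarrow> below_solutions (Xs (Suc k))"
    and edge: "(s, t, w) \<in> constraints P K \<Longrightarrow> Xs k s + w \<le> Xs (Suc k) t" for k v s t w
    using step[of k] unfolding relaxed_def Xs_def by (auto simp: store_other)
  have bounded: "below_solutions (Xs k)" for k
  proof (induction k)
    case 0
    then show ?case using X0 by (simp add: below_solutions_def Xs_def)
  qed (rule bnd)
  have below: "Xs k v \<le> Y v" if "satisfies (constraints P K) Y" "\<And>v. v \<in> P \<Longrightarrow> 0 \<le> Y v" "v \<in> P" for Y :: "int \<Rightarrow> real" and k v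
    using bounded[of k, unfolded below_solutions_def, rule_format, OF that(1) _ that(3)] that(2) by simp
  have nonneg: "0 \<le> Xs k v" for k v
  proof (induction k)
    case 0
    then show ?case using X0 by (simp add: Xs_def)
  next
    case (Suc k)
    then show ?case using mono[of k v] by linarith
  qed
  have X: "X = Xs (n + n)"
  proof -
    have "nat (aval (Plus num num) m) = n + n" using t by (simp add: tables_def nat_add_distrib)
    then show ?thesis
      by (simp add: X_def bellman_ford_def lmem.simps(6) store_other Xs_def del: aval.simps)
  qed
  have card: "card P \<le> n + n" unfolding P_def using card_image_le[of "{..<n + n}" T] by simp
  show "satisfies (constraints P K) (\<lambda>v. real_of_int (X v))"
    unfolding X
  proof (rule relaxation_converges[where X = Xs and V = P and E = "constraints P K"])
    show "constraints P K \<subseteq> P \<times> P \<times> UNIV" using constraints_P by auto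
    show "finite (constraints P K)" by (rule constraints_finite[OF finite_P finite_K])
    show "0 \<le> Xs k v" for k v by (rule nonneg)
    show "Xs k v \<le> Xs (Suc k) v" for k v by (rule mono)
    show "Xs k s + w \<le> Xs (Suc k) t" if "(s, t, w) \<in> constraints P K" for k s t w by (rule edge[OF that])
    show "real_of_int (Xs k v) \<le> Y v" if "satisfies (constraints P K) Y" "\<And>v. v \<in> P \<Longrightarrow> 0 \<le> Y v" "v \<in> P"
      for Y :: "int \<Rightarrow> real" and k v by (rule below[OF that])
  qed (fact finite_P card Y0)+
  show "0 \<le> X v" for v unfolding X by (rule nonneg)
  show "X v \<le> Y v" if "satisfies (constraints P K) Y" "\<And>v. v \<in> P \<Longrightarrow> 0 \<le> Y v" "v \<in> P" for Y :: "int \<Rightarrow> real" and v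
    unfolding X by (rule below[OF that])
qed

end

section \<open>The algorithm\<close>

text \<open>Follows \<open>encode_network\<close>: three header cells, then six per edge, so fields
  2 to 5 are processing time, release date, deadline and preemption flag.\<close>

definition in_entry :: "int \<Rightarrow> aexp \<Rightarrow> aexp" where
  "in_entry c j = Cell ''in'' (Plus (N (3 + c)) (Times (N 6) j))"

definition load_job :: lcom where
  "load_job =
     LIf (Less (in_entry 5 (V ''j'')) (N 1))
       (Assign ''r'' (V ''j'') (in_entry 3 (V ''j'')) ;;
        Assign ''p'' (V ''j'') (in_entry 2 (V ''j'')) ;;
        Assign ''d'' (V ''j'') (in_entry 4 (V ''j'')) ;;
        Assign ''q'' (V ''j'') (N 0))
       (Assign ''r'' (V ''j'') (N 0) ;;
        Assign ''p'' (V ''j'') (N 0) ;;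
        Assign ''d'' (V ''j'') (N 0) ;;
        Assign ''q'' (V ''j'') (in_entry 2 (V ''j''))) ;;
     Assign ''e'' (V ''j'') (Plus (Cell ''r'' (V ''j'')) (Cell ''p'' (V ''j''))) ;;
     Assign ''l'' (V ''j'') (Minus (Cell ''d'' (V ''j'')) (Cell ''p'' (V ''j''))) ;;
     Assign ''T'' (V ''j'') (in_entry 3 (V ''j'')) ;;
     Assign ''T'' (Plus (V ''j'') num) (in_entry 4 (V ''j'')) ;;
     Assign ''B'' (N 0) (Plus (V ''B'') (Cell ''d'' (V ''j'')))"

text \<open>Sentinels go to index \<open>n\<close>. The sum \<open>B\<close> of the deadlines of
  non-preemptive jobs is an upper bound for all latest start times; adding 1 makes it
  strict.\<close>

definition load_input :: lcom where
  "load_input = For ''j'' num load_job ;;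
     Assign ''e'' num (N (- 1)) ;; Assign ''p'' num (N (- 1)) ;;
     Assign ''l'' num (Plus (V ''B'') (N 1))"

text \<open>
  The piece starting at point \<open>T[u]\<close> ends when the next point is reached or \<open>X\<close> would exceed the value at
  which the job is complete; as \<open>X\<close> is monotone, its value at the next point is a minimum.
\<close>

definition lower_next :: lcom where
  "lower_next = LWhen (BAnd (Less (Cell ''T'' (V ''u'')) (Cell ''T'' (V ''v'')))
       (Less (Cell ''X'' (Cell ''T'' (V ''v''))) (V ''y'')))
     (Assign ''y'' (N 0) (Cell ''X'' (Cell ''T'' (V ''v''))))"

definition truncate_piece :: lcom where
  "truncate_piece =
     Assign ''z'' (N 0) (Plus (Cell ''X'' (Cell ''T'' (V ''j''))) (Cell ''q'' (V ''j''))) ;;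
     LWhen (Less (V ''z'') (V ''y'')) (Assign ''y'' (N 0) (V ''z'')) ;;
     Assign ''x'' (N 0) (Cell ''X'' (Cell ''T'' (V ''u''))) ;;
     LWhen (Less (V ''z'') (V ''x'')) (Assign ''x'' (N 0) (V ''z''))"

definition measure_piece :: lcom where
  "measure_piece = Assign ''y'' (N 0) (Cell ''X'' (Cell ''T'' (Plus (V ''j'') num))) ;;
     For ''v'' (Plus num num) lower_next ;; truncate_piece"

definition in_window :: bexp where
  "in_window = BAnd (BNot (Less (Cell ''T'' (V ''u'')) (Cell ''T'' (V ''j''))))
     (Less (Cell ''T'' (V ''u'')) (Cell ''T'' (Plus (V ''j'') num)))"

definition output_piece :: lcom where
  "output_piece = LWhen in_window
     (measure_piece ;; Out (V ''j'') ;; Out (Cell ''T'' (V ''u'')) ;;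
      Out (Plus (Cell ''T'' (V ''u'')) (Minus (V ''y'') (V ''x''))))"

definition output_preemptive :: lcom where
  "output_preemptive = For ''u'' (Plus num num) output_piece"

definition output_nonpreemptive :: lcom where
  "output_nonpreemptive = Out (V ''j'') ;;
     Out (Cell ''S'' (entry (entry num num) (V ''j''))) ;;
     Out (Plus (Cell ''S'' (entry (entry num num) (V ''j''))) (Cell ''p'' (V ''j'')))"

text \<open>The leading 1 is the common denominator: both parts of the schedule have integer end
  points. Preemptive jobs of length 0 get no interval, the empty set being feasible for
  them.\<close>

definition output_schedule :: lcom where
  "output_schedule = Out (N 1) ;;
     For ''j'' num (LIf (Less (in_entry 5 (V ''j'')) (N 1)) output_nonpreemptive
       (LWhen (Less (N 0) (Cell ''q'' (V ''j''))) output_preemptive))"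

definition algorithm :: lcom where
  "algorithm = load_input ;; bellman_ford ;; dynamic_program ;; output_schedule"

lemma writes_algorithm [simp]:
  "writes load_job = {''r'', ''p'', ''d'', ''q'', ''e'', ''l'', ''T'', ''B''}"
  "writes lower_next = {''y''}"
  "writes truncate_piece = {''y'', ''z'', ''x''}"
  "writes measure_piece = {''y'', ''v'', ''z'', ''x''}"
  "writes output_piece = {''y'', ''v'', ''z'', ''x''}"
  "writes output_preemptive = {''u'', ''y'', ''v'', ''z'', ''x''}"
  "writes output_nonpreemptive = {}"
  "writes output_schedule = {''j'', ''u'', ''y'', ''v'', ''z'', ''x''}"
  "writes load_input = {''j'', ''r'', ''p'', ''d'', ''q'', ''e'', ''l'', ''T'', ''B''}"
  unfolding load_job_def load_input_def lower_next_def truncate_piece_def measure_piece_def output_piece_def output_preemptive_def output_nonpreemptive_def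
    output_schedule_def by auto

lemmas program_defs = algorithm_def load_input_def load_job_def output_schedule_def output_nonpreemptive_def
  output_preemptive_def in_window_def output_piece_def measure_piece_def truncate_piece_def lower_next_def bellman_ford_def sweep_def relax_job_def relax_pair_def relax_def
  dynamic_program_def solve_state_def try_interval_def combine_starts_def find_pred_def pick_interval_def
  find_longest_def update_longest_def update_pred_def combine_start_def entry_def start_addr_def in_entry_def

lemma well_formed_algorithm: "well_formed algorithm"
  by (simp add: program_defs)

lemma in_not_written: "''in'' \<notin> writes algorithm"
  by (simp add: algorithm_def)

lemma loop_bounds_algorithm: "loop_bounds algorithm \<subseteq> {num, Plus num (N 1), Plus num num}"
  by (auto simp: program_defs)

section \<open>Reading the encoded input and writing the schedule\<close>

lemma length_encode_edge: "length (encode_edge x) = 6"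
  by (simp add: encode_edge_def)

lemma length_edge_codes: "length (concat (map encode_edge es)) = 6 * length es"
  by (induction es) (auto simp: length_encode_edge)

lemma nth_edge_codes:
  "j < length es \<Longrightarrow> c < 6 \<Longrightarrow> concat (map encode_edge es) ! (6 * j + c) = encode_edge (es ! j) ! c"
proof (induction es arbitrary: j)
  case (Cons x es)
  show ?case
  proof (cases j)
    case 0
    then show ?thesis using Cons.prems by (simp add: nth_append length_encode_edge)
  next
    case (Suc i)
    then show ?thesis using Cons by (simp add: nth_append length_encode_edge)
  qed
qed simp

lemma length_encode_network: "length (encode_network G) = 3 + 6 * length (edges G)"
  by (simp add: encode_network_def length_edge_codes)

lemma initial_num: "initial_memory (encode_network G) ''in'' 0 = int (length (edges G))"
  using length_encode_network[of G] by (simp add: initial_memory_def encode_network_def)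

lemma initial_entry:
  assumes "j < length (edges G)" "c < 6"
  shows "initial_memory (encode_network G) ''in'' (3 + int c + 6 * int j) = encode_edge (edges G ! j) ! c"
proof -
  let ?k = "3 + (6 * j + c)"
  have "?k < length (encode_network G)" using assms by (simp add: length_encode_network)
  moreover have "3 + int c + 6 * int j = int ?k" by simp
  ultimately have "initial_memory (encode_network G) ''in'' (3 + int c + 6 * int j) = encode_network G ! ?k"
    unfolding initial_memory_def by (simp only: of_nat_less_iff nat_int) simp
  also have "\<dots> = concat (map encode_edge (edges G)) ! (6 * j + c)" by (simp add: encode_network_def)
  also have "\<dots> = encode_edge (edges G ! j) ! c" by (rule nth_edge_codes[OF assms])
  finally show ?thesis .
qed

definition time_point :: "network \<Rightarrow> nat \<Rightarrow> int" where
  "time_point G i = (if i < length (edges G) then int (release (edges G ! i))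
     else int (deadline (edges G ! (i - length (edges G)))))"

definition pre_length :: "network \<Rightarrow> nat \<Rightarrow> int" where
  "pre_length G j = (if preemptive (edges G ! j) then int (proc (edges G ! j)) else 0)"

lemma points_eq: "bf.P (length (edges G)) (time_point G) = points G"
proof -
  let ?n = "length (edges G)"
  have split: "{..<?n + ?n} = {..<?n} \<union> (\<lambda>j. j + ?n) ` {..<?n}"
  proof (intro set_eqI iffI)
    fix i assume i: "i \<in> {..<?n + ?n}"
    show "i \<in> {..<?n} \<union> (\<lambda>j. j + ?n) ` {..<?n}"
    proof (cases "i < ?n")
      case False
      then have "i = (i - ?n) + ?n" "i - ?n \<in> {..<?n}" using i by auto
      then show ?thesis by blast
    qed simp
  qed auto
  show ?thesis
    unfolding bf.P_def points_def split image_Un image_image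
    by (intro arg_cong2[of _ _ _ _ "(\<union>)"] image_cong) (simp_all add: time_point_def)
qed

lemma pre_jobs_eq: "bf.K (length (edges G)) (time_point G) (pre_length G) = pre_jobs G"
  unfolding bf.K_def pre_jobs_def
  by (rule image_cong) (auto simp: time_point_def pre_length_def split: if_splits)

lemma in_entries:
  assumes "m ''in'' = initial_memory (encode_network G) ''in''" "m ''j'' 0 = int j" "j < length (edges G)"
  shows "aval (in_entry 2 (V ''j'')) m = int (proc (edges G ! j))"
    "aval (in_entry 3 (V ''j'')) m = int (release (edges G ! j))"
    "aval (in_entry 4 (V ''j'')) m = int (deadline (edges G ! j))"
    "aval (in_entry 5 (V ''j'')) m < 1 \<longleftrightarrow> \<not> preemptive (edges G ! j)"
  using initial_entry[OF assms(3), of 2] initial_entry[OF assms(3), of 3] initial_entry[OF assms(3), of 4]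
    initial_entry[OF assms(3), of 5] assms(1,2)
  by (simp_all add: in_entry_def encode_edge_def)

definition prepared :: "network \<Rightarrow> nat \<Rightarrow> memory \<Rightarrow> bool" where
  "prepared G k m \<longleftrightarrow> (\<forall>j<k. m ''r'' (int j) = nonpre G release j \<and> m ''p'' (int j) = nonpre G proc j \<and>
     m ''e'' (int j) = nonpre G release j + nonpre G proc j \<and>
     m ''l'' (int j) = nonpre G deadline j - nonpre G proc j \<and>
     m ''q'' (int j) = pre_length G j \<and> m ''T'' (int j) = int (release (edges G ! j)) \<and>
     m ''T'' (int j + int (length (edges G))) = int (deadline (edges G ! j))) \<and>
     m ''B'' 0 = (\<Sum>j<k. nonpre G deadline j)"

lemma load_job:
  assumes "m ''in'' = initial_memory (encode_network G) ''in''" "m ''j'' 0 = int k" "k < length (edges G)" "prepared G k m"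
  shows "prepared G (Suc k) (lmem load_job m)"
proof -
  let ?n = "length (edges G)"
  have n: "m ''in'' 0 = int ?n" using assms(1) by (simp add: initial_num)
  have ents: "m' ''in'' = m ''in'' \<Longrightarrow> m' ''j'' = m ''j'' \<Longrightarrow>
      aval (in_entry 2 (V ''j'')) m' = int (proc (edges G ! k)) \<and>
      aval (in_entry 3 (V ''j'')) m' = int (release (edges G ! k)) \<and>
      aval (in_entry 4 (V ''j'')) m' = int (deadline (edges G ! k)) \<and>
      (aval (in_entry 5 (V ''j'')) m' < 1 \<longleftrightarrow> \<not> preemptive (edges G ! k))" for m'
    using in_entries[of m' G k] assms by simp
  have q: "lmem load_job m ''r'' = (m ''r'')(int k := nonpre G release k)"
    "lmem load_job m ''p'' = (m ''p'')(int k := nonpre G proc k)"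
    "lmem load_job m ''e'' = (m ''e'')(int k := nonpre G release k + nonpre G proc k)"
    "lmem load_job m ''l'' = (m ''l'')(int k := nonpre G deadline k - nonpre G proc k)"
    "lmem load_job m ''q'' = (m ''q'')(int k := pre_length G k)"
    "lmem load_job m ''T'' = (m ''T'')(int k := int (release (edges G ! k)), int k + int ?n := int (deadline (edges G ! k)))"
    "lmem load_job m ''B'' 0 = m ''B'' 0 + nonpre G deadline k"
    unfolding load_job_def using assms(2) n ents
    by (cases "preemptive (edges G ! k)"; simp add: store_def nonpre_def pre_length_def fun_eq_iff)+
  show ?thesis
    using assms(3,4) unfolding prepared_def q by (auto simp: less_Suc_eq)
qed

lemma load_input:
  fixes G
  defines "m \<equiv> lmem load_input (initial_memory (encode_network G))"
  shows "prepared G (length (edges G)) m"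
    and "m ''e'' (int (length (edges G))) = - 1" "m ''p'' (int (length (edges G))) = - 1"
    and "m ''l'' (int (length (edges G))) = (\<Sum>j<length (edges G). nonpre G deadline j) + 1"
proof -
  let ?n = "length (edges G)" and ?m0 = "initial_memory (encode_network G)"
  define m1 where "m1 = lmem (For ''j'' num load_job) ?m0"
  have "prepared G ?n m1"
    unfolding m1_def
  proof (rule For_invariant)
    show "nat (aval num ?m0) = ?n" by (simp add: initial_num)
    show "prepared G 0 ?m0" by (simp add: prepared_def initial_memory_def)
    show "prepared G i (store m' ''j'' 0 v)" if "prepared G i m'" for i m' v
      using that by (simp add: prepared_def store_apply)
    show "prepared G (Suc i) (lmem load_job m')"
      if "i < ?n" "\<And>y. y \<notin> insert ''j'' (writes load_job) \<Longrightarrow> m' y = ?m0 y" "m' ''j'' 0 = int i" "prepared G i m'" for i m'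
      by (rule load_job[OF _ that(3,1,4)]) (use that(2) in simp)
  qed
  moreover have "m1 ''in'' 0 = int ?n" unfolding m1_def by (simp add: lmem_frame initial_num)
  moreover have "m = lmem (Assign ''e'' num (N (- 1)) ;; Assign ''p'' num (N (- 1)) ;;
     Assign ''l'' num (Plus (V ''B'') (N 1))) m1"
    by (simp add: m_def load_input_def m1_def)
  ultimately show "prepared G ?n m" "m ''e'' (int ?n) = - 1" "m ''p'' (int ?n) = - 1"
    "m ''l'' (int ?n) = (\<Sum>j<?n. nonpre G deadline j) + 1"
    by (simp_all add: prepared_def store_apply)
qed

lemma aval_entry': "aval (entry x y) m = aval x m * (m ''in'' 0 + 1) + aval y m"
  by (simp add: entry_def)

lemma measure_piece:
  assumes tab: "bf.tables n T q m" and regs: "m ''j'' 0 = int j" "m ''u'' 0 = int u" "j < n" "u < n + n" "T u < T (j + n)"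
    and mono: "\<And>s t. s \<in> bf.P n T \<Longrightarrow> t \<in> bf.P n T \<Longrightarrow> s \<le> t \<Longrightarrow> m ''X'' s \<le> m ''X'' t"
  shows "lmem measure_piece m ''y'' 0 - lmem measure_piece m ''x'' 0 =
     piece (bf.P n T) (m ''X'') (m ''X'' (T j) + q j) (T u)"
proof -
  interpret bf n T q .
  let ?X = "m ''X''"
  have vals: "m ''in'' 0 = int n" "m ''T'' (int j) = T j" "m ''T'' (int j + int n) = T (j + n)"
    "m ''T'' (int u) = T u" "m ''q'' (int j) = q j"
    using tab regs by (auto simp: tables_def simp flip: of_nat_add)
  define m1 where "m1 = store m ''y'' 0 (?X (T (j + n)))"
  define m2 where "m2 = lmem (For ''v'' (Plus num num) lower_next) m1"
  \<comment> \<open>The search starts from the deadline, itself a point after \<open>T u\<close>.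
    Since \<open>y\<close> always is the value of \<open>X\<close> at some later point, monotonicity
    bounds it below by the value at the next point; the exhaustive search gives the
    converse.\<close>
  define I where "I i m' \<longleftrightarrow> (\<exists>t\<in>P. T u < t \<and> m' ''y'' 0 = ?X t) \<and> (\<forall>v<i. T u < T v \<longrightarrow> m' ''y'' 0 \<le> ?X (T v))"
    for i and m' :: memory
  have "I (n + n) m2"
    unfolding m2_def
  proof (rule For_invariant)
    show "nat (aval (Plus num num) m1) = n + n" by (simp add: m1_def store_apply vals nat_add_distrib)
    have "T (j + n) \<in> P" using regs(3) by (auto simp: P_def)
    then show "I 0 m1" using regs(5) by (auto simp: I_def m1_def store_apply)
    show "I i (store m' ''v'' 0 k)" if "I i m'" for i m' k
      using that by (simp add: I_def store_apply)
  next
    fix v m' assume v: "v < n + n" and fr: "\<And>y. y \<notin> insert ''v'' (writes lower_next) \<Longrightarrow> m' y = m1 y"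
      and v': "m' ''v'' 0 = int v" and I: "I v m'"
    have eqs: "m' ''T'' = m ''T''" "m' ''X'' = ?X" "m' ''u'' = m ''u''"
      using fr by (simp_all add: m1_def store_other)
    have Tv: "m ''T'' (int v) = T v" using tab v by (simp add: tables_def)
    have *: "lmem lower_next m' = (if T u < T v \<and> ?X (T v) < m' ''y'' 0 then store m' ''y'' 0 (?X (T v)) else m')"
      unfolding lower_next_def using v' regs(2) by (simp add: eqs vals Tv)
    have "T v \<in> P" using v by (simp add: P_def)
    then show "I (Suc v) (lmem lower_next m')"
      using I unfolding * I_def by (auto simp: store_apply less_Suc_eq)
  qed
  then obtain t where t: "t \<in> P" "T u < t" "m2 ''y'' 0 = ?X t"
    and least: "\<And>v. v < n + n \<Longrightarrow> T u < T v \<Longrightarrow> m2 ''y'' 0 \<le> ?X (T v)" unfolding I_def by blast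
  note nx = nxt[OF finite_P t(1,2)]
  have y: "m2 ''y'' 0 = ?X (nxt P (T u))"
  proof (rule antisym)
    obtain v where "v < n + n" "nxt P (T u) = T v" using nx(1) by (auto simp: P_def)
    then show "m2 ''y'' 0 \<le> ?X (nxt P (T u))" using least[of v] nx(2) by simp
    show "?X (nxt P (T u)) \<le> m2 ''y'' 0" unfolding t(3) by (rule mono[OF nx(1) t(1) nx(3)])
  qed
  have fr2: "m2 y = m y" if "y \<notin> {''y'', ''v''}" for y
    unfolding m2_def using that by (subst lmem_frame) (auto simp: m1_def store_other)
  have "lmem measure_piece m = lmem truncate_piece m2"
    using regs(1) by (simp add: measure_piece_def m2_def m1_def vals)
  then show ?thesis
    using regs(1,2) by (simp add: truncate_piece_def fr2 vals y piece_def store_apply min_def)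
qed

lemma lout_measure_piece [simp]: "lout measure_piece m = []"
  by (rule lout_silent) (simp add: measure_piece_def truncate_piece_def lower_next_def)

definition encode_pieces :: "(nat \<times> int \<times> int) list \<Rightarrow> int list" where
  "encode_pieces js = concat (map (\<lambda>(i, a, b). [int i, a, b]) js)"

lemma encode_pieces_concat: "encode_pieces (concat jss) = concat (map encode_pieces jss)"
  by (induction jss) (auto simp: encode_pieces_def)

text \<open>If several indices \<open>u\<close> carry the same time point, the same triple is listed
  repeatedly; a schedule assigns sets of intervals, so repetitions vanish.\<close>

definition pieces_of :: "network \<Rightarrow> (int \<Rightarrow> int) \<Rightarrow> (nat \<Rightarrow> int) \<Rightarrow> nat \<Rightarrow> (nat \<times> int \<times> int) list" where
  "pieces_of G X s j =
     (if \<not> preemptive (edges G ! j) then [(j, s j, s j + int (proc (edges G ! j)))]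
      else if 0 < proc (edges G ! j) then
        concat (map (\<lambda>u. if time_point G j \<le> time_point G u \<and> time_point G u < time_point G (j + length (edges G))
            then [(j, time_point G u, time_point G u + piece (points G) X (X (time_point G j) + int (proc (edges G ! j))) (time_point G u))]
            else []) [0..<length (edges G) + length (edges G)])
      else [])"

lemma set_pieces_of:
  assumes j: "j < length (edges G)"
  shows "set (pieces_of G X s j) =
     (if \<not> preemptive (edges G ! j) then {(j, s j, s j + int (proc (edges G ! j)))}
      else if 0 < proc (edges G ! j) then
        (\<lambda>t. (j, t, t + piece (points G) X (X (int (release (edges G ! j))) + int (proc (edges G ! j))) t)) `
         {t \<in> points G. int (release (edges G ! j)) \<le> t \<and> t < int (deadline (edges G ! j))}
      else {})"
proof -
  have "time_point G j = int (release (edges G ! j))" "time_point G (j + length (edges G)) = int (deadline (edges G ! j))"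
    using j by (auto simp: time_point_def)
  moreover have "points G = time_point G ` {..<length (edges G) + length (edges G)}"
    using points_eq[of G] by (simp add: bf.P_def)
  ultimately show ?thesis by (auto simp: pieces_of_def atLeast0LessThan)
qed

lemma output_schedule:
  fixes G
  defines "n \<equiv> length (edges G)"
  assumes in_eq: "m ''in'' = initial_memory (encode_network G) ''in''"
    and tab: "bf.tables n (time_point G) (pre_length G) m"
    and p: "\<And>j. j < n \<Longrightarrow> m ''p'' (int j) = nonpre G proc j"
    and s: "\<And>j. j < n \<Longrightarrow> m ''S'' ((int n * (int n + 1) + int n) * (int n + 1) + int j) = s j"
    and mono: "\<And>s t. s \<in> points G \<Longrightarrow> t \<in> points G \<Longrightarrow> s \<le> t \<Longrightarrow> m ''X'' s \<le> m ''X'' t"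
  shows "lout output_schedule m = 1 # encode_pieces (concat (map (pieces_of G (m ''X'') s) [0..<n]))"
proof -
  let ?body = "LIf (Less (in_entry 5 (V ''j'')) (N 1)) output_nonpreemptive
       (LWhen (Less (N 0) (Cell ''q'' (V ''j''))) output_preemptive)"
  have num: "m ''in'' 0 = int n" by (simp add: in_eq initial_num n_def)
  have "lout (For ''j'' num ?body) m = concat (map (\<lambda>j. encode_pieces (pieces_of G (m ''X'') s j)) [0..<n])"
  proof (rule For_output)
    show "nat (aval num m) = n" by (simp add: num)
  next
    fix j m' assume j: "j < n" and fr: "\<And>y. y \<notin> insert ''j'' (writes ?body) \<Longrightarrow> m' y = m y"
      and j': "m' ''j'' 0 = int j"
    have eqs: "m' ''in'' = m ''in''" "m' ''T'' = m ''T''" "m' ''q'' = m ''q''" "m' ''p'' = m ''p''" "m' ''S'' = m ''S''" "m' ''X'' = m ''X''"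
      using fr by simp_all
    have pre: "aval (in_entry 5 (V ''j'')) m' < 1 \<longleftrightarrow> \<not> preemptive (edges G ! j)"
      using in_entries(4)[of m' G j] j j' in_eq by (simp add: eqs n_def)
    have q: "m' ''q'' (int j) = pre_length G j" using tab j by (simp add: eqs bf.tables_def)
    show "lout ?body m' = encode_pieces (pieces_of G (m ''X'') s j)"
    proof (cases "preemptive (edges G ! j)")
      case False
      then have "nonpre G proc j = int (proc (edges G ! j))" by (simp add: nonpre_def)
      then show ?thesis using False pre j' p[OF j] s[OF j]
        by (simp add: output_nonpreemptive_def aval_entry' eqs num encode_pieces_def pieces_of_def)
    next
      case True
      show ?thesis
      proof (cases "0 < proc (edges G ! j)")
        case False
        then show ?thesis using True pre j' q by (simp add: encode_pieces_def pieces_of_def pre_length_def)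
      next
        case proc: True
        let ?T = "time_point G"
        let ?g = "\<lambda>u. if ?T j \<le> ?T u \<and> ?T u < ?T (j + n)
            then [(j, ?T u, ?T u + piece (points G) (m ''X'') (m ''X'' (?T j) + int (proc (edges G ! j))) (?T u))] else []"
        have "lout output_preemptive m' = concat (map (\<lambda>u. encode_pieces (?g u)) [0..<n + n])"
          unfolding output_preemptive_def
        proof (rule For_output)
          show "nat (aval (Plus num num) m') = n + n" by (simp add: eqs num nat_add_distrib)
        next
          fix u m2 assume u: "u < n + n" and fr2: "\<And>y. y \<notin> insert ''u'' (writes output_piece) \<Longrightarrow> m2 y = m' y"
            and u2: "m2 ''u'' 0 = int u"
          have eqs2: "m2 ''in'' = m ''in''" "m2 ''T'' = m ''T''" "m2 ''q'' = m ''q''" "m2 ''X'' = m ''X''" "m2 ''j'' = m' ''j''"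
            using fr2 by (simp_all add: eqs)
          have tab2: "bf.tables n ?T (pre_length G) m2" using tab by (simp add: bf.tables_def eqs2)
          have T: "m ''T'' (int u) = ?T u" "m ''T'' (int j) = ?T j" "m ''T'' (int j + int n) = ?T (j + n)"
            using tab u j by (auto simp: bf.tables_def simp flip: of_nat_add)
          have test: "bval in_window m2 \<longleftrightarrow> ?T j \<le> ?T u \<and> ?T u < ?T (j + n)"
            using j' u2 by (auto simp: in_window_def eqs2 T num)
          show "lout output_piece m2 = encode_pieces (?g u)"
          proof (cases "?T j \<le> ?T u \<and> ?T u < ?T (j + n)")
            case False
            then have "\<not> bval in_window m2" using test by blast
            then show ?thesis by (simp add: if_not_P[OF False] output_piece_def encode_pieces_def)
          next
            case window: True
            have "lmem measure_piece m2 ''y'' 0 - lmem measure_piece m2 ''x'' 0 =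
               piece (bf.P n ?T) (m2 ''X'') (m2 ''X'' (?T j) + pre_length G j) (?T u)"
              by (rule measure_piece[OF tab2 _ u2 j u])
                (use window j' mono in \<open>simp_all add: eqs2 n_def points_eq\<close>)
            then have "lmem measure_piece m2 ''y'' 0 - lmem measure_piece m2 ''x'' 0 =
               piece (points G) (m ''X'') (m ''X'' (?T j) + int (proc (edges G ! j))) (?T u)"
              using True by (simp add: eqs2 n_def points_eq pre_length_def)
            moreover have "lmem measure_piece m2 ''j'' = m' ''j''" "lmem measure_piece m2 ''T'' = m ''T''"
              "lmem measure_piece m2 ''u'' = m2 ''u''" by (simp_all add: lmem_frame eqs2)
            ultimately show ?thesis using window test j' u2
              by (simp add: output_piece_def encode_pieces_def T)
          qed
        qed
        then show ?thesis using True proc pre j' q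
          by (simp add: pieces_of_def encode_pieces_concat n_def pre_length_def comp_def)
      qed
    qed
  qed
  then show ?thesis
    by (simp add: output_schedule_def encode_pieces_concat comp_def)
qed

lemma lout_algorithm:
  "lout algorithm m = lout output_schedule (lmem dynamic_program (lmem bellman_ford (lmem load_input m)))"
proof -
  have "silent (load_input ;; bellman_ford ;; dynamic_program)"
    by (simp add: program_defs)
  then have "silent load_input" "silent bellman_ford" "silent dynamic_program" by simp_all
  then show ?thesis by (simp add: algorithm_def lout_silent)
qed

lemma algorithm_correct:
  assumes path: "path_network G" and ex: "\<exists>S. feasible G S"
  obtains S where "schedule_encoding (lout algorithm (initial_memory (encode_network G))) S"
    "feasible G S" "disconnected_time G S \<le> 2 * min_connectivity_opt G"
proof -
  let ?n = "length (edges G)" and ?m0 = "initial_memory (encode_network G)"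
  let ?T = "time_point G" and ?q = "pre_length G"
  obtain S0 where S0: "feasible G S0" using ex by blast
  define m1 where "m1 = lmem load_input ?m0"
  define m2 where "m2 = lmem bellman_ford m1"
  define m3 where "m3 = lmem dynamic_program m2"
  note li = load_input[of G, folded m1_def]
  have m1: "m1 y = ?m0 y" if "y \<notin> {''j'', ''r'', ''p'', ''d'', ''q'', ''e'', ''l'', ''T'', ''B''}" for y
    unfolding m1_def by (rule lmem_frame) (use that in simp)
  have m2: "m2 y = m1 y" if "y \<notin> {''t'', ''u'', ''v'', ''j'', ''X''}" for y
    unfolding m2_def by (rule lmem_frame) (use that in simp)
  have m3: "m3 y = m2 y" if "y \<notin> {''t'', ''a'', ''b'', ''J'', ''j'', ''i'', ''k'', ''u'', ''v'', ''w'', ''h'', ''x'', ''F'', ''S''}" for y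
    unfolding m3_def by (rule lmem_frame) (use that in simp)
  interpret bf ?n ?T ?q .
  have tab: "tables m1"
    unfolding tables_def
  proof (intro conjI allI impI)
    show "m1 ''in'' 0 = int ?n" by (simp add: m1 initial_num)
    show "m1 ''q'' (int j) = ?q j" if "j < ?n" for j using li(1) that by (simp add: prepared_def)
    show "m1 ''T'' (int i) = ?T i" if "i < ?n + ?n" for i
    proof (cases "i < ?n")
      case True
      then show ?thesis using li(1) by (simp add: prepared_def time_point_def)
    next
      case False
      define j where "j = i - ?n"
      have "i = j + ?n" "j < ?n" using False that by (auto simp: j_def)
      then show ?thesis using li(1) by (simp add: prepared_def time_point_def)
    qed
  qed
  have prep: "m1 ''r'' (int j) = nonpre G release j" "m1 ''p'' (int j) = nonpre G proc j"
    "m1 ''e'' (int j) = nonpre G release j + nonpre G proc j"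
    "m1 ''l'' (int j) = nonpre G deadline j - nonpre G proc j" if "j < ?n" for j
    using li(1) that by (simp_all add: prepared_def)
  define X where "X = m2 ''X''"
  \<comment> \<open>Any feasible schedule supplies the solution that Bellman-Ford needs in order to
    converge; it does not have to be optimal.\<close>
  have Y0: "satisfies (constraints P K) (\<lambda>t. measure lborel (busy_times G S0 \<inter> {0..<real_of_int t}))"
    using preemptive_constraints[OF S0] by (simp add: points_eq pre_jobs_eq)
  have X0: "m1 ''X'' v = 0" for v by (simp add: m1 initial_memory_def)
  note bfX = bellman_ford[OF tab X0 Y0 measure_nonneg, folded m2_def, folded X_def, unfolded points_eq pre_jobs_eq]
  have sat: "satisfies (constraints (points G) (pre_jobs G)) (\<lambda>v. real_of_int (X v))" by (rule bfX(1))
  interpret solved "points G" "pre_jobs G" X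
    by (rule solved.intro[OF finite_points sat])
  define B where "B = (\<Sum>j<?n. nonpre G deadline j) + 1"
  interpret dp: dp ?n "nonpre G release" "nonpre G proc" "nonpre G deadline" B
  proof (intro dp.intro dp_axioms.intro feasible_jobs[OF S0])
    fix j assume j: "j < ?n"
    show "0 \<le> nonpre G release j" by (simp add: nonpre_def)
    have "nonpre G deadline j \<le> (\<Sum>j<?n. nonpre G deadline j)"
      using j by (intro member_le_sum) (auto simp: nonpre_def)
    moreover have "0 \<le> nonpre G proc j" by (simp add: nonpre_def)
    ultimately show "jobs.l (nonpre G proc) (nonpre G deadline) j < B"
      unfolding jobs.l_def[OF feasible_jobs[OF S0]] B_def by linarith
  qed
  have "dp.tables m2"
    unfolding dp.tables_def
  proof (intro conjI allI impI)
    show "m2 ''in'' 0 = int ?n" by (simp add: m1 m2 initial_num)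
    fix j assume "j \<le> ?n"
    have eqs: "m2 ''e'' = m1 ''e''" "m2 ''l'' = m1 ''l''" "m2 ''p'' = m1 ''p''" by (simp_all add: m2)
    show "m2 ''e'' (int j) = dp.e' j" "m2 ''l'' (int j) = dp.l' j" "m2 ''p'' (int j) = dp.p' j"
      unfolding eqs dp.e'_def dp.l'_def dp.p'_def dp.e_def dp.l_def
    proof -
      consider "j < ?n" | "j = ?n" using \<open>j \<le> ?n\<close> by linarith
      then show "m1 ''e'' (int j) = (if j < ?n then nonpre G release j + nonpre G proc j else - 1)"
        "m1 ''l'' (int j) = (if j < ?n then nonpre G deadline j - nonpre G proc j else B)"
        "m1 ''p'' (int j) = (if j < ?n then nonpre G proc j else - 1)"
        using prep[of j] li(2-4) unfolding B_def by (cases; simp)+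
    qed
  next
    fix j assume "j < ?n"
    then show "m2 ''r'' (int j) = nonpre G release j" by (simp add: m2 prep)
  qed
  then have sol: "dp.solution {..<?n} (dp.F m3 ?n ?n) (dp.S m3 ?n ?n)"
    unfolding m3_def by (rule dp.dynamic_program) (simp add: m1 m2 initial_memory_def)
  define s where "s = dp.S m3 ?n ?n"
  define js where "js = concat (map (pieces_of G X s) [0..<?n])"
  have out: "lout algorithm ?m0 = 1 # encode_pieces js"
  proof -
    have "lout output_schedule m3 = 1 # encode_pieces (concat (map (pieces_of G (m3 ''X'') s) [0..<?n]))"
    proof (rule output_schedule)
      show "m3 ''in'' = ?m0 ''in''" by (simp add: m1 m2 m3)
      show "bf.tables ?n ?T ?q m3" using tab by (simp add: tables_def m2 m3)
      show "m3 ''p'' (int j) = nonpre G proc j" if "j < ?n" for j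
        using that by (simp add: m2 m3 prep)
      show "m3 ''S'' ((int ?n * (int ?n + 1) + int ?n) * (int ?n + 1) + int j) = s j" for j
        by (simp add: s_def dp.S_def dp.sidx_def dp.idx_def)
      show "m3 ''X'' s \<le> m3 ''X'' t" if "s \<in> points G" "t \<in> points G" "s \<le> t" for s t
        using X_mono[OF that] by (simp add: m3 X_def)
    qed
    then show ?thesis
      by (simp add: lout_algorithm m1_def[symmetric] m2_def[symmetric] m3_def[symmetric] js_def X_def m3)
  qed
  define S where "S = (\<lambda>i. {(real_of_int a / real_of_int 1, real_of_int b / real_of_int 1) | a b. (i, a, b) \<in> set js})"
  have enc: "schedule_encoding (lout algorithm ?m0) S"
    unfolding schedule_encoding_def out encode_pieces_def S_def by (intro exI[of _ 1] exI[of _ js]) simp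
  have mem: "(i, a, b) \<in> set js \<longleftrightarrow> (i, a, b) \<in> set (pieces_of G X s i)" if "i < ?n" for i a b
  proof -
    have "j = i" if "(i, a, b) \<in> set (pieces_of G X s j)" "j < ?n" for j
      using that(1) unfolding set_pieces_of[OF that(2)] by (auto split: if_splits)
    moreover have "(i, a, b) \<in> set js \<longleftrightarrow> (\<exists>j<?n. (i, a, b) \<in> set (pieces_of G X s j))"
      by (auto simp: js_def)
    ultimately show ?thesis using that by blast
  qed
  have "feasible G S \<and> disconnected_time G S \<le> 2 * min_connectivity_opt G"
  proof (rule union_schedule[OF path ex sol sat])
    show "0 \<le> X v" for v by (rule bfX(2))
    show "real_of_int (X v) \<le> Y v" if "satisfies (constraints (points G) (pre_jobs G)) Y"
      "\<And>v. v \<in> points G \<Longrightarrow> 0 \<le> Y v" "v \<in> points G" for Y :: "int \<Rightarrow> real" and v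
      by (rule bfX(3)[OF that])
    show "S j = {(real_of_int (dp.S m3 ?n ?n j), real_of_int (dp.S m3 ?n ?n j + int (proc (edges G ! j))))}"
      if "j < ?n" "\<not> preemptive (edges G ! j)" for j
      unfolding S_def mem[OF that(1)] set_pieces_of[OF that(1)] using that(2) by (auto simp: s_def)
    show "S j = {}" if "j < ?n" "preemptive (edges G ! j)" "proc (edges G ! j) = 0" for j
      unfolding S_def mem[OF that(1)] set_pieces_of[OF that(1)] using that(2,3) by simp
    show "S j = (\<lambda>t. (real_of_int t, real_of_int (t + piece (points G) X
          (X (int (release (edges G ! j))) + int (proc (edges G ! j))) t))) `
         {t \<in> points G. int (release (edges G ! j)) \<le> t \<and> t < int (deadline (edges G ! j))}"
      if "j < ?n" "preemptive (edges G ! j)" "0 < proc (edges G ! j)" for j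
      unfolding S_def mem[OF that(1)] set_pieces_of[OF that(1)] using that(2,3) by (auto simp: image_iff)
  qed
  then show ?thesis using that enc by blast
qed

theorem theorem10:
  "\<exists>c. polynomial_approximation_on {G. path_network G} 2 c"
proof
  let ?X = "encode_network ` {G. path_network G}"
  \<comment> \<open>The input has \<open>3 + 6 * n\<close> entries, so the loop bounds
    \<open>n\<close>, \<open>n + 1\<close> and \<open>2 * n\<close> are linear in its length, for
    infeasible instances as well.\<close>
  have bounds: "aval e m \<le> 2 * int (length xs) + 1"
    if xs: "xs \<in> ?X" and em: "e \<in> loop_bounds algorithm" "m ''in'' = initial_memory xs ''in''" for xs e m
  proof -
    obtain G where "xs = encode_network G" using xs by blast
    then have "m ''in'' 0 \<le> int (length xs)" "0 \<le> m ''in'' 0"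
      using em(2) by (simp_all add: initial_num length_encode_network)
    then show ?thesis using em(1) loop_bounds_algorithm by auto
  qed
  show "polynomial_approximation_on {G. path_network G} 2 (compile algorithm)"
    unfolding polynomial_approximation_on_def
  proof (intro conjI ballI impI)
    show "polynomial_time_on ?X (compile algorithm)"
      by (rule compile_polynomial(1)[OF well_formed_algorithm in_not_written bounds])
    fix G assume G: "G \<in> {G. path_network G}" and ex: "\<exists>S. feasible G S"
    obtain S where "schedule_encoding (lout algorithm (initial_memory (encode_network G))) S"
      "feasible G S" "disconnected_time G S \<le> 2 * min_connectivity_opt G"
      using algorithm_correct[of G] G ex by blast
    moreover obtain t where "run (compile algorithm) (encode_network G) t (lout algorithm (initial_memory (encode_network G)))"
      using compile_polynomial(2)[OF well_formed_algorithm in_not_written bounds] G by blast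
    ultimately show "\<exists>t ys S. run (compile algorithm) (encode_network G) t ys \<and> schedule_encoding ys S \<and>
        feasible G S \<and> disconnected_time G S \<le> 2 * min_connectivity_opt G" by blast
  qed
qed

end
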